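(* Let $0<T<\infty$, $\alpha_0>0$, and let $\mu_0$ be a Borel measure on $\mathbb R^D$ of total mass $1$ with $\int e^{\alpha_0|x|}d\mu_0<\infty$. Assume the dynamical hypothesis (stated in the context). For $\varepsilon>0$ and $n\ge1$ let $(\mu_t^{\varepsilon,n})_{t\in[0,T]}$ be the time-discretized measures with initial datum $\mu_0$ defined in the context. Then there exist a sequence $(\varepsilon_k,n_k)\to(0,\infty)$ and measures $(\mu_t)_{t\in[0,T]}$, starting at $\mu_0$, such that $\mu_t^{\varepsilon_k,n_k}\rightharpoonup\mu_t$ in the sense of distributions for every $t\in[0,T]$, and (i) $t\mapsto\mu_t$ is a distributionally continuous path of finite Borel measures, and $\mu_t(\mathbb R^D)\le1$ for $t\in[0,T]$; (ii) $(\mu_t)_{t\in[0,T]}$ satisfies the Hamiltonian ODE $$\partial_t\mu_t+\nabla\cdot\big(J\nabla_W\mathcal H(\mu_t)\,\mu_t\big)=0$$ in the sense of distributions on $(0,T)\times\mathbb R^D$.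
   Context: Let $D=2d$ and write points of $\mathbb R^D$ as $x=(p,q)$, $p,q\in\mathbb R^d$. $W\in C_c^2(\mathbb R^d)$ is even, and $\Phi\in C^2(\mathbb R^d)$ satisfies $|\Phi(q)|\le B_1|q|^{b_2}$ for finite constants $B_1,b_2$. For a finite Borel measure $\mu$ on $\mathbb R^D$, $(W*\mu)(q)=\int W(q-q')\,d\mu(p',q')$. With $\mathcal H(\mu)=\frac12\int|p|^2d\mu+\frac12\int(W*\mu)(q)d\mu+\int\Phi(q)d\mu$ one sets $\nabla_W\mathcal H(\mu)(p,q)=(p,\nabla(W*\mu+\Phi)(q))$ and $J(p,q)=(-q,p)$, so $J\nabla_W\mathcal H(\mu)(p,q)=(-\nabla(W*\mu+\Phi)(q),\,p)$. Distributional convergence $\mu_n\rightharpoonup\mu$: $\int\varphi\,d\mu_n\to\int\varphi\,d\mu$ for all $\varphi\in C_c^\infty(\mathbb R^D)$; distributional continuity is continuity of $t\mapsto\int\varphi\,d\mu_t$ for all such $\varphi$. Time-discretized measures. For $n\ge1$ let $h=T/n$ and $\mu_0^{\varepsilon,n}=\mu_0$. Given $\mu_{kh}^{\varepsilon,n}$, let $v=J\nabla_W\mathcal H(\mu_{kh}^{\varepsilon,n})$ (a time-independent $C^1$ field), let $Y_s(x)$ be the maximal solution of $\dot Y_s=v(Y_s)$, $Y_0=x$, with lifetime $\sigma(x)$, and for $s\in[0,h]$ define $\mu^{\varepsilon,n}_{kh+s}$ by $\int\psi\,d\mu^{\varepsilon,n}_{kh+s}=\int_{\{\sigma>s\}}\psi(Y_s(x))\exp\big(-\varepsilon\int_0^s|\dot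 Y_r(x)|dr\big)d\mu_{kh}^{\varepsilon,n}(x)$ for bounded continuous $\psi$. Dynamical hypothesis. Let $B>0$ satisfy $|W|\le B$ and $|\nabla W|<B$. There exist $u\in C^2(\mathbb R)$ with $$u'(r)\ge B+\max_{|q|=r}\langle\nabla\Phi(q),\hat q\rangle,\quad r\ge0,\qquad \hat q=q/|q|$$ (at $r=0$ the right-hand side is read as its limit as $r\to0^+$), and, with $\Upsilon(q)=u(|q|)$, a sequence $\{q_L^\star\}_{L\ge1}\subset\mathbb R^d$ with $|q_L^\star|$ increasing to $\infty$ and $\Upsilon(q)<\Upsilon(q_L^\star)$ for all $|q|>|q_L^\star|$ and all $L$. *)

theory Defs
  imports "HOL-Analysis.Analysis"
begin

section \<open>Smoothness and test functions\<close>

text \<open>Continuous differentiability of order \<open>k\<close> on the whole space, phrased by directional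
  derivatives. In finite dimension this is the usual class \<open>C^k\<close>.\<close>

primrec Ck :: "nat \<Rightarrow> ('a::real_normed_vector \<Rightarrow> 'b::real_normed_vector) \<Rightarrow> bool" where
  "Ck 0 f \<longleftrightarrow> continuous_on UNIV f"
| "Ck (Suc k) f \<longleftrightarrow>
     (\<forall>x. f differentiable (at x)) \<and> (\<forall>v. Ck k (\<lambda>x. frechet_derivative f (at x) v))"

definition grad :: "('a::euclidean_space \<Rightarrow> real) \<Rightarrow> 'a \<Rightarrow> 'a" where
  "grad f x = (THE D. GDERIV f x :> D)"

definition supp :: "('a::topological_space \<Rightarrow> real) \<Rightarrow> 'a set" where
  "supp f = closure {x. f x \<noteq> 0}"

definition test_function :: "('a::euclidean_space \<Rightarrow> real) \<Rightarrow> bool" where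
  "test_function \<phi> \<longleftrightarrow> (\<forall>k. Ck k \<phi>) \<and> compact (supp \<phi>)"


section \<open>The Hamiltonian vector field\<close>

text \<open>Phase space points are pairs \<open>(p, q)\<close>: momentum first, position second.\<close>

definition conv :: "('a::euclidean_space \<Rightarrow> real) \<Rightarrow> ('a \<times> 'a) measure \<Rightarrow> 'a \<Rightarrow> real" where
  "conv W \<mu> q = (\<integral>x. W (q - snd x) \<partial>\<mu>)"

definition grad_H ::
  "('a::euclidean_space \<Rightarrow> real) \<Rightarrow> ('a \<Rightarrow> real) \<Rightarrow> ('a \<times> 'a) measure \<Rightarrow> 'a \<times> 'a \<Rightarrow> 'a \<times> 'a" where
  "grad_H W \<Phi> \<mu> = (\<lambda>(p, q). (p, grad (\<lambda>q'. conv W \<mu> q' + \<Phi> q') q))"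

definition J :: "'a::euclidean_space \<times> 'a \<Rightarrow> 'a \<times> 'a" where
  "J = (\<lambda>(p, q). (- q, p))"

definition ham_field ::
  "('a::euclidean_space \<Rightarrow> real) \<Rightarrow> ('a \<Rightarrow> real) \<Rightarrow> ('a \<times> 'a) measure \<Rightarrow> 'a \<times> 'a \<Rightarrow> 'a \<times> 'a" where
  "ham_field W \<Phi> \<mu> x = J (grad_H W \<Phi> \<mu> x)"


section \<open>Maximal solutions of autonomous ODEs\<close>

definition solves_upto ::
  "('a::euclidean_space \<Rightarrow> 'a) \<Rightarrow> 'a \<Rightarrow> ereal \<Rightarrow> (real \<Rightarrow> 'a) \<Rightarrow> bool" where
  "solves_upto v x \<tau> y \<longleftrightarrow> y 0 = x \<and>
     (\<forall>s. 0 \<le> s \<and> ereal s < \<tau> \<longrightarrow>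
        (y has_vector_derivative v (y s)) (at s within {r. 0 \<le> r \<and> ereal r < \<tau>}))"

definition lifetime :: "('a::euclidean_space \<Rightarrow> 'a) \<Rightarrow> 'a \<Rightarrow> ereal" where
  "lifetime v x = Sup {\<tau>. \<exists>y. solves_upto v x \<tau> y}"

text \<open>For a \<open>C^1\<close> field the chosen solution is unique on \<open>[0, lifetime v x)\<close>; its values
  at later times are arbitrary and must not be used.\<close>

definition max_sol :: "('a::euclidean_space \<Rightarrow> 'a) \<Rightarrow> 'a \<Rightarrow> real \<Rightarrow> 'a" where
  "max_sol v x = (SOME y. solves_upto v x (lifetime v x) y)"

definition path_length :: "('a::euclidean_space \<Rightarrow> 'a) \<Rightarrow> 'a \<Rightarrow> real \<Rightarrow> real" where
  "path_length v x s =
     integral {0..s} (\<lambda>r. norm (vector_derivative (max_sol v x) (at r within {0..s})))"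


section \<open>Time-discretized measures\<close>

text \<open>Finite Borel measures on a Euclidean space are determined by their integrals of bounded
  continuous functions, which makes the description below definite.\<close>

definition step ::
  "real \<Rightarrow> ('a::euclidean_space \<Rightarrow> 'a) \<Rightarrow> real \<Rightarrow> 'a measure \<Rightarrow> 'a measure" where
  "step \<epsilon> v s \<mu> = (THE \<nu>. sets \<nu> = sets borel \<and> finite_measure \<nu> \<and>
     (\<forall>\<psi>::'a \<Rightarrow> real. continuous_on UNIV \<psi> \<and> bounded (range \<psi>) \<longrightarrow>
        (\<integral>x. \<psi> x \<partial>\<nu>) =
        (LINT x:{x. ereal s < lifetime v x}|\<mu>.
            \<psi> (max_sol v x s) * exp (- \<epsilon> * path_length v x s))))"

primrec grid_measure ::
  "('a::euclidean_space \<Rightarrow> real) \<Rightarrow> ('a \<Rightarrow> real) \<Rightarrow> real \<Rightarrow> real \<Rightarrow> ('a \<times> 'a) measure \<Rightarrow>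
     nat \<Rightarrow> ('a \<times> 'a) measure" where
  "grid_measure W \<Phi> \<epsilon> h \<mu>0 0 = \<mu>0"
| "grid_measure W \<Phi> \<epsilon> h \<mu>0 (Suc k) =
     step \<epsilon> (ham_field W \<Phi> (grid_measure W \<Phi> \<epsilon> h \<mu>0 k)) h (grid_measure W \<Phi> \<epsilon> h \<mu>0 k)"

text \<open>Time \<open>t\<close> is written as \<open>k h + s\<close> with \<open>h = T / n\<close>, \<open>k = floor (t / h)\<close>, \<open>0 \<le> s < h\<close>. At a
  grid time this takes \<open>s = 0\<close>, which agrees with the endpoint \<open>s = h\<close> of the preceding step.\<close>

definition discr_measure ::
  "('a::euclidean_space \<Rightarrow> real) \<Rightarrow> ('a \<Rightarrow> real) \<Rightarrow> real \<Rightarrow> ('a \<times> 'a) measure \<Rightarrow>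
     real \<Rightarrow> nat \<Rightarrow> real \<Rightarrow> ('a \<times> 'a) measure" where
  "discr_measure W \<Phi> T \<mu>0 \<epsilon> n t =
     (let h = T / real n; k = nat \<lfloor>t / h\<rfloor>; \<mu> = grid_measure W \<Phi> \<epsilon> h \<mu>0 k
      in step \<epsilon> (ham_field W \<Phi> \<mu>) (t - real k * h) \<mu>)"


section \<open>Dynamical hypothesis\<close>

definition radial_max :: "('a::euclidean_space \<Rightarrow> real) \<Rightarrow> real \<Rightarrow> real" where
  "radial_max \<Phi> r = (SUP q\<in>sphere 0 r. grad \<Phi> q \<bullet> (q /\<^sub>R norm q))"

definition dynamical_hypothesis :: "('a::euclidean_space \<Rightarrow> real) \<Rightarrow> real \<Rightarrow> bool" where
  "dynamical_hypothesis \<Phi> B \<longleftrightarrow>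
     (\<exists>(u::real \<Rightarrow> real) (q\<^sub>L::nat \<Rightarrow> 'a).
        Ck 2 u \<and>
        (\<forall>r>0. deriv u r \<ge> B + radial_max \<Phi> r) \<and>
        deriv u 0 \<ge> B + Lim (at_right 0) (radial_max \<Phi>) \<and>
        mono_on {1..} (\<lambda>L. norm (q\<^sub>L L)) \<and>
        filterlim (\<lambda>L. norm (q\<^sub>L L)) at_top sequentially \<and>
        (\<forall>L\<ge>1. \<forall>q::'a. norm q > norm (q\<^sub>L L) \<longrightarrow> u (norm q) < u (norm (q\<^sub>L L))))"


section \<open>Distributional notions\<close>

definition distr_tendsto ::
  "(nat \<Rightarrow> 'a::euclidean_space measure) \<Rightarrow> 'a measure \<Rightarrow> bool" where
  "distr_tendsto \<mu>s \<mu> \<longleftrightarrow>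
     (\<forall>\<phi>. test_function \<phi> \<longrightarrow> (\<lambda>k. \<integral>x. \<phi> x \<partial>\<mu>s k) \<longlonglongrightarrow> (\<integral>x. \<phi> x \<partial>\<mu>))"

definition distr_continuous_on ::
  "real set \<Rightarrow> (real \<Rightarrow> 'a::euclidean_space measure) \<Rightarrow> bool" where
  "distr_continuous_on I \<mu> \<longleftrightarrow>
     (\<forall>\<phi>. test_function \<phi> \<longrightarrow> continuous_on I (\<lambda>t. \<integral>x. \<phi> x \<partial>\<mu> t))"

text \<open>Weak form of the continuity equation with velocity field \<open>ham_field W \<Phi> (\<mu> t)\<close>. The
  integrability clauses rule out Bochner integrals that are zero by convention.\<close>

definition hamiltonian_ODE ::
  "('a::euclidean_space \<Rightarrow> real) \<Rightarrow> ('a \<Rightarrow> real) \<Rightarrow> real \<Rightarrow> (real \<Rightarrow> ('a \<times> 'a) measure) \<Rightarrow> bool" where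
  "hamiltonian_ODE W \<Phi> T \<mu> \<longleftrightarrow>
     (\<forall>\<phi>::real \<times> ('a \<times> 'a) \<Rightarrow> real. test_function \<phi> \<and> supp \<phi> \<subseteq> {0<..<T} \<times> UNIV \<longrightarrow>
        (let g = (\<lambda>t x. deriv (\<lambda>s. \<phi> (s, x)) t
                        + grad (\<lambda>y. \<phi> (t, y)) x \<bullet> ham_field W \<Phi> (\<mu> t) x)
         in (\<forall>t\<in>{0<..<T}. integrable (\<mu> t) (g t)) \<and>
            set_integrable lborel {0<..<T} (\<lambda>t. \<integral>x. g t x \<partial>\<mu> t) \<and>
            (LINT t:{0<..<T}|lborel. (\<integral>x. g t x \<partial>\<mu> t)) = 0))"

end

theory Submission
  imports Defs "HOL-Complex_Analysis.Great_Picard"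
begin

text \<open>Every discretized measure is the image of \<open>\<mu>0\<close>, restricted to the particles still alive and damped by
  the path length, under the flow of a time-dependent field \<open>(p, q) \<mapsto> (- (G t q + grad \<Phi> q), p)\<close>, and the
  limit is built in the same Lagrangian form, so no compactness of measures is needed. Since
  \<open>norm (grad W)\<close> stays strictly below \<open>B\<close>, the dynamical hypothesis makes the region outside a peak
  \<open>q\<^sub>L\<close> absorbing: a particle that starts inside and is seen inside has never been outside, so its
  momentum is bounded independently of the discretization. Hence the mean-field forces
  \<open>G t q = (\<integral>x. grad W (q - snd x) \<partial>\<mu> t)\<close> are equicontinuous in time and converge along a subsequence.
  Their flows then converge on the trajectories that survive, while a particle whose limit trajectory
  explodes is eventually invisible to compactly supported test functions. Dominated convergence
  gives convergence of the measures and identifies the limit force; the weak equation is the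
  fundamental theorem of calculus along each trajectory.\<close>

section \<open>Global Picard iteration and flows of time-dependent fields\<close>

text \<open>The force kernel \<open>grad W (q - snd x)\<close> has bounded support in position but
  not in momentum, so convergence against compactly supported test functions alone would not give
  convergence of the forces: mass could run off to infinite momentum while its position stays
  visible. This is why the limit statements are made for bounded continuous functions that vanish at
  large positions only, and why each starting point is followed separately. The second obstacle is
  uniformity. \<open>grad \<Phi>\<close> is only locally Lipschitz and trajectories may explode, so
  constants have to be fixed before the force is chosen: one function \<open>C\<close> serves all
  fields that occur, and barriers at arbitrarily large radii confine whatever is still visible. The
  third is circularity, since the limit force should come from the limit measures. It is broken by
  extracting a limit of the forces first, transporting \<open>\<mu>0\<close> along the resulting
  flow, and only then checking that the transported measures generate that force.\<close>

lemma compact_image_norm_bound: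
  assumes "continuous_on S f" "compact S"
  obtains b where "\<And>x. x \<in> S \<Longrightarrow> norm (f x) \<le> b"
  using compact_imp_bounded[OF compact_continuous_image[OF assms]] by (auto simp: bounded_iff)

text \<open>Discounted by \<open>exp (- L * r)\<close>, the right-hand side
  \<open>c + L * integral {0..r} w\<close> does not increase: its derivative is
  \<open>L * exp (- L * r)\<close> times the difference between \<open>w r\<close> and that
  right-hand side.\<close>

lemma gronwall:
  fixes w :: "real \<Rightarrow> real"
  assumes cont: "continuous_on {0..t} w" and L: "0 \<le> L" 
    and le: "\<And>s. s \<in> {0..t} \<Longrightarrow> w s \<le> c + L * integral {0..s} w" and s: "s \<in> {0..t}"
  shows "w s \<le> c * exp (L * s)"
proof -
  define z where "z r = (c + L * integral {0..r} w) * exp (- L * r)" for r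
  have deriv: "(z has_real_derivative (L * w r * exp (- L * r) - L * exp (- L * r) * (c + L * integral {0..r} w)))
      (at r within {0..t})" if "r \<in> {0..t}" for r
  proof -
    have "((\<lambda>r. integral {0..r} w) has_real_derivative w r) (at r within {0..t})"
      using integral_has_real_derivative[OF cont that] .
    then show ?thesis unfolding z_def
      by (auto intro!: derivative_eq_intros simp: algebra_simps)
  qed
  have "z s \<le> z 0"
  proof (rule DERIV_nonpos_imp_decreasing_open[where f = z and a = 0 and b = s])
    show "0 \<le> s" using s by simp
    have "continuous_on {0..t} z"
      by (rule DERIV_continuous_on) (rule deriv)
    then show "continuous_on {0..s} z"
      by (rule continuous_on_subset) (use s in auto)
    fix r assume r: "0 < r" "r < s"
    have eq: "at r within {0..t} = at r"
      using r s by (intro at_within_interior) auto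
    moreover have "L * w r * exp (- L * r) - L * exp (- L * r) * (c + L * integral {0..r} w) \<le> 0"
    proof -
      have "L * exp (- L * r) * (w r - (c + L * integral {0..r} w)) \<le> 0"
        using le[of r] r s L by (intro mult_nonneg_nonpos) auto
      then show ?thesis by (simp add: algebra_simps)
    qed
    ultimately show "\<exists>y. (z has_real_derivative y) (at r) \<and> y \<le> 0"
      using deriv[of r, unfolded eq] r s by auto
  qed
  also have "z 0 = c" by (simp add: z_def)
  finally have "(c + L * integral {0..s} w) * exp (- L * s) \<le> c" by (simp add: z_def)
  then have "c + L * integral {0..s} w \<le> c * exp (L * s)"
    by (simp add: exp_minus field_simps)
  with le[OF s] show ?thesis by simp
qed

text \<open>Bielecki's weighted norm makes the Picard map a contraction on the whole interval at
  once, so no short-time solutions have to be glued. In time the field is only asked to be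
  integrable along continuous curves, since the fields of the scheme jump at grid times.\<close>

lemma picard_global:
  fixes g :: "real \<Rightarrow> 'a::euclidean_space \<Rightarrow> 'a"
  assumes t: "0 \<le> t" and L: "0 < L" 
    and lip: "\<And>r x y. norm (g r x - g r y) \<le> L * norm (x - y)"
    and int: "\<And>y. continuous_on UNIV y \<Longrightarrow> (\<lambda>r. g r (y r)) integrable_on {0..t}"
  obtains y where "continuous_on UNIV y"
    "\<And>s. s \<in> {0..t} \<Longrightarrow> ((\<lambda>r. g r (y r)) has_integral (y s - x)) {0..s}"
proof -
  \<comment> \<open>Clamping time to \<open>{0..t}\<close> turns curves on the interval into bounded
    continuous functions on the whole line, a complete space.\<close>
  define c where "c s = max 0 (min t s)" for s
  \<comment> \<open>Written for \<open>u s = exp (- 2 * L * s) *\<^sub>R y s\<close>, so that the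
    plain sup distance of \<open>u\<close> is the weighted distance of \<open>y\<close>.\<close>
  define \<Psi>0 where "\<Psi>0 u s = exp (- 2 * L * s) *\<^sub>R (x + integral {0..s} (\<lambda>r. g r (exp (2 * L * r) *\<^sub>R u r)))" for u s
  have c: "c s \<in> {0..t}" for s using t by (auto simp: c_def)
  have cid: "c s = s" if "s \<in> {0..t}" for s using that by (auto simp: c_def)
  have ccont: "continuous_on UNIV c" unfolding c_def by (intro continuous_intros)
  have int': "(\<lambda>r. g r (exp (2 * L * r) *\<^sub>R u r)) integrable_on {0..t}" if "continuous_on UNIV u" for u
    by (rule int) (intro continuous_intros that)
  have cont0: "continuous_on {0..t} (\<Psi>0 u)" if "continuous_on UNIV u" for u
    unfolding \<Psi>0_def by (intro continuous_intros indefinite_integral_continuous_1 int' that)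
  have bc: "(\<lambda>s. \<Psi>0 u (c s)) \<in> bcontfun" if "continuous_on UNIV u" for u
  proof -
    have "continuous_on UNIV (\<lambda>s. \<Psi>0 u (c s))"
      by (rule continuous_on_compose2[OF cont0[OF that] ccont]) (use c in auto)
    moreover have "bounded (\<Psi>0 u ` {0..t})"
      by (intro compact_imp_bounded compact_continuous_image cont0 that) auto
    then have "bounded (range (\<lambda>s. \<Psi>0 u (c s)))"
      by (rule bounded_subset) (use c in auto)
    ultimately show ?thesis by (simp add: bcontfun_def)
  qed
  define \<Psi> where "\<Psi> u = Bcontfun (\<lambda>s. \<Psi>0 (apply_bcontfun u) (c s))" for u
  have \<Psi>: "apply_bcontfun (\<Psi> u) s = \<Psi>0 (apply_bcontfun u) (c s)" for u s
    unfolding \<Psi>_def by (subst Bcontfun_inverse) (auto intro: bc)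
  have contr: "dist (\<Psi> u) (\<Psi> v) \<le> (1/2) * dist u v" for u v
  proof (rule dist_bound)
    fix s
    define d where "d = dist u v"
    have d: "norm (apply_bcontfun u r - apply_bcontfun v r) \<le> d" for r
      unfolding d_def by (metis dist_bounded dist_norm)
    let ?a = "c s"
    let ?G = "\<lambda>u r. g r (exp (2 * L * r) *\<^sub>R apply_bcontfun u r)"
    have sub: "?G u integrable_on {0..?a}" for u
      by (rule integrable_subinterval_real[OF int']) (use c in auto)
    \<comment> \<open>Integrating \<open>L * exp (2 * L * r)\<close> produces the factor 1/2; the
      exponent \<open>2 * L\<close> is chosen for this.\<close>
    have hi: "((\<lambda>r. L * exp (2 * L * r) * d) has_integral (d/2 * exp (2 * L * ?a) - d/2 * exp (2*L*0))) {0..?a}"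
      by (rule fundamental_theorem_of_calculus)
        (use c in \<open>auto intro!: derivative_eq_intros simp: has_real_derivative_iff_has_vector_derivative[symmetric]\<close>)
    have "norm (integral {0..?a} (\<lambda>r. ?G u r - ?G v r)) \<le> integral {0..?a} (\<lambda>r. L * exp (2 * L * r) * d)"
    proof (rule integral_norm_bound_integral)
      fix r
      have "norm (?G u r - ?G v r) \<le> L * norm (exp (2 * L * r) *\<^sub>R apply_bcontfun u r - exp (2 * L * r) *\<^sub>R apply_bcontfun v r)"
        by (rule lip)
      also have "\<dots> = L * exp (2 * L * r) * norm (apply_bcontfun u r - apply_bcontfun v r)"
        by (simp flip: scaleR_diff_right)
      also have "\<dots> \<le> L * exp (2 * L * r) * d"
        using L by (intro mult_left_mono d) auto
      finally show "norm (?G u r - ?G v r) \<le> L * exp (2 * L * r) * d" .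
    qed (use hi in \<open>auto intro: integrable_diff sub\<close>)
    also have "\<dots> = d/2 * exp (2 * L * ?a) - d/2" using integral_unique[OF hi] by simp
    finally have *: "norm (integral {0..?a} (\<lambda>r. ?G u r - ?G v r)) \<le> d/2 * exp (2 * L * ?a) - d/2" .
    have "dist (\<Psi> u s) (\<Psi> v s) = exp (- 2 * L * ?a) * norm (integral {0..?a} (\<lambda>r. ?G u r - ?G v r))"
      by (simp add: \<Psi> \<Psi>0_def dist_norm integral_diff[OF sub sub] flip: scaleR_diff_right)
    also have "\<dots> \<le> exp (- 2 * L * ?a) * (d/2 * exp (2 * L * ?a) - d/2)"
      by (intro mult_left_mono *) auto
    also have "\<dots> = d/2 - d/2 * exp (- 2 * L * ?a)"
      by (simp add: algebra_simps exp_minus)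
    also have "\<dots> \<le> d/2" by (simp add: d_def)
    finally show "dist (\<Psi> u s) (\<Psi> v s) \<le> (1/2) * dist u v" by (simp add: d_def)
  qed
  have "\<exists>!u. \<Psi> u = u"
    by (rule banach_fix_type[of "1/2"]) (use contr in auto)
  then obtain u where u: "\<Psi> u = u" by auto
  define y where "y s = exp (2 * L * s) *\<^sub>R apply_bcontfun u s" for s
  show ?thesis
  proof
    show "continuous_on UNIV y" unfolding y_def by (intro continuous_intros) auto
    fix s assume s: "s \<in> {0..t}"
    have "apply_bcontfun u s = \<Psi>0 (apply_bcontfun u) s" using \<Psi>[of u s] u cid[OF s] by simp
    then have "y s = x + integral {0..s} (\<lambda>r. g r (y r))"
      by (simp add: y_def \<Psi>0_def exp_minus)
    moreover have "(\<lambda>r. g r (y r)) integrable_on {0..s}"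
      by (rule integrable_subinterval_real[OF int[OF \<open>continuous_on UNIV y\<close>]]) (use s in auto)
    ultimately show "((\<lambda>r. g r (y r)) has_integral (y s - x)) {0..s}"
      by (simp add: has_integral_integral)
  qed
qed

text \<open>\<open>C R\<close> bounds both the size and the Lipschitz constant on the ball of radius
  \<open>R\<close>, uniformly over all real times. Keeping \<open>C\<close> as a parameter lets a
  whole sequence of fields and its limit share it. The finite set \<open>K\<close> of jump times is
  common to all points \<open>x\<close>.\<close>

definition regular :: "(real \<Rightarrow> real) \<Rightarrow> (real \<Rightarrow> 'a::euclidean_space \<Rightarrow> 'a) \<Rightarrow> bool" where
  "regular C f \<longleftrightarrow>
     (\<forall>R t. \<forall>x\<in>cball 0 R. norm (f t x) \<le> C R \<and>
        (\<forall>y\<in>cball 0 R. norm (f t x - f t y) \<le> C R * norm (x - y))) \<and>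
     (\<exists>K. finite K \<and> (\<forall>x. continuous_on (- K) (\<lambda>t. f t x)))"

lemma regular_bound: "regular C f \<Longrightarrow> norm x \<le> R \<Longrightarrow> norm (f t x) \<le> C R"
  by (simp add: regular_def)

lemma regular_lipschitz:
  "regular C f \<Longrightarrow> norm x \<le> R \<Longrightarrow> norm y \<le> R \<Longrightarrow> norm (f t x - f t y) \<le> C R * norm (x - y)"
  by (simp add: regular_def)

lemma regular_nonneg: "regular C f \<Longrightarrow> 0 \<le> R \<Longrightarrow> 0 \<le> C R"
  using regular_bound[of C f 0 R] norm_ge_zero order_trans by (metis norm_zero)

text \<open>The Lipschitz bound in space is uniform in time, so continuity in time at each fixed
  point upgrades to joint continuity off the jump times.\<close>

lemma regular_tendsto:
  assumes f: "regular C f" and K: "finite K" "continuous_on (- K) (\<lambda>t. f t x)"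
    and t: "t \<notin> K" and \<sigma>: "(\<sigma> \<longlongrightarrow> t) F" and y: "(y \<longlongrightarrow> x) F"
  shows "((\<lambda>a. f (\<sigma> a) (y a)) \<longlongrightarrow> f t x) F"
proof -
  have "isCont (\<lambda>t. f t x) t"
    using K t by (intro continuous_on_interior[of "- K"]) (auto simp: interior_open open_Compl finite_imp_closed)
  then have 1: "((\<lambda>a. f (\<sigma> a) x) \<longlongrightarrow> f t x) F"
    by (rule isCont_tendsto_compose) (rule \<sigma>)
  have "((\<lambda>a. f (\<sigma> a) (y a) - f (\<sigma> a) x) \<longlongrightarrow> 0) F"
  proof (rule Lim_null_comparison)
    have "((\<lambda>a. norm (y a)) \<longlongrightarrow> norm x) F" by (intro tendsto_intros y)
    then have "\<forall>\<^sub>F a in F. norm (y a) < norm x + 1" by (rule order_tendstoD) simp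
    then show "\<forall>\<^sub>F a in F. norm (f (\<sigma> a) (y a) - f (\<sigma> a) x) \<le> C (norm x + 1) * norm (y a - x)"
      by eventually_elim (rule regular_lipschitz[OF f]; simp)
    show "((\<lambda>a. C (norm x + 1) * norm (y a - x)) \<longlongrightarrow> 0) F"
      using y by (intro tendsto_mult_right_zero tendsto_norm_zero) (simp add: LIM_zero)
  qed
  from tendsto_add[OF this 1] show ?thesis by simp
qed

lemma regular_continuous_compose:
  assumes f: "regular C f" and K: "finite K" "\<And>x. continuous_on (- K) (\<lambda>t. f t x)"
    and y: "continuous_on S y"
  shows "continuous_on (S - K) (\<lambda>r. f r (y r))"
  unfolding continuous_on_def
proof
  fix t assume t: "t \<in> S - K"
  have "(y \<longlongrightarrow> y t) (at t within S - K)"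
    using y t continuous_on_subset[of S y "S - K"] by (auto simp: continuous_on_def)
  then show "((\<lambda>r. f r (y r)) \<longlongrightarrow> f t (y t)) (at t within S - K)"
    using t by (intro regular_tendsto[OF f K]) auto
qed

lemma regular_absolutely_integrable:
  assumes f: "regular C f" and y: "continuous_on {a..b} y"
  shows "(\<lambda>r. f r (y r)) absolutely_integrable_on {a..b}"
proof -
  obtain K where K: "finite K" "\<And>x. continuous_on (- K) (\<lambda>t. f t x)"
    using f by (auto simp: regular_def)
  obtain R where R: "\<And>r. r \<in> {a..b} \<Longrightarrow> norm (y r) \<le> R"
    using compact_image_norm_bound[OF y compact_Icc] by metis
  \<comment> \<open>Extending \<open>y\<close> by its end values gives a function on the whole line
    that is continuous off the jump times, hence Borel.\<close>
  define c where "c s = max a (min b s)" for s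
  have "(\<lambda>r. f r (y (c r))) \<in> borel_measurable borel" if "a \<le> b"
  proof (rule borel_measurable_continuous_countable_exceptions[of K])
    have "continuous_on UNIV (\<lambda>r. y (c r))"
      by (rule continuous_on_compose2[OF y]) (use that in \<open>auto simp: c_def intro!: continuous_intros\<close>)
    from regular_continuous_compose[OF f K this]
    show "continuous_on (- K) (\<lambda>r. f r (y (c r)))" by (simp add: Compl_eq_Diff_UNIV)
  qed (use K in \<open>auto intro: countable_finite\<close>)
  then have m: "(\<lambda>r. f r (y (c r))) \<in> borel_measurable (lebesgue_on {a..b})" if "a \<le> b"
    using that by (intro measurable_restrict_space1 measurable_completion) simp
  show ?thesis
  proof (cases "a \<le> b")
    case True
    have "(\<lambda>r. f r (y (c r))) absolutely_integrable_on {a..b}"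
    proof (rule measurable_bounded_by_integrable_imp_absolutely_integrable[where g="\<lambda>_. C R"])
      show "norm (f r (y (c r))) \<le> C R" if "r \<in> {a..b}" for r
        using that by (intro regular_bound[OF f] R) (auto simp: c_def)
    qed (use m[OF True] in \<open>simp_all add: integrable_const_ivl\<close>)
    moreover have "(\<lambda>r. f r (y (c r))) absolutely_integrable_on {a..b} \<longleftrightarrow> (\<lambda>r. f r (y r)) absolutely_integrable_on {a..b}"
      by (rule set_integrable_cong) (auto simp: c_def)
    ultimately show ?thesis by simp
  qed simp
qed

lemma regular_integrable:
  assumes "regular C f" "continuous_on {a..b} y"
  shows "(\<lambda>r. f r (y r)) integrable_on {a..b}" "(\<lambda>r. norm (f r (y r))) integrable_on {a..b}"
  using regular_absolutely_integrable[OF assms] by (auto simp: absolutely_integrable_on_def)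

text \<open>The integral form is insensitive to the jumps of the field, where a derivative need not
  exist. Taking \<open>s = 0\<close> forces \<open>y 0 = x\<close>.\<close>

definition sol :: "(real \<Rightarrow> 'a::euclidean_space \<Rightarrow> 'a) \<Rightarrow> 'a \<Rightarrow> real \<Rightarrow> (real \<Rightarrow> 'a) \<Rightarrow> bool" where
  "sol f x t y \<longleftrightarrow> 0 \<le> t \<and> continuous_on {0..t} y \<and>
     (\<forall>s\<in>{0..t}. ((\<lambda>r. f r (y r)) has_integral (y s - x)) {0..s})"

definition alive :: "(real \<Rightarrow> 'a::euclidean_space \<Rightarrow> 'a) \<Rightarrow> 'a \<Rightarrow> real \<Rightarrow> bool" where
  "alive f x t \<longleftrightarrow> (\<exists>y. sol f x t y)"

text \<open>Only meaningful for times \<open>t\<close> with \<open>alive f x t\<close>.\<close>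

definition flow :: "(real \<Rightarrow> 'a::euclidean_space \<Rightarrow> 'a) \<Rightarrow> 'a \<Rightarrow> real \<Rightarrow> 'a" where
  "flow f x t = (SOME y. sol f x t y) t"

lemma sol_0: "sol f x t y \<Longrightarrow> y 0 = x"
  unfolding sol_def by (metis atLeastAtMost_iff atLeastAtMost_singleton diff_eq_eq has_integral_refl(2) has_integral_unique order_refl diff_0 add_0)

lemma sol_mono: "sol f x t y \<Longrightarrow> 0 \<le> s \<Longrightarrow> s \<le> t \<Longrightarrow> sol f x s y"
  unfolding sol_def by (auto intro: continuous_on_subset)

text \<open>Gronwall, with the two fields compared along \<open>z\<close> only. In the application
  \<open>z\<close> is the limit trajectory, so pointwise convergence of the fields on one fixed
  curve will suffice.\<close>

lemma sol_compare:
  assumes f: "regular C f" and g: "regular C g" and y: "sol f x t y" and z: "sol g x' t z"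
    and R: "\<And>s. s \<in> {0..t} \<Longrightarrow> norm (y s) \<le> R" "\<And>s. s \<in> {0..t} \<Longrightarrow> norm (z s) \<le> R"
    and s: "s \<in> {0..t}"
  shows "norm (y s - z s) \<le> (norm (x - x') + integral {0..t} (\<lambda>r. norm (f r (z r) - g r (z r)))) * exp (C R * s)"
proof (rule gronwall[where t=t and w="\<lambda>s. norm (y s - z s)", OF _ _ _ s])
  have yc: "continuous_on {0..t} y" and zc: "continuous_on {0..t} z" using y z by (auto simp: sol_def)
  then show "continuous_on {0..t} (\<lambda>s. norm (y s - z s))" by (intro continuous_intros)
  have "norm (y s) \<le> R" using R s by auto
  then have "0 \<le> R" using norm_ge_zero order_trans by blast
  then show CR: "0 \<le> C R" by (rule regular_nonneg[OF f])
  fix s assume s: "s \<in> {0..t}"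
  let ?e = "\<lambda>r. norm (f r (z r) - g r (z r))"
  have sub: "{0..s} \<subseteq> {0..t}" using s by auto
  have ei: "?e integrable_on {0..t}"
    using set_integral_diff(1)[OF regular_absolutely_integrable[OF f zc] regular_absolutely_integrable[OF g zc]]
    by (simp add: absolutely_integrable_on_def)
  have wi: "(\<lambda>r. norm (y r - z r)) integrable_on {0..s}"
    using s by (intro integrable_continuous_real continuous_intros continuous_on_subset[OF yc] continuous_on_subset[OF zc]) auto
  have yi: "((\<lambda>r. f r (y r)) has_integral (y s - x)) {0..s}" and zi: "((\<lambda>r. g r (z r)) has_integral (z s - x')) {0..s}"
    using y z s by (auto simp: sol_def)
  have "y s - z s - (x - x') = integral {0..s} (\<lambda>r. f r (y r) - g r (z r))"
    using integral_unique[OF has_integral_diff[OF yi zi]] by simp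
  also have "norm \<dots> \<le> integral {0..s} (\<lambda>r. C R * norm (y r - z r) + ?e r)"
  proof (rule integral_norm_bound_integral)
    show "(\<lambda>r. f r (y r) - g r (z r)) integrable_on {0..s}" using has_integral_diff[OF yi zi] by blast
    show "(\<lambda>r. C R * norm (y r - z r) + ?e r) integrable_on {0..s}"
      using wi integrable_subinterval_real[OF ei sub] by (intro integrable_add integrable_on_mult_right) auto
    fix r assume r: "r \<in> {0..s}"
    have "norm (f r (y r) - g r (z r)) \<le> norm (f r (y r) - f r (z r)) + ?e r"
      by (metis norm_triangle_ineq add_diff_eq diff_add_cancel)
    also have "norm (f r (y r) - f r (z r)) \<le> C R * norm (y r - z r)"
      by (rule regular_lipschitz[OF f]) (use R r s in auto)
    finally show "norm (f r (y r) - g r (z r)) \<le> C R * norm (y r - z r) + ?e r" by simp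
  qed
  also have "\<dots> = C R * integral {0..s} (\<lambda>r. norm (y r - z r)) + integral {0..s} ?e"
    by (subst integral_add) (use integrable_on_mult_right[OF wi, of "C R"] integrable_subinterval_real[OF ei sub] in auto)
  also have "integral {0..s} ?e \<le> integral {0..t} ?e"
    by (rule integral_subset_le[OF sub integrable_subinterval_real[OF ei sub] ei]) simp
  finally show "norm (y s - z s) \<le> norm (x - x') + integral {0..t} ?e + C R * integral {0..s} (\<lambda>r. norm (y r - z r))"
    using norm_triangle_ineq2[of "y s - z s" "x - x'"] by linarith
qed

lemma sol_unique:
  assumes f: "regular C f" and y: "sol f x t y" and z: "sol f x t z" and s: "s \<in> {0..t}"
  shows "y s = z s"
proof -
  have "continuous_on {0..t} y" "continuous_on {0..t} z" using y z by (auto simp: sol_def)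
  then have "bounded (y ` {0..t} \<union> z ` {0..t})"
    by (simp add: compact_continuous_image compact_imp_bounded)
  then obtain R where "\<And>s. s \<in> {0..t} \<Longrightarrow> norm (y s) \<le> R" "\<And>s. s \<in> {0..t} \<Longrightarrow> norm (z s) \<le> R"
    by (force simp: bounded_iff)
  from sol_compare[OF f f y z this s] show ?thesis by simp
qed

lemma alive_mono: "alive f x t \<Longrightarrow> 0 \<le> s \<Longrightarrow> s \<le> t \<Longrightarrow> alive f x s"
  unfolding alive_def using sol_mono by blast

lemma alive_nonneg: "alive f x t \<Longrightarrow> 0 \<le> t"
  by (auto simp: alive_def sol_def)

lemma flow_eq:
  assumes f: "regular C f" and y: "sol f x t y" and s: "0 \<le> s" "s \<le> t"
  shows "flow f x s = y s"
proof -
  have "sol f x s (SOME y. sol f x s y)" by (rule someI[of "sol f x s"]) (rule sol_mono[OF y s])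
  from sol_unique[OF f this sol_mono[OF y s], of s] show ?thesis using s by (simp add: flow_def)
qed

lemma sol_cong: "sol f x t y \<Longrightarrow> (\<And>s. s \<in> {0..t} \<Longrightarrow> y s = z s) \<Longrightarrow> sol f x t z"
proof -
  assume y: "sol f x t y" and eq: "\<And>s. s \<in> {0..t} \<Longrightarrow> y s = z s"
  have "((\<lambda>r. f r (z r)) has_integral (z s - x)) {0..s}" if "s \<in> {0..t}" for s
  proof (rule has_integral_eq)
    show "((\<lambda>r. f r (y r)) has_integral (z s - x)) {0..s}" using y that by (simp add: sol_def flip: eq[OF that])
  qed (use that eq in auto)
  moreover have "continuous_on {0..t} z" using y eq continuous_on_cong[of "{0..t}" "{0..t}" y z] by (simp add: sol_def)
  ultimately show ?thesis using y by (simp add: sol_def)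
qed

lemma sol_flow:
  assumes f: "regular C f" and a: "alive f x t"
  shows "sol f x t (flow f x)"
  using a flow_eq[OF f] unfolding alive_def by (force intro: sol_cong)

lemma sol_trivial: "sol f x 0 (\<lambda>_. x)"
  by (simp add: sol_def has_integral_refl)

lemma alive_0: "alive f x 0"
  using sol_trivial by (auto simp: alive_def)

lemma flow_0: "regular C f \<Longrightarrow> flow f x 0 = x"
  using flow_eq[OF _ sol_trivial, of C f 0 x] by simp

text \<open>Composed with the nearest-point projection onto the ball, the field becomes globally
  Lipschitz and has a solution up to \<open>t\<close>; this is a true solution until it first
  reaches the sphere. Continuation, stability and escape all rest on this alternative.\<close>

lemma exit_or_alive:
  assumes f: "regular C f" and t: "0 \<le> t" and x: "norm x < R"
  obtains \<tau> where "0 \<le> \<tau>" "\<tau> \<le> t" "alive f x \<tau>" "\<And>s. s \<in> {0..\<tau>} \<Longrightarrow> norm (flow f x s) \<le> R"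
    "\<tau> = t \<or> norm (flow f x \<tau>) = R"
proof -
  note result = that
  have R: "0 < R" using x norm_ge_zero order_le_less_trans by blast
  define P where "P = closest_point (cball (0::'a) R)"
  have P: "P z \<in> cball 0 R" "norm (P z - P w) \<le> norm (z - w)" for z w
    using closest_point_in_set[of "cball (0::'a) R"] closest_point_lipschitz[of "cball (0::'a) R" z w] R
    by (auto simp: P_def dist_norm)
  have Pid: "P z = z" if "norm z \<le> R" for z
    unfolding P_def by (rule closest_point_self) (use that in auto)
  have CR: "0 \<le> C R" using regular_nonneg[OF f] R by simp
  obtain y where yc: "continuous_on UNIV y"
    and yi: "\<And>s. s \<in> {0..t} \<Longrightarrow> ((\<lambda>r. f r (P (y r))) has_integral (y s - x)) {0..s}"
  proof (rule picard_global[OF t, of "C R + 1" "\<lambda>r z. f r (P z)" x])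
    \<comment> \<open>One is added because the Picard iteration needs a positive constant, while
      \<open>C R\<close> may vanish.\<close>
    show "0 < C R + 1" using CR by simp
    show "norm (f r (P z) - f r (P w)) \<le> (C R + 1) * norm (z - w)" for r z w
    proof -
      have "norm (f r (P z) - f r (P w)) \<le> C R * norm (P z - P w)"
        by (rule regular_lipschitz[OF f]) (use P in auto)
      also have "\<dots> \<le> (C R + 1) * norm (z - w)" using CR P by (intro mult_mono) auto
      finally show ?thesis .
    qed
    show "(\<lambda>r. f r (P (y r))) integrable_on {0..t}" if y: "continuous_on UNIV y" for y
    proof (rule regular_integrable[OF f])
      have "continuous_on UNIV (\<lambda>r. P (y r))" unfolding P_def
        by (rule continuous_on_compose2[OF continuous_on_closest_point y]) (use R in auto)
      then show "continuous_on {0..t} (\<lambda>r. P (y r))" by (rule continuous_on_subset) auto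
    qed
  qed (rule that)
  have "((\<lambda>r. f r (P (y r))) has_integral (y 0 - x)) {0}" using yi[of 0] t by simp
  from has_integral_unique[OF this has_integral_refl(2)] have y0: "y 0 = x" by simp
  have ny: "continuous_on S (\<lambda>s. norm (y s))" for S
    by (intro continuous_intros continuous_on_subset[OF yc]) auto
  have mk: "sol f x \<tau> y" if \<tau>: "0 \<le> \<tau>" "\<tau> \<le> t" and le: "\<And>s. s \<in> {0..\<tau>} \<Longrightarrow> norm (y s) \<le> R" for \<tau>
    unfolding sol_def
  proof (intro conjI ballI)
    show "0 \<le> \<tau>" by (rule \<tau>)
    show "continuous_on {0..\<tau>} y" using yc by (rule continuous_on_subset) auto
    fix s assume s: "s \<in> {0..\<tau>}"
    show "((\<lambda>r. f r (y r)) has_integral (y s - x)) {0..s}"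
    proof (rule has_integral_eq[OF _ yi[of s]])
      show "f r (P (y r)) = f r (y r)" if "r \<in> {0..s}" for r
        using Pid[OF le[of r]] that s by simp
    qed (use s \<tau> in auto)
  qed
  have fin: thesis if \<tau>: "0 \<le> \<tau>" "\<tau> \<le> t" and le: "\<And>s. s \<in> {0..\<tau>} \<Longrightarrow> norm (y s) \<le> R"
    and "\<tau> = t \<or> norm (y \<tau>) = R" for \<tau>
  proof (rule result[of \<tau>])
    have m: "sol f x \<tau> y" using mk[OF \<tau> le] .
    show "alive f x \<tau>" using m by (auto simp: alive_def)
    show "norm (flow f x s) \<le> R" if "s \<in> {0..\<tau>}" for s
      using flow_eq[OF f m, of s] le[of s] that by auto
    show "\<tau> = t \<or> norm (flow f x \<tau>) = R"
      using flow_eq[OF f m, of \<tau>] \<tau> \<open>\<tau> = t \<or> norm (y \<tau>) = R\<close> by auto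
  qed (use \<tau> in auto)
  \<comment> \<open>The times on the sphere form a closed set, so there is a first one unless the
    set is empty; before it the intermediate value theorem keeps the solution inside.\<close>
  define Z where "Z = {s \<in> {0..t}. norm (y s) = R}"
  have ivt: "\<exists>z\<in>Z. z \<le> s" if s: "s \<in> {0..t}" "norm (y s) > R" for s
  proof -
    obtain z where "0 \<le> z" "z \<le> s" "norm (y z) = R"
      using IVT'[of "\<lambda>s. norm (y s)" 0 R s] ny[of "{0..s}"] s y0 x by auto
    then show ?thesis using s by (auto simp: Z_def)
  qed
  show ?thesis
  proof (cases "Z = {}")
    case True
    then have "norm (y s) \<le> R" if "s \<in> {0..t}" for s using ivt[of s] that by force
    then show ?thesis using t by (intro fin[of t]) auto
  next
    case False
    have "closed Z" unfolding Z_def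
      by (rule continuous_closed_preimage_constant[OF ny]) auto
    then have "compact Z" unfolding compact_eq_bounded_closed
      by (auto simp: Z_def intro: bounded_subset[of "{0..t}"])
    then obtain \<tau> where \<tau>: "\<tau> \<in> Z" "\<And>z. z \<in> Z \<Longrightarrow> \<tau> \<le> z"
      using compact_attains_inf[OF _ False] by auto
    have le: "norm (y s) \<le> R" if "s \<in> {0..\<tau>}" for s
    proof (rule ccontr)
      assume a: "\<not> norm (y s) \<le> R"
      then have "R < norm (y s)" "s \<in> {0..t}" using \<tau>(1) that by (auto simp: Z_def)
      then obtain z where "z \<in> Z" "z \<le> s" using ivt[of s] by blast
      then have "s = \<tau>" using \<tau>(2)[of z] that by auto
      then show False using a \<tau>(1) by (auto simp: Z_def)
    qed
    have "0 \<le> \<tau>" "\<tau> \<le> t" "norm (y \<tau>) = R" using \<tau>(1) by (auto simp: Z_def)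
    then show ?thesis using le by (intro fin[of \<tau>]) auto
  qed
qed

section \<open>Stability, concatenation and maximal solutions\<close>

text \<open>The fields converge only pointwise; dominated convergence along the one limit trajectory
  turns this into an integrated error tending to zero. Gronwall also needs an a priori bound on the
  perturbed trajectory. A continuity argument supplies it: the trajectory is stopped on the sphere
  of radius \<open>R\<close>, and while it is close to the limit trajectory it cannot get
  there.\<close>

lemma flow_stability:
  fixes fk :: "nat \<Rightarrow> real \<Rightarrow> 'a::euclidean_space \<Rightarrow> 'a"
  assumes fk: "\<And>k. regular C (fk k)" and f: "regular C f"
    and conv: "\<And>r z. (\<lambda>k. fk k r z) \<longlonglongrightarrow> f r z"
    and x: "xk \<longlonglongrightarrow> x" and a: "alive f x t"
  obtains R where "\<And>s. s \<in> {0..t} \<Longrightarrow> norm (flow f x s) \<le> R"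
    "\<forall>\<^sub>F k in sequentially. alive (fk k) (xk k) t"
    "\<forall>\<^sub>F k in sequentially. \<forall>s\<in>{0..t}. norm (flow (fk k) (xk k) s) \<le> R"
    "uniform_limit {0..t} (\<lambda>k. flow (fk k) (xk k)) (flow f x) sequentially"
proof -
  note result = that
  have y: "sol f x t (flow f x)" by (rule sol_flow[OF f a])
  then have t: "0 \<le> t" and yc: "continuous_on {0..t} (flow f x)" by (auto simp: sol_def)
  obtain M where M: "\<And>s. s \<in> {0..t} \<Longrightarrow> norm (flow f x s) \<le> M"
    using compact_image_norm_bound[OF yc compact_Icc] by metis
  \<comment> \<open>The limit trajectory has radius at most \<open>M\<close>; an exit through the
    sphere of radius \<open>R\<close> would mean a distance of at least 1 from it, against
    \<open>D k < 1\<close> below.\<close>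
  define R where "R = M + 1"
  have x0: "flow f x 0 = x" by (rule flow_0[OF f])
  have M0: "norm x \<le> M" using M[of 0] t x0 by simp
  have R: "0 \<le> R" using M0 norm_ge_zero[of x] unfolding R_def by linarith
  have CR: "0 \<le> C R" by (rule regular_nonneg[OF f R])
  let ?d = "\<lambda>k r. norm (fk k r (flow f x r) - f r (flow f x r))"
  have di: "?d k integrable_on {0..t}" for k
    using set_integral_diff(1)[OF regular_absolutely_integrable[OF fk yc] regular_absolutely_integrable[OF f yc]]
    by (simp add: absolutely_integrable_on_def)
  define \<eta> where "\<eta> k = integral {0..t} (?d k)" for k
  have "\<eta> \<longlonglongrightarrow> integral {0..t} (\<lambda>r. 0)"
    unfolding \<eta>_def
  proof (rule dominated_convergence(2)[OF di])
    show "(\<lambda>r. 2 * C R) integrable_on {0..t}" by (simp add: integrable_const_ivl)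
    fix k r assume r: "r \<in> {0..t}"
    have "norm (flow f x r) \<le> R" using M[OF r] by (simp add: R_def)
    then have "?d k r \<le> 2 * C R"
      using norm_triangle_ineq4[of "fk k r (flow f x r)" "f r (flow f x r)"]
        regular_bound[OF fk, of "flow f x r" R k r] regular_bound[OF f, of "flow f x r" R r] by linarith
    then show "norm (?d k r) \<le> 2 * C R" by simp
    have "(\<lambda>k. fk k r (flow f x r) - f r (flow f x r)) \<longlonglongrightarrow> 0" using conv by (rule LIM_zero)
    then show "(\<lambda>k. ?d k r) \<longlonglongrightarrow> 0" by (rule tendsto_norm_zero)
  qed
  then have \<eta>: "\<eta> \<longlonglongrightarrow> 0" by simp
  define D where "D k = (norm (xk k - x) + \<eta> k) * exp (C R * t)" for k
  have "D \<longlonglongrightarrow> (0 + 0) * exp (C R * t)"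
    unfolding D_def by (intro tendsto_intros \<eta> tendsto_norm_zero LIM_zero x)
  then have D: "D \<longlonglongrightarrow> 0" by simp
  have \<eta>0: "0 \<le> \<eta> k" for k unfolding \<eta>_def by (intro integral_nonneg di) auto
  have key: "alive (fk k) (xk k) t \<and> (\<forall>s\<in>{0..t}. norm (flow (fk k) (xk k) s) \<le> R \<and> norm (flow (fk k) (xk k) s - flow f x s) \<le> D k)"
    if Dk: "D k < 1" and xk: "norm (xk k) < R" for k
  proof -
    obtain \<tau> where \<tau>: "0 \<le> \<tau>" "\<tau> \<le> t" "alive (fk k) (xk k) \<tau>"
      and \<tau>R: "\<And>s. s \<in> {0..\<tau>} \<Longrightarrow> norm (flow (fk k) (xk k) s) \<le> R"
      and end_: "\<tau> = t \<or> norm (flow (fk k) (xk k) \<tau>) = R"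
      using exit_or_alive[OF fk t xk] by blast
    have cmp: "norm (flow (fk k) (xk k) s - flow f x s) \<le> D k" if s: "s \<in> {0..\<tau>}" for s
    proof -
      have "norm (flow (fk k) (xk k) s - flow f x s) \<le> (norm (xk k - x) + integral {0..\<tau>} (?d k)) * exp (C R * s)"
        by (rule sol_compare[OF fk f sol_flow[OF fk \<tau>(3)] sol_mono[OF y \<tau>(1,2)] \<tau>R _ s])
          (use M \<tau> in \<open>auto simp: R_def intro: add_increasing2\<close>)
      also have "\<dots> \<le> (norm (xk k - x) + \<eta> k) * exp (C R * t)"
      proof (intro mult_mono add_left_mono)
        have sub: "{0..\<tau>} \<subseteq> {0..t}" using \<tau> by auto
        show "integral {0..\<tau>} (?d k) \<le> \<eta> k" unfolding \<eta>_def
          by (rule integral_subset_le[OF sub integrable_subinterval_real[OF di sub] di]) simp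
        show "exp (C R * s) \<le> exp (C R * t)" using CR s \<tau> by (simp add: mult_left_mono)
      qed (use \<eta>0 in auto)
      finally show ?thesis by (simp add: D_def)
    qed
    have "\<tau> = t"
    proof (rule ccontr)
      assume "\<tau> \<noteq> t"
      then have "norm (flow (fk k) (xk k) \<tau>) = R" using end_ by simp
      moreover have "norm (flow (fk k) (xk k) \<tau>) \<le> norm (flow f x \<tau>) + norm (flow (fk k) (xk k) \<tau> - flow f x \<tau>)"
        by norm
      ultimately show False using cmp[of \<tau>] M[of \<tau>] \<tau> Dk by (simp add: R_def)
    qed
    then show ?thesis using \<tau> \<tau>R cmp by auto
  qed
  have "\<forall>\<^sub>F k in sequentially. D k < 1" using D by (rule order_tendstoD) simp
  moreover have "\<forall>\<^sub>F k in sequentially. norm (xk k) < R"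
    using tendsto_norm[OF x] by (rule order_tendstoD) (use M0 in \<open>simp add: R_def\<close>)
  ultimately have ev: "\<forall>\<^sub>F k in sequentially. alive (fk k) (xk k) t \<and>
      (\<forall>s\<in>{0..t}. norm (flow (fk k) (xk k) s) \<le> R \<and> norm (flow (fk k) (xk k) s - flow f x s) \<le> D k)"
    by eventually_elim (rule key)
  show ?thesis
  proof (rule result[of R])
    show "norm (flow f x s) \<le> R" if "s \<in> {0..t}" for s using M[OF that] by (simp add: R_def)
    show "\<forall>\<^sub>F k in sequentially. alive (fk k) (xk k) t" using ev by eventually_elim simp
    show "\<forall>\<^sub>F k in sequentially. \<forall>s\<in>{0..t}. norm (flow (fk k) (xk k) s) \<le> R"
      using ev by eventually_elim simp
    show "uniform_limit {0..t} (\<lambda>k. flow (fk k) (xk k)) (flow f x) sequentially"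
    proof (rule uniform_limitI)
      fix e :: real assume "0 < e"
      then have "\<forall>\<^sub>F k in sequentially. D k < e" using D order_tendstoD(2) by blast
      with ev show "\<forall>\<^sub>F k in sequentially. \<forall>s\<in>{0..t}. dist (flow (fk k) (xk k) s) (flow f x s) < e"
        by eventually_elim (force simp: dist_norm)
    qed
  qed
qed

text \<open>Arc length, computed from the field instead of the velocity, which need not exist at
  jump times.\<close>

definition len :: "(real \<Rightarrow> 'a::euclidean_space \<Rightarrow> 'a) \<Rightarrow> 'a \<Rightarrow> real \<Rightarrow> real" where
  "len f x t = integral {0..t} (\<lambda>r. norm (f r (flow f x r)))"

lemma flow_continuous: "regular C f \<Longrightarrow> alive f x t \<Longrightarrow> continuous_on {0..t} (flow f x)"
  using sol_flow[of C f x t] by (simp add: sol_def)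

lemma len_integrable:
  "regular C f \<Longrightarrow> alive f x t \<Longrightarrow> (\<lambda>r. norm (f r (flow f x r))) integrable_on {0..t}"
  by (intro regular_integrable flow_continuous)

lemma len_nonneg: "regular C f \<Longrightarrow> alive f x t \<Longrightarrow> 0 \<le> len f x t"
  unfolding len_def by (intro integral_nonneg len_integrable) auto

lemma len_diff_le:
  assumes f: "regular C f" and a: "alive f x t" and s: "0 \<le> s" "s \<le> t"
    and R: "\<And>r. r \<in> {s..t} \<Longrightarrow> norm (flow f x r) \<le> R"
  shows "len f x s \<le> len f x t" "len f x t - len f x s \<le> C R * (t - s)"
proof -
  have i: "(\<lambda>r. norm (f r (flow f x r))) integrable_on {0..t}" by (rule len_integrable[OF f a])
  have "len f x s + integral {s..t} (\<lambda>r. norm (f r (flow f x r))) = len f x t"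
    unfolding len_def by (rule Henstock_Kurzweil_Integration.integral_combine[OF s i])
  moreover have i': "(\<lambda>r. norm (f r (flow f x r))) integrable_on {s..t}"
    by (rule integrable_subinterval_real[OF i]) (use s in auto)
  moreover have "integral {s..t} (\<lambda>r. norm (f r (flow f x r))) \<ge> 0"
    by (intro integral_nonneg i') auto
  moreover have "integral {s..t} (\<lambda>r. norm (f r (flow f x r))) \<le> integral {s..t} (\<lambda>r. C R)"
    by (intro integral_le i') (auto simp: integrable_const_ivl intro: regular_bound[OF f R])
  ultimately show "len f x s \<le> len f x t" "len f x t - len f x s \<le> C R * (t - s)"
    using s by (auto simp: algebra_simps)
qed

lemma len_0: "len f x 0 = 0"
  by (simp add: len_def)

lemma flow_diff_le:
  assumes f: "regular C f" and a: "alive f x t" and s: "0 \<le> s" "s \<le> t"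
    and R: "\<And>r. r \<in> {s..t} \<Longrightarrow> norm (flow f x r) \<le> R"
  shows "norm (flow f x t - flow f x s) \<le> C R * (t - s)"
proof -
  have y: "sol f x t (flow f x)" by (rule sol_flow[OF f a])
  have t: "((\<lambda>r. f r (flow f x r)) has_integral (flow f x t - x)) {0..t}"
    and s': "((\<lambda>r. f r (flow f x r)) has_integral (flow f x s - x)) {0..s}"
    using y s by (auto simp: sol_def)
  have i: "(\<lambda>r. f r (flow f x r)) integrable_on {s..t}"
    by (rule integrable_subinterval_real[of _ 0 t]) (use s t in auto)
  have "flow f x t - flow f x s = integral {s..t} (\<lambda>r. f r (flow f x r))"
    using Henstock_Kurzweil_Integration.integral_combine[OF s has_integral_integrable[OF t]] integral_unique[OF t] integral_unique[OF s']
    by (simp add: algebra_simps)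
  also have "norm \<dots> \<le> integral {s..t} (\<lambda>r. C R)"
    by (intro integral_norm_bound_integral i) (auto simp: integrable_const_ivl intro: regular_bound[OF f R])
  finally show ?thesis using s by (simp add: mult.commute)
qed

text \<open>The exit alternative is applied up to time \<open>t + 1\<close> with a ball strictly
  larger than one containing the trajectory on \<open>{0..t}\<close>; the exit from it cannot occur
  by time \<open>t\<close>.\<close>

lemma alive_extend:
  assumes f: "regular C f" and a: "alive f x t"
  obtains t' where "t < t'" "alive f x t'"
proof -
  have t: "0 \<le> t" using a by (rule alive_nonneg)
  obtain M where M: "\<And>s. s \<in> {0..t} \<Longrightarrow> norm (flow f x s) \<le> M"
    using compact_image_norm_bound[OF flow_continuous[OF f a] compact_Icc] by metis
  have "norm x < M + 1" using M[of 0] t flow_0[OF f, of x] by simp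
  from exit_or_alive[OF f _ this, of "t + 1"] t obtain \<tau> where
    \<tau>: "alive f x \<tau>" "0 \<le> \<tau>" "\<tau> = t + 1 \<or> norm (flow f x \<tau>) = M + 1"
    by (metis add_nonneg_nonneg zero_le_one)
  have "t < \<tau>" using \<tau> M[of \<tau>] t by force
  then show ?thesis using that \<tau> by blast
qed

text \<open>The times \<open>tk\<close> may exceed \<open>t\<close>, so the comparison runs up to a
  slightly later \<open>t'\<close> at which the limit trajectory is still alive. For the lengths a
  bound is enough: they will be multiplied by damping factors that tend to zero.\<close>

lemma flow_converge:
  fixes fk :: "nat \<Rightarrow> real \<Rightarrow> 'a::euclidean_space \<Rightarrow> 'a"
  assumes fk: "\<And>k. regular C (fk k)" and f: "regular C f"
    and conv: "\<And>r z. (\<lambda>k. fk k r z) \<longlonglongrightarrow> f r z"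
    and x: "xk \<longlonglongrightarrow> x" and t: "tk \<longlonglongrightarrow> t" "\<And>k. 0 \<le> tk k" and a: "alive f x t"
  shows "\<forall>\<^sub>F k in sequentially. alive (fk k) (xk k) (tk k)"
    and "(\<lambda>k. flow (fk k) (xk k) (tk k)) \<longlonglongrightarrow> flow f x t"
    and "\<exists>b. \<forall>\<^sub>F k in sequentially. len (fk k) (xk k) (tk k) \<le> b"
proof -
  obtain t' where t': "t < t'" "alive f x t'" using alive_extend[OF f a] .
  have t0: "0 \<le> t" by (rule alive_nonneg[OF a])
  obtain R where R: "\<And>s. s \<in> {0..t'} \<Longrightarrow> norm (flow f x s) \<le> R"
    and ev1: "\<forall>\<^sub>F k in sequentially. alive (fk k) (xk k) t'"
    and ev2: "\<forall>\<^sub>F k in sequentially. \<forall>s\<in>{0..t'}. norm (flow (fk k) (xk k) s) \<le> R"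
    and ul: "uniform_limit {0..t'} (\<lambda>k. flow (fk k) (xk k)) (flow f x) sequentially"
    using flow_stability[OF fk f conv x t'(2)] by blast
  have ev3: "\<forall>\<^sub>F k in sequentially. tk k < t'" using t(1) t'(1) by (rule order_tendstoD)
  show "\<forall>\<^sub>F k in sequentially. alive (fk k) (xk k) (tk k)"
    using ev1 ev3 by eventually_elim (rule alive_mono, use t in auto)
  have "((flow f x) \<longlongrightarrow> flow f x t) (at t within {0..t'})"
    using flow_continuous[OF f t'(2)] t' t0 by (auto simp: continuous_on_def)
  then have "(\<lambda>k. flow f x (tk k)) \<longlonglongrightarrow> flow f x t"
    by (rule continuous_within_tendsto_compose[unfolded continuous_within])
      (use t ev3 in \<open>auto elim: eventually_mono\<close>)
  moreover have "(\<lambda>k. flow (fk k) (xk k) (tk k) - flow f x (tk k)) \<longlonglongrightarrow> 0"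
  proof (rule tendstoI)
    fix e :: real assume "0 < e"
    from uniform_limitD[OF ul this] ev3
    show "\<forall>\<^sub>F k in sequentially. dist (flow (fk k) (xk k) (tk k) - flow f x (tk k)) 0 < e"
      by eventually_elim (use t in \<open>force simp: dist_norm\<close>)
  qed
  ultimately show "(\<lambda>k. flow (fk k) (xk k) (tk k)) \<longlonglongrightarrow> flow f x t"
    using tendsto_add by fastforce
  have "\<forall>\<^sub>F k in sequentially. len (fk k) (xk k) (tk k) \<le> C R * t'"
    using ev1 ev2 ev3
  proof eventually_elim
    case (elim k)
    have "len (fk k) (xk k) (tk k) - len (fk k) (xk k) 0 \<le> C R * (tk k - 0)"
      by (rule len_diff_le(2)[OF fk alive_mono[OF elim(1)]]) (use elim t in auto)
    also have "\<dots> \<le> C R * t'"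
    proof (intro mult_left_mono regular_nonneg[OF f])
      show "0 \<le> R" using order_trans[OF norm_ge_zero R[of 0]] t' t0 by simp
      show "tk k - 0 \<le> t'" using elim by simp
    qed
    finally show ?case by (simp add: len_0)
  qed
  then show "\<exists>b. \<forall>\<^sub>F k in sequentially. len (fk k) (xk k) (tk k) \<le> b" by blast
qed

text \<open>The field is fixed here because this serves the measurability of the damping weight in
  the starting point.\<close>

lemma len_converge:
  fixes f :: "real \<Rightarrow> 'a::euclidean_space \<Rightarrow> 'a"
  assumes f: "regular C f" and x: "xk \<longlonglongrightarrow> x" and a: "alive f x t"
  shows "(\<lambda>k. len f (xk k) t) \<longlonglongrightarrow> len f x t"
proof -
  obtain R where R: "\<And>s. s \<in> {0..t} \<Longrightarrow> norm (flow f x s) \<le> R"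
    and ev1: "\<forall>\<^sub>F k in sequentially. alive f (xk k) t"
    and ev2: "\<forall>\<^sub>F k in sequentially. \<forall>s\<in>{0..t}. norm (flow f (xk k) s) \<le> R"
    and ul: "uniform_limit {0..t} (\<lambda>k. flow f (xk k)) (flow f x) sequentially"
    using flow_stability[of C "\<lambda>_. f", OF f f tendsto_const x a] by blast
  from ev1 ev2 have "\<forall>\<^sub>F k in sequentially. alive f (xk k) t \<and> (\<forall>s\<in>{0..t}. norm (flow f (xk k) s) \<le> R)"
    by eventually_elim simp
  then obtain N where N: "\<And>k. k \<ge> N \<Longrightarrow> alive f (xk k) t \<and> (\<forall>s\<in>{0..t}. norm (flow f (xk k) s) \<le> R)"
    by (auto simp: eventually_sequentially)
  \<comment> \<open>Dominated convergence wants its bounds for every index, hence the shift by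
    \<open>N\<close>.\<close>
  have "(\<lambda>k. len f (xk (k + N)) t) \<longlonglongrightarrow> len f x t"
    unfolding len_def
  proof (rule dominated_convergence(2))
    show "(\<lambda>r. norm (f r (flow f (xk (k + N)) r))) integrable_on {0..t}" for k
      by (rule len_integrable[OF f]) (use N in auto)
    show "(\<lambda>r. C R) integrable_on {0..t}" by (simp add: integrable_const_ivl)
    show "norm (norm (f r (flow f (xk (k + N)) r))) \<le> C R" if "r \<in> {0..t}" for k r
      using N[of "k + N"] that by (auto intro: regular_bound[OF f])
    fix r assume r: "r \<in> {0..t}"
    have "(\<lambda>k. flow f (xk k) r) \<longlonglongrightarrow> flow f x r" by (rule tendsto_uniform_limitI[OF ul r])
    then have conv: "(\<lambda>k. flow f (xk (k + N)) r) \<longlonglongrightarrow> flow f x r" by (rule LIMSEQ_ignore_initial_segment)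
    have "(\<lambda>k. f r (flow f (xk (k + N)) r) - f r (flow f x r)) \<longlonglongrightarrow> 0"
    proof (rule Lim_null_comparison)
      show "\<forall>\<^sub>F k in sequentially. norm (f r (flow f (xk (k + N)) r) - f r (flow f x r)) \<le> C R * norm (flow f (xk (k + N)) r - flow f x r)"
        by (intro always_eventually allI regular_lipschitz[OF f]) (use N R r in auto)
      show "(\<lambda>k. C R * norm (flow f (xk (k + N)) r - flow f x r)) \<longlonglongrightarrow> 0"
        by (intro tendsto_mult_right_zero tendsto_norm_zero LIM_zero conv)
    qed
    then show "(\<lambda>k. norm (f r (flow f (xk (k + N)) r))) \<longlonglongrightarrow> norm (f r (flow f x r))"
      by (intro tendsto_norm) (rule LIM_zero_cancel)
  qed
  then show ?thesis by (rule LIMSEQ_offset)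
qed

section \<open>Measurability in the starting point and in time\<close>

lemma open_alive:
  assumes f: "regular C f" and t: "0 \<le> t"
  shows "open {x. alive f x t}"
proof -
  have "closed {x. \<not> alive f x t}"
    unfolding closed_sequential_limits
  proof safe
    fix xk x assume *: "\<forall>n::nat. xk n \<in> {x. \<not> alive f x t}" "xk \<longlonglongrightarrow> x" and "alive f x t"
    from flow_converge(1)[of C "\<lambda>_. f", OF f f tendsto_const *(2) tendsto_const[of t]] this t
    show False by auto
  qed
  then show ?thesis by (simp add: closed_def Compl_eq)
qed

lemma flow_continuous_initial:
  assumes f: "regular C f"
  shows "continuous_on {x. alive f x t} (\<lambda>x. flow f x t)"
  unfolding continuous_on_sequentially
proof (intro allI impI ballI, elim conjE)
  fix xk x assume *: "x \<in> {x. alive f x t}" "\<forall>n. xk n \<in> {x. alive f x t}" "xk \<longlonglongrightarrow> x"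
  then have a: "alive f x t" by simp
  show "((\<lambda>x. flow f x t) \<circ> xk) \<longlonglongrightarrow> flow f x t"
    unfolding o_def
    by (rule flow_converge(2)[of C "\<lambda>_. f", OF f f tendsto_const *(3) tendsto_const alive_nonneg[OF a] a])
qed

lemma len_continuous_initial:
  assumes f: "regular C f"
  shows "continuous_on {x. alive f x t} (\<lambda>x. len f x t)"
  unfolding continuous_on_sequentially o_def
proof (intro allI impI ballI, elim conjE)
  fix xk x assume "x \<in> {x. alive f x t}" "xk \<longlonglongrightarrow> x"
  then show "(\<lambda>k. len f (xk k) t) \<longlonglongrightarrow> len f x t" by (intro len_converge[OF f]) auto
qed

text \<open>Fubini in the weak formulation needs the joint dependence on time and starting point.
  The set is a difference of two closed sets: being dead persists under limits of times and points
  by \<open>flow_converge\<close>.\<close>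

lemma alive_joint:
  assumes f: "regular C f"
  shows "{z. 0 \<le> fst z \<and> alive f (snd z) (fst z)} \<in> sets borel" (is "?A \<in> _")
    and "continuous_on {z. 0 \<le> fst z \<and> alive f (snd z) (fst z)} (\<lambda>z. flow f (snd z) (fst z))"
proof -
  let ?N = "{z. 0 \<le> fst z \<and> \<not> alive f (snd z) (fst z)}"
  have cl0: "closed {z :: real \<times> 'a. 0 \<le> fst z}"
    by (intro closed_Collect_le continuous_intros)
  have "closed ?N"
    unfolding closed_sequential_limits
  proof safe
    fix zk :: "nat \<Rightarrow> real \<times> 'a" and t x
    assume zk: "\<forall>n. zk n \<in> ?N" "zk \<longlonglongrightarrow> (t, x)"
    show "0 \<le> fst (t, x)" using closed_sequentially[OF cl0 _ zk(2)] zk(1) by auto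
    have 1: "(\<lambda>n. snd (zk n)) \<longlonglongrightarrow> x" "(\<lambda>n. fst (zk n)) \<longlonglongrightarrow> t"
      using tendsto_snd[OF zk(2)] tendsto_fst[OF zk(2)] by auto
    assume "alive f (snd (t, x)) (fst (t, x))"
    from flow_converge(1)[of C "\<lambda>_. f", OF f f tendsto_const 1] this zk(1) show False by auto
  qed
  moreover have "?A = {z. 0 \<le> fst z} - ?N" by auto
  ultimately show "?A \<in> sets borel" using cl0 by auto
  show "continuous_on ?A (\<lambda>z. flow f (snd z) (fst z))"
    unfolding continuous_on_sequentially
  proof (intro allI impI ballI, elim conjE)
    fix zk z assume *: "z \<in> ?A" "\<forall>n. zk n \<in> ?A" "zk \<longlonglongrightarrow> z"
    show "((\<lambda>z. flow f (snd z) (fst z)) \<circ> zk) \<longlonglongrightarrow> flow f (snd z) (fst z)"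
      unfolding o_def
      by (rule flow_converge(2)[of C "\<lambda>_. f", OF f f tendsto_const tendsto_snd[OF *(3)] tendsto_fst[OF *(3)]])
        (use * in auto)
  qed
qed

section \<open>Restarting a trajectory at a later time\<close>

lemma regular_shift: 
  assumes f: "regular C f" shows "regular C (\<lambda>r. f (a + r))"
proof -
  obtain K where K: "finite K" "\<And>x. continuous_on (- K) (\<lambda>t. f t x)" using f by (auto simp: regular_def)
  have "continuous_on (- (\<lambda>r. r - a) ` K) (\<lambda>t. f (a + t) x)" for x
    by (rule continuous_on_compose2[OF K(2)]) (force intro!: continuous_intros simp: image_iff)+
  then have "\<exists>K. finite K \<and> (\<forall>x. continuous_on (- K) (\<lambda>t. f (a + t) x))"
    using K(1) by blast
  then show ?thesis using f unfolding regular_def by blast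
qed

lemma has_integral_shift_0:
  fixes g :: "real \<Rightarrow> 'b::euclidean_space"
  shows "((\<lambda>r. g (a + r)) has_integral I) {0..s} \<longleftrightarrow> (g has_integral I) {a..a+s}"
  using has_integral_affinity_iff[of 1 g a I a "a + s"] by (simp add: add.commute)

lemma sol_shift:
  assumes y: "sol f x (a + s) y" and a: "0 \<le> a" "0 \<le> s"
  shows "sol (\<lambda>r. f (a + r)) (y a) s (\<lambda>r. y (a + r))"
  unfolding sol_def
proof (intro conjI ballI)
  show "continuous_on {0..s} (\<lambda>r. y (a + r))"
    by (rule continuous_on_compose2[of "{0..a+s}" y]) (use y a in \<open>auto simp: sol_def intro!: continuous_intros\<close>)
  fix r assume r: "r \<in> {0..s}"
  have t: "((\<lambda>r. f r (y r)) has_integral (y (a + r) - x)) {0..a+r}"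
    and s': "((\<lambda>r. f r (y r)) has_integral (y a - x)) {0..a}"
    using y a r by (auto simp: sol_def)
  have i: "(\<lambda>r. f r (y r)) integrable_on {a..a+r}"
    by (rule integrable_subinterval_real[OF has_integral_integrable[OF t]]) (use a in auto)
  have "y (a + r) - y a = integral {a..a+r} (\<lambda>r. f r (y r))"
    using Henstock_Kurzweil_Integration.integral_combine[OF a(1) _ has_integral_integrable[OF t]] integral_unique[OF t] integral_unique[OF s'] r
    by (simp add: algebra_simps)
  with i have "((\<lambda>r. f r (y r)) has_integral (y (a + r) - y a)) {a..a+r}"
    by (simp add: has_integral_integral)
  then show "((\<lambda>r. f (a + r) (y (a + r))) has_integral (y (a + r) - y a)) {0..r}"
    by (subst has_integral_shift_0[of "\<lambda>r. f r (y r)"])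
qed (rule a)

lemma sol_append:
  assumes y: "sol f x a y" and z: "sol (\<lambda>r. f (a + r)) (y a) s z"
  shows "sol f x (a + s) (\<lambda>r. if r \<le> a then y r else z (r - a))" (is "sol _ _ _ ?w")
proof -
  have a: "0 \<le> a" "0 \<le> s" using y z by (auto simp: sol_def)
  have z0: "z 0 = y a" by (rule sol_0[OF z])

  show ?thesis
    unfolding sol_def
  proof (intro conjI ballI)
    have "continuous_on ({0..a} \<union> {a..a+s}) ?w"
    proof (rule continuous_on_closed_Un)
      show "continuous_on {0..a} ?w" by (rule continuous_on_eq[of _ y]) (use y in \<open>auto simp: sol_def\<close>)
      have "continuous_on {a..a+s} (\<lambda>r. z (r - a))"
        by (rule continuous_on_compose2[of "{0..s}" z]) (use z in \<open>auto simp: sol_def intro!: continuous_intros\<close>)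
      then show "continuous_on {a..a+s} ?w"
      proof (rule continuous_on_eq)
        show "z (r - a) = ?w r" if "r \<in> {a..a+s}" for r using z0 that by (cases "r = a") auto
      qed
    qed auto
    then show "continuous_on {0..a + s} ?w" using a by (simp add: ivl_disj_un_two_touch)
    fix r assume r: "r \<in> {0..a+s}"
    have 1: "((\<lambda>r. f r (?w r)) has_integral (y b - x)) {0..b}" if b: "b \<in> {0..a}" for b
    proof (rule has_integral_eq)
      show "((\<lambda>r. f r (y r)) has_integral (y b - x)) {0..b}" using y b by (simp add: sol_def)
    qed (use b in simp)
    show "((\<lambda>r. f r (?w r)) has_integral (?w r - x)) {0..r}"
    proof (cases "r \<le> a")
      case True then show ?thesis using 1[of r] r by simp
    next
      case False
      have "((\<lambda>r. f (a + r) (z r)) has_integral (z (r - a) - y a)) {0..r - a}"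
        using z r False by (auto simp: sol_def)
      then have "((\<lambda>r. f (a + r) (?w (a + r))) has_integral (z (r - a) - y a)) {0..r - a}"
      proof (rule has_integral_eq[rotated])
        show "f (a + b) (z b) = f (a + b) (?w (a + b))" if "b \<in> {0..r - a}" for b
          using z0 that by (cases "b = 0") auto
      qed
      then have "((\<lambda>r. f r (?w r)) has_integral (z (r - a) - y a)) {a..r}"
        using has_integral_shift_0[of "\<lambda>r. f r (?w r)" a "z (r - a) - y a" "r - a"] by simp
      from has_integral_combine[OF a(1) _ 1[of a] this] show ?thesis
        using False a by simp
    qed
  qed (use a in auto)
qed

text \<open>Cutting and concatenating solutions give the two directions. Together with
  \<open>flow_shift\<close> and \<open>len_shift\<close> this is the semigroup law that reduces the
  iterated scheme to one flow.\<close>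

lemma alive_shift:
  assumes f: "regular C f" and a: "0 \<le> a" "0 \<le> s"
  shows "alive f x (a + s) \<longleftrightarrow> alive f x a \<and> alive (\<lambda>r. f (a + r)) (flow f x a) s"
  using sol_shift[OF sol_flow[OF f] a] sol_append[OF sol_flow[OF f]] alive_mono[of f x "a + s" a] a
  unfolding alive_def by (metis le_add_same_cancel1)

lemma flow_shift:
  assumes f: "regular C f" and a: "0 \<le> a" "0 \<le> s" and al: "alive f x (a + s)"
  shows "flow (\<lambda>r. f (a + r)) (flow f x a) s = flow f x (a + s)"
  using flow_eq[OF regular_shift[OF f] sol_shift[OF sol_flow[OF f al] a]] a by simp

lemma len_shift:
  assumes f: "regular C f" and a: "0 \<le> a" "0 \<le> s" and al: "alive f x (a + s)"
  shows "len f x (a + s) = len f x a + len (\<lambda>r. f (a + r)) (flow f x a) s"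
proof -
  let ?g = "\<lambda>r. norm (f r (flow f x r))"
  have "len (\<lambda>r. f (a + r)) (flow f x a) s = integral {0..s} (\<lambda>r. ?g (a + r))"
    unfolding len_def
    by (rule integral_cong) (use a flow_shift[OF f a(1) _ alive_mono[OF al]] in auto)
  also have "\<dots> = integral {a..a+s} ?g"
    using has_integral_shift_0[of ?g a _ s] unfolding integral_def integrable_on_def by simp
  finally show ?thesis
    using Henstock_Kurzweil_Integration.integral_combine[OF a(1) _ len_integrable[OF f al]] a by (simp add: len_def)
qed

text \<open>Agreement is required only for \<open>r < t\<close>: at the end of a step the field of
  the scheme has already jumped to the next one, and a single time does not affect
  integrals.\<close>

lemma sol_field_cong:
  assumes eq: "\<And>r z. 0 \<le> r \<Longrightarrow> r < t \<Longrightarrow> f r z = g r z"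
  shows "sol f x t y \<longleftrightarrow> sol g x t y"
  unfolding sol_def
  by (intro conj_cong refl ball_cong has_integral_spike_finite_eq[of "{t}"]) (auto simp: eq)

lemma field_cong:
  assumes eq: "\<And>r z. 0 \<le> r \<Longrightarrow> r < t \<Longrightarrow> f r z = g r z"
  shows "alive f x t \<longleftrightarrow> alive g x t" "flow f x t = flow g x t" "len f x t = len g x t"
proof -
  show "alive f x t \<longleftrightarrow> alive g x t" unfolding alive_def by (intro ex_cong1 sol_field_cong eq)
  have *: "flow f x s = flow g x s" if "s \<le> t" for s
  proof -
    have "sol f x s = sol g x s" by (intro ext sol_field_cong eq) (use that in auto)
    then show ?thesis by (simp add: flow_def)
  qed
  then show "flow f x t = flow g x t" by simp
  show "len f x t = len g x t" unfolding len_def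
    by (rule integral_spike[of "{t}"]) (use * eq in auto)
qed

section \<open>Agreement with the maximal solutions of the definitions\<close>

lemma solves_upto_sol:
  assumes y: "solves_upto v x \<tau> y" and s: "0 \<le> s" "ereal s < \<tau>"
  shows "sol (\<lambda>_. v) x s y"
proof -
  have d: "(y has_vector_derivative v (y r)) (at r within {0..b})" if "r \<in> {0..b}" "b \<le> s" for r b
  proof (rule has_vector_derivative_within_subset)
    have "ereal r < \<tau>" using that s by (meson atLeastAtMost_iff ereal_less_eq(3) le_less_trans order_trans)
    then show "(y has_vector_derivative v (y r)) (at r within {r. 0 \<le> r \<and> ereal r < \<tau>})"
      using y that by (auto simp: solves_upto_def)
    show "{0..b} \<subseteq> {r. 0 \<le> r \<and> ereal r < \<tau>}"
    proof safe
      fix q assume "q \<in> {0..b}"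
      then have "ereal q \<le> ereal s" using that by simp
      then show "ereal q < \<tau>" using s(2) by (rule le_less_trans)
    qed simp
  qed
  have "continuous_on {0..s} y"
    unfolding continuous_on_eq_continuous_within
    using has_vector_derivative_continuous[OF d[of _ s]] by blast
  moreover have "((\<lambda>r. v (y r)) has_integral (y b - y 0)) {0..b}" if "b \<in> {0..s}" for b
    by (rule fundamental_theorem_of_calculus) (use that d in auto)
  moreover have "y 0 = x" using y by (simp add: solves_upto_def)
  ultimately show ?thesis using s by (simp add: sol_def)
qed

lemma sol_has_vector_derivative:
  assumes f: "regular C f" and K: "finite K" "\<And>x. continuous_on (- K) (\<lambda>t. f t x)"
    and y: "sol f x t y" and s: "s \<in> {0<..<t} - K"
  shows "(y has_vector_derivative f s (y s)) (at s)"
proof -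
  have yc: "continuous_on {0..t} y" using y by (simp add: sol_def)
  have i: "(\<lambda>r. f r (y r)) integrable_on {0..t}" by (rule regular_integrable[OF f yc])
  have c: "continuous_on ({0..t} - K) (\<lambda>r. f r (y r))" by (rule regular_continuous_compose[OF f K yc])
  have "at s within ({0..t} - K) = at s"
  proof (rule at_within_open_subset[of s "{0<..<t} - K"])
    show "open ({0<..<t} - K)" using K(1) by (intro open_Diff) (auto simp: finite_imp_closed)
  qed (use s in auto)
  moreover have "((\<lambda>u. integral {0..u} (\<lambda>r. f r (y r))) has_vector_derivative f s (y s)) (at s within ({0..t} - K))"
    by (rule integral_has_vector_derivative_continuous_at[OF i])
      (use s K c in \<open>auto simp: continuous_on_eq_continuous_within\<close>)
  ultimately have "((\<lambda>u. x + integral {0..u} (\<lambda>r. f r (y r))) has_vector_derivative f s (y s)) (at s)"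
    by (auto intro!: derivative_eq_intros)
  then show ?thesis
  proof (rule has_vector_derivative_transform_within_open[where S="{0<..<t}"])
    show "x + integral {0..u} (\<lambda>r. f r (y r)) = y u" if "u \<in> {0<..<t}" for u
    proof -
      have "((\<lambda>r. f r (y r)) has_integral (y u - x)) {0..u}" using y that by (auto simp: sol_def)
      then show ?thesis by (simp add: integral_unique)
    qed
  qed (use s in auto)
qed

lemma sol_has_vector_derivative_within:
  assumes f: "regular C f" "\<And>x. continuous_on UNIV (\<lambda>t. f t x)" and y: "sol f x t y" and s: "s \<in> {0..t}"
  shows "(y has_vector_derivative f s (y s)) (at s within {0..t})"
proof -
  have yc: "continuous_on {0..t} y" using y by (simp add: sol_def)
  have c: "continuous_on {0..t} (\<lambda>r. f r (y r))"
    using regular_continuous_compose[OF f(1), of "{}" "{0..t}" y] yc f(2) by simp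
  have "((\<lambda>u. x + integral {0..u} (\<lambda>r. f r (y r))) has_vector_derivative f s (y s)) (at s within {0..t})"
    using integral_has_vector_derivative[OF c s] by (auto intro!: derivative_eq_intros)
  then show ?thesis
  proof (rule has_vector_derivative_transform[OF s, rotated])
    show "y u = x + integral {0..u} (\<lambda>r. f r (y r))" if "u \<in> {0..t}" for u
    proof -
      have "((\<lambda>r. f r (y r)) has_integral (y u - x)) {0..u}" using y that by (auto simp: sol_def)
      then show ?thesis by (simp add: integral_unique)
    qed
  qed
qed

lemma sol_autonomous_has_vector_derivative:
  "regular C (\<lambda>_. v) \<Longrightarrow> sol (\<lambda>_. v) x t y \<Longrightarrow> s \<in> {0..t} \<Longrightarrow>
     (y has_vector_derivative v (y s)) (at s within {0..t})"
  by (rule sol_has_vector_derivative_within[where f = "\<lambda>_. v"]) auto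

text \<open>\<open>lifetime\<close> is a supremum, so the strict inequality needs a solution that
  goes strictly beyond \<open>s\<close>; \<open>alive_extend\<close> provides it.\<close>

lemma alive_lifetime:
  assumes v: "regular C (\<lambda>_. v)" and s: "0 \<le> s"
  shows "ereal s < lifetime v x \<longleftrightarrow> alive (\<lambda>_. v) x s"
proof
  assume "ereal s < lifetime v x"
  then obtain \<tau> y where "ereal s < \<tau>" "solves_upto v x \<tau> y"
    unfolding lifetime_def less_Sup_iff by blast
  then show "alive (\<lambda>_. v) x s" unfolding alive_def using solves_upto_sol s by blast
next
  assume "alive (\<lambda>_. v) x s"
  then obtain t' where t': "s < t'" "alive (\<lambda>_. v) x t'" using alive_extend[OF v] by blast
  have "solves_upto v x (ereal t') (flow (\<lambda>_. v) x)"
    unfolding solves_upto_def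
  proof (intro conjI allI impI)
    fix r assume r: "0 \<le> r \<and> ereal r < ereal t'"
    show "(flow (\<lambda>_. v) x has_vector_derivative v (flow (\<lambda>_. v) x r)) (at r within {r. 0 \<le> r \<and> ereal r < ereal t'})"
      by (rule has_vector_derivative_within_subset[OF sol_autonomous_has_vector_derivative[OF v sol_flow[OF v t'(2)]]])
        (use r in auto)
  qed (rule flow_0[OF v])
  then have "ereal t' \<le> lifetime v x" unfolding lifetime_def by (intro Sup_upper) auto
  then show "ereal s < lifetime v x" using t'(1) by (meson ereal_less_eq(3) less_le_trans less_ereal.simps(1))
qed

text \<open>The supremum is attained: \<open>flow\<close> solves up to the lifetime itself, so the
  choice in \<open>max_sol\<close> is a genuine solution.\<close>

lemma solves_upto_max_sol:
  assumes v: "regular C (\<lambda>_. v)"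
  shows "solves_upto v x (lifetime v x) (max_sol v x)"
proof -
  have "solves_upto v x (lifetime v x) (flow (\<lambda>_. v) x)"
    unfolding solves_upto_def
  proof (intro conjI allI impI)
    fix r assume r: "0 \<le> r \<and> ereal r < lifetime v x"
    then obtain t' where t': "r < t'" "alive (\<lambda>_. v) x t'"
      using alive_lifetime[OF v] alive_extend[OF v] by metis
    have "(flow (\<lambda>_. v) x has_vector_derivative v (flow (\<lambda>_. v) x r)) (at r within {0..t'})"
      by (rule sol_autonomous_has_vector_derivative[OF v sol_flow[OF v t'(2)]]) (use r t' in auto)
    \<comment> \<open>A derivative at \<open>r\<close> depends only on the domain near
      \<open>r\<close>, and below \<open>t'\<close> both domains coincide.\<close>
    moreover have "at r within {r. 0 \<le> r \<and> ereal r < lifetime v x} = at r within {0..t'}"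
    proof (rule at_within_nhd[of _ "{..<t'}"])
      have "ereal s < lifetime v x" if "0 \<le> s" "s < t'" for s
        using alive_lifetime[OF v that(1)] alive_mono[OF t'(2)] that by simp
      then show "{r. 0 \<le> r \<and> ereal r < lifetime v x} \<inter> {..<t'} - {r} = {0..t'} \<inter> {..<t'} - {r}" by auto
    qed (use t' in auto)
    ultimately show "(flow (\<lambda>_. v) x has_vector_derivative v (flow (\<lambda>_. v) x r)) (at r within {r. 0 \<le> r \<and> ereal r < lifetime v x})"
      by simp
  qed (rule flow_0[OF v])
  then show ?thesis unfolding max_sol_def by (rule someI[of "solves_upto v x (lifetime v x)"])
qed

lemma max_sol_flow:
  assumes v: "regular C (\<lambda>_. v)" and a: "alive (\<lambda>_. v) x s"
  shows "max_sol v x s = flow (\<lambda>_. v) x s"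
proof -
  have s: "0 \<le> s" by (rule alive_nonneg[OF a])
  have "sol (\<lambda>_. v) x s (max_sol v x)"
    by (rule solves_upto_sol[OF solves_upto_max_sol[OF v] s]) (simp add: alive_lifetime[OF v s] a)
  from flow_eq[OF v this s] show ?thesis by simp
qed

lemma path_length_len:
  assumes v: "regular C (\<lambda>_. v)" and a: "alive (\<lambda>_. v) x s"
  shows "path_length v x s = len (\<lambda>_. v) x s"
proof (cases "s = 0")
  \<comment> \<open>On the degenerate interval the derivative relative to it carries no information,
    but both integrals vanish.\<close>
  case True then show ?thesis by (simp add: path_length_def len_def)
next
  case False
  have s: "0 < s" using alive_nonneg[OF a] False by simp
  have m: "sol (\<lambda>_. v) x s (max_sol v x)"
    by (rule solves_upto_sol[OF solves_upto_max_sol[OF v]]) (use s in \<open>auto simp: alive_lifetime[OF v] a\<close>)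
  show ?thesis
    unfolding path_length_def len_def
  proof (rule integral_cong)
    fix r assume r: "r \<in> {0..s}"
    have "vector_derivative (max_sol v x) (at r within {0..s}) = v (max_sol v x r)"
      by (rule vector_derivative_within_closed_interval[OF s r sol_autonomous_has_vector_derivative[OF v m r]])
    then show "norm (vector_derivative (max_sol v x) (at r within {0..s})) = norm (v (flow (\<lambda>_. v) x r))"
      using max_sol_flow[OF v alive_mono[OF a]] r by simp
  qed
qed

section \<open>Transported measures and the discretization\<close>

text \<open>Indicators of closed sets are limits of the functions
  \<open>max 0 (1 - real n * infdist x C)\<close>, and closed sets form an intersection-stable
  generator. This is the uniqueness behind the definite description in \<open>step\<close>.\<close>

lemma measure_eqI_bounded_continuous:
  fixes M N :: "'a::metric_space measure"
  assumes sets: "sets M = sets borel" "sets N = sets borel" and fin: "finite_measure M" "finite_measure N"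
    and eq: "\<And>\<psi> :: 'a \<Rightarrow> real. continuous_on UNIV \<psi> \<Longrightarrow> bounded (range \<psi>) \<Longrightarrow> (\<integral>x. \<psi> x \<partial>M) = (\<integral>x. \<psi> x \<partial>N)"
  shows "M = N"
proof (rule measure_eqI_generator_eq[where E="Collect closed" and \<Omega>=UNIV and A="\<lambda>_. UNIV"])
  have lim: "(\<lambda>n. \<integral>x. max 0 (1 - real n * infdist x C) \<partial>L) \<longlonglongrightarrow> measure L C"
    if L: "sets L = sets borel" "finite_measure L" and C: "closed C" "C \<noteq> {}" for L and C :: "'a set"
  proof -
    interpret L: finite_measure L by (rule L)
    have "C \<in> sets L" using C L by simp
    then have "measure L C = (\<integral>x. indicator C x \<partial>L)" by simp
    moreover have "(\<lambda>n. \<integral>x. max 0 (1 - real n * infdist x C) \<partial>L) \<longlonglongrightarrow> (\<integral>x. indicator C x \<partial>L)"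
    proof (rule integral_dominated_convergence[where w="\<lambda>_. 1"])
      show "(\<lambda>x. max 0 (1 - real n * infdist x C)) \<in> borel_measurable L" for n
        unfolding measurable_cong_sets[OF L(1) refl]
        by (intro borel_measurable_continuous_onI continuous_intros)
      show "indicator C \<in> borel_measurable L" using \<open>C \<in> sets L\<close> by (rule borel_measurable_indicator)
      show "AE x in L. norm (max 0 (1 - real n * infdist x C)) \<le> 1" for n
        by (auto simp: infdist_nonneg)
      show "AE x in L. (\<lambda>n. max 0 (1 - real n * infdist x C)) \<longlonglongrightarrow> indicator C x"
      proof (rule AE_I2)
        fix x
        show "(\<lambda>n. max 0 (1 - real n * infdist x C)) \<longlonglongrightarrow> indicator C x"
        proof (cases "x \<in> C")
          case False
          then have pos: "0 < infdist x C"
            using in_closed_iff_infdist_zero[OF C] infdist_nonneg[of x C] by (simp add: less_le)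
          obtain N :: nat where N: "1 / infdist x C < real N" using reals_Archimedean2 by blast
          have "\<forall>\<^sub>F n in sequentially. max 0 (1 - real n * infdist x C) = 0"
            using eventually_ge_at_top[of N]
          proof eventually_elim
            case (elim n)
            have "1 / infdist x C < real n" using N elim by simp
            then have "1 < real n * infdist x C" using pos by (simp add: field_simps)
            then show ?case by simp
          qed
          then show ?thesis using False by (simp add: tendsto_eventually)
        qed (simp add: infdist_zero)
      qed
    qed simp
    ultimately show ?thesis by simp
  qed
  show "emeasure M C = emeasure N C" if "C \<in> Collect closed" for C
  \<comment> \<open>The empty set is separate because \<open>infdist\<close> to it is 0, which would
    make the approximating functions constantly 1.\<close>
  proof (cases "C = {}")
    case False
    have "continuous_on UNIV (\<lambda>x. max 0 (1 - real n * infdist x C))" for n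
      by (intro continuous_intros)
    moreover have "bounded (range (\<lambda>x. max 0 (1 - real n * infdist x C)))" for n
      by (rule boundedI[of _ 1]) (auto simp: infdist_nonneg)
    ultimately have "measure M C = measure N C"
      using lim[OF sets(1) fin(1) _ False] lim[OF sets(2) fin(2) _ False] eq LIMSEQ_unique that by auto
    then show ?thesis by (simp add: finite_measure.emeasure_eq_measure[OF fin(1)] finite_measure.emeasure_eq_measure[OF fin(2)])
  qed simp
  show "Int_stable (Collect closed :: 'a set set)" by (auto simp: Int_stable_def)
  show "sets M = sigma_sets UNIV (Collect closed)" "sets N = sigma_sets UNIV (Collect closed)"
    by (simp_all add: sets borel_eq_closed)
  show "emeasure M UNIV \<noteq> \<infinity>"
    using finite_measure.emeasure_finite[OF fin(1)] by (simp add: top.not_eq_extremum)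
qed auto

section \<open>Transport of a measure along a flow with damping\<close>

definition weight :: "real \<Rightarrow> (real \<Rightarrow> 'a::euclidean_space \<Rightarrow> 'a) \<Rightarrow> real \<Rightarrow> 'a \<Rightarrow> real" where
  "weight \<epsilon> f t x = (if alive f x t then exp (- \<epsilon> * len f x t) else 0)"

text \<open>The default 0 makes the map total and Borel; dead particles have weight zero, so it is
  never seen.\<close>

definition endpoint :: "(real \<Rightarrow> 'a::euclidean_space \<Rightarrow> 'a) \<Rightarrow> real \<Rightarrow> 'a \<Rightarrow> 'a" where
  "endpoint f t x = (if alive f x t then flow f x t else 0)"

definition transport :: "real \<Rightarrow> (real \<Rightarrow> 'a::euclidean_space \<Rightarrow> 'a) \<Rightarrow> real \<Rightarrow> 'a measure \<Rightarrow> 'a measure" where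
  "transport \<epsilon> f t \<mu> = distr (density \<mu> (\<lambda>x. ennreal (weight \<epsilon> f t x))) borel (endpoint f t)"

text \<open>Mass may be lost to explosion and to damping, so the class stable under transport has
  mass at most one.\<close>

definition subprob :: "'a::euclidean_space measure \<Rightarrow> bool" where
  "subprob \<mu> \<longleftrightarrow> sets \<mu> = sets borel \<and> emeasure \<mu> UNIV \<le> 1"

lemma subprob_finite: "subprob \<mu> \<Longrightarrow> finite_measure \<mu>"
  by (rule finite_measureI) (auto simp: subprob_def sets_eq_imp_space_eq[of \<mu> borel] top_unique)

lemma subprob_measurable: "subprob \<mu> \<Longrightarrow> borel_measurable \<mu> = borel_measurable borel"
  by (simp add: subprob_def cong: measurable_cong_sets)

lemma weight_measurable:
  assumes f: "regular C f" and t: "0 \<le> t" shows "weight \<epsilon> f t \<in> borel_measurable borel"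
proof -
  have "(\<lambda>x. if x \<in> {x. alive f x t} then exp (- \<epsilon> * len f x t) else 0) \<in> borel_measurable borel"
    by (rule borel_measurable_continuous_on_if)
      (auto intro!: continuous_intros len_continuous_initial[OF f] borel_open open_alive[OF f t])
  then show ?thesis by (simp add: weight_def[abs_def])
qed

lemma endpoint_measurable:
  assumes f: "regular C f" and t: "0 \<le> t" shows "endpoint f t \<in> borel_measurable borel"
proof -
  have "(\<lambda>x. if x \<in> {x. alive f x t} then flow f x t else 0) \<in> borel_measurable borel"
    by (rule borel_measurable_continuous_on_if)
      (auto intro!: continuous_intros flow_continuous_initial[OF f] borel_open open_alive[OF f t])
  then show ?thesis by (simp add: endpoint_def[abs_def])
qed

lemma weight_nonneg: "0 \<le> weight \<epsilon> f t x"
  by (simp add: weight_def)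

lemma weight_le_1: "regular C f \<Longrightarrow> 0 \<le> \<epsilon> \<Longrightarrow> weight \<epsilon> f t x \<le> 1"
  by (simp add: weight_def len_nonneg)

lemma sets_transport [simp]: "sets (transport \<epsilon> f t \<mu>) = sets borel"
  by (simp add: transport_def)

lemma nn_integral_transport:
  assumes f: "regular C f" and t: "0 \<le> t" and \<mu>: "subprob \<mu>" and \<psi>: "\<psi> \<in> borel_measurable borel"
  shows "(\<integral>\<^sup>+x. \<psi> x \<partial>transport \<epsilon> f t \<mu>) = (\<integral>\<^sup>+x. ennreal (weight \<epsilon> f t x) * \<psi> (endpoint f t x) \<partial>\<mu>)"
proof -
  have [measurable]: "weight \<epsilon> f t \<in> borel_measurable \<mu>" "endpoint f t \<in> borel_measurable \<mu>" "\<psi> \<in> borel_measurable borel"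
    using weight_measurable[OF f t] endpoint_measurable[OF f t] \<psi> by (simp_all add: subprob_measurable[OF \<mu>])
  show ?thesis
    unfolding transport_def by (subst nn_integral_distr, simp_all, subst nn_integral_density, simp_all)
qed

lemma integral_transport:
  fixes \<psi> :: "'a::euclidean_space \<Rightarrow> 'b::euclidean_space"
  assumes f: "regular C f" and t: "0 \<le> t" and \<mu>: "subprob \<mu>" and \<psi>: "\<psi> \<in> borel_measurable borel"
  shows "(\<integral>x. \<psi> x \<partial>transport \<epsilon> f t \<mu>) = (\<integral>x. weight \<epsilon> f t x *\<^sub>R \<psi> (endpoint f t x) \<partial>\<mu>)"
proof -
  have [measurable]: "weight \<epsilon> f t \<in> borel_measurable \<mu>" "endpoint f t \<in> borel_measurable \<mu>" "\<psi> \<in> borel_measurable borel"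
    using weight_measurable[OF f t] endpoint_measurable[OF f t] \<psi> by (simp_all add: subprob_measurable[OF \<mu>])
  show ?thesis
    unfolding transport_def by (subst integral_distr, simp_all, subst integral_density, simp_all add: weight_nonneg)
qed

lemma subprob_transport:
  assumes f: "regular C f" and t: "0 \<le> t" and \<mu>: "subprob \<mu>" and \<epsilon>: "0 \<le> \<epsilon>"
  shows "subprob (transport \<epsilon> f t \<mu>)"
proof -
  have "emeasure (transport \<epsilon> f t \<mu>) UNIV = (\<integral>\<^sup>+x. 1 \<partial>transport \<epsilon> f t \<mu>)"
    by (simp add: transport_def)
  also have "\<dots> = (\<integral>\<^sup>+x. ennreal (weight \<epsilon> f t x) * 1 \<partial>\<mu>)"
    by (rule nn_integral_transport[OF f t \<mu>]) simp
  also have "\<dots> \<le> (\<integral>\<^sup>+x. 1 \<partial>\<mu>)"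
    using weight_le_1[OF f \<epsilon>] by (intro nn_integral_mono) simp
  also have "\<dots> = emeasure \<mu> UNIV" using \<mu> by (simp add: subprob_def sets_eq_imp_space_eq[of \<mu> borel])
  also have "\<dots> \<le> 1" using \<mu> by (simp add: subprob_def)
  finally show ?thesis by (simp add: subprob_def)
qed

text \<open>Existence in the definite description comes from \<open>transport\<close>, uniqueness
  from testing with bounded continuous functions. Values of \<open>max_sol\<close> after the
  lifetime are cut off by the indicator on one side and by the weight on the other.\<close>

lemma step_eq_transport:
  assumes v: "regular C (\<lambda>_. v)" and s: "0 \<le> s" and \<mu>: "subprob \<mu>" and \<epsilon>: "0 \<le> \<epsilon>"
  shows "step \<epsilon> v s \<mu> = transport \<epsilon> (\<lambda>_. v) s \<mu>"
proof -
  have fin: "finite_measure (transport \<epsilon> (\<lambda>_. v) s \<mu>)"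
    by (rule subprob_finite[OF subprob_transport[OF v s \<mu> \<epsilon>]])
  have int: "(\<integral>x. \<psi> x \<partial>transport \<epsilon> (\<lambda>_. v) s \<mu>) =
        (LINT x:{x. ereal s < lifetime v x}|\<mu>. \<psi> (max_sol v x s) * exp (- \<epsilon> * path_length v x s))"
    if "continuous_on UNIV \<psi>" for \<psi> :: "'a \<Rightarrow> real"
  proof -
    have "(\<integral>x. \<psi> x \<partial>transport \<epsilon> (\<lambda>_. v) s \<mu>) = (\<integral>x. weight \<epsilon> (\<lambda>_. v) s x *\<^sub>R \<psi> (endpoint (\<lambda>_. v) s x) \<partial>\<mu>)"
      by (rule integral_transport[OF v s \<mu> borel_measurable_continuous_onI[OF that]])
    also have "\<dots> = (LINT x:{x. ereal s < lifetime v x}|\<mu>. \<psi> (max_sol v x s) * exp (- \<epsilon> * path_length v x s))"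
      unfolding set_lebesgue_integral_def
      by (rule Bochner_Integration.integral_cong[OF refl])
        (auto simp: weight_def endpoint_def alive_lifetime[OF v s] max_sol_flow[OF v] path_length_len[OF v])
    finally show ?thesis .
  qed
  show ?thesis
    unfolding step_def
  proof (rule the_equality)
    fix \<nu> assume \<nu>: "sets \<nu> = sets borel \<and> finite_measure \<nu> \<and>
      (\<forall>\<psi>::'a \<Rightarrow> real. continuous_on UNIV \<psi> \<and> bounded (range \<psi>) \<longrightarrow> (\<integral>x. \<psi> x \<partial>\<nu>) =
        (LINT x:{x. ereal s < lifetime v x}|\<mu>. \<psi> (max_sol v x s) * exp (- \<epsilon> * path_length v x s)))"
    show "\<nu> = transport \<epsilon> (\<lambda>_. v) s \<mu>"
      by (rule measure_eqI_bounded_continuous) (use \<nu> fin int in auto)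
  qed (use fin int in simp)
qed

text \<open>Arc lengths add, so damping weights multiply, and a death in either stage gives weight
  zero on both sides.\<close>

lemma transport_shift:
  assumes f: "regular C f" and a: "0 \<le> a" "0 \<le> s" and \<mu>: "subprob \<mu>" and \<epsilon>: "0 \<le> \<epsilon>"
  shows "transport \<epsilon> (\<lambda>r. f (a + r)) s (transport \<epsilon> f a \<mu>) = transport \<epsilon> f (a + s) \<mu>"
proof (rule measure_eqI)
  fix A assume "A \<in> sets (transport \<epsilon> (\<lambda>r. f (a + r)) s (transport \<epsilon> f a \<mu>))"
  then have A: "A \<in> sets borel" by simp
  let ?g = "\<lambda>r. f (a + r)"
  note g = regular_shift[OF f, of a]
  have as: "0 \<le> a + s" using a by simp
  have "emeasure (transport \<epsilon> ?g s (transport \<epsilon> f a \<mu>)) A = (\<integral>\<^sup>+x. indicator A x \<partial>transport \<epsilon> ?g s (transport \<epsilon> f a \<mu>))"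
    using A by simp
  also have "\<dots> = (\<integral>\<^sup>+x. ennreal (weight \<epsilon> ?g s x) * indicator A (endpoint ?g s x) \<partial>transport \<epsilon> f a \<mu>)"
    by (rule nn_integral_transport[OF g a(2) subprob_transport[OF f a(1) \<mu> \<epsilon>]]) (use A in simp)
  also have "\<dots> = (\<integral>\<^sup>+x. ennreal (weight \<epsilon> f a x) * (ennreal (weight \<epsilon> ?g s (endpoint f a x)) * indicator A (endpoint ?g s (endpoint f a x))) \<partial>\<mu>)"
  proof (rule nn_integral_transport[OF f a(1) \<mu>])
    have [measurable]: "weight \<epsilon> ?g s \<in> borel_measurable borel" "endpoint ?g s \<in> borel_measurable borel" "A \<in> sets borel"
      using A weight_measurable[OF g a(2)] endpoint_measurable[OF g a(2)] by auto
    show "(\<lambda>x. ennreal (weight \<epsilon> ?g s x) * indicator A (endpoint ?g s x)) \<in> borel_measurable borel"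
      by measurable
  qed
  also have "\<dots> = (\<integral>\<^sup>+x. ennreal (weight \<epsilon> f (a + s) x) * indicator A (endpoint f (a + s) x) \<partial>\<mu>)"
  proof (intro nn_integral_cong)
    fix x
    show "ennreal (weight \<epsilon> f a x) * (ennreal (weight \<epsilon> ?g s (endpoint f a x)) * indicator A (endpoint ?g s (endpoint f a x)))
        = ennreal (weight \<epsilon> f (a + s) x) * indicator A (endpoint f (a + s) x)"
      using alive_shift[OF f a, of x] flow_shift[OF f a, of x] len_shift[OF f a, of x]
      by (auto simp: weight_def endpoint_def distrib_left exp_add mult.assoc[symmetric] simp flip: ennreal_mult' exp_add)
  qed
  also have "\<dots> = (\<integral>\<^sup>+x. indicator A x \<partial>transport \<epsilon> f (a + s) \<mu>)"
    by (rule nn_integral_transport[OF f as \<mu>, symmetric]) (use A in simp)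
  finally show "emeasure (transport \<epsilon> ?g s (transport \<epsilon> f a \<mu>)) A = emeasure (transport \<epsilon> f (a + s) \<mu>) A"
    using A by simp
qed simp

lemma transport_cong:
  assumes "\<And>r z. 0 \<le> r \<Longrightarrow> r < t \<Longrightarrow> f r z = g r z"
  shows "transport \<epsilon> f t \<mu> = transport \<epsilon> g t \<mu>"
proof -
  have "weight \<epsilon> f t = weight \<epsilon> g t" "endpoint f t = endpoint g t"
    using field_cong[OF assms] by (auto simp: weight_def endpoint_def fun_eq_iff)
  then show ?thesis by (simp add: transport_def)
qed

lemma transport_0:
  assumes f: "regular C f" and \<mu>: "subprob \<mu>"
  shows "transport \<epsilon> f 0 \<mu> = \<mu>"
proof (rule measure_eqI)
  show "sets (transport \<epsilon> f 0 \<mu>) = sets \<mu>" using \<mu> by (simp add: subprob_def)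
  fix A assume "A \<in> sets (transport \<epsilon> f 0 \<mu>)"
  then have A: "A \<in> sets borel" by simp
  have "emeasure (transport \<epsilon> f 0 \<mu>) A = (\<integral>\<^sup>+x. indicator A x \<partial>transport \<epsilon> f 0 \<mu>)" using A by simp
  also have "\<dots> = (\<integral>\<^sup>+x. ennreal (weight \<epsilon> f 0 x) * indicator A (endpoint f 0 x) \<partial>\<mu>)"
    by (rule nn_integral_transport[OF f _ \<mu>]) (use A in auto)
  also have "\<dots> = (\<integral>\<^sup>+x. indicator A x \<partial>\<mu>)"
    by (simp add: weight_def endpoint_def alive_0 len_0 flow_0[OF f])
  also have "\<dots> = emeasure \<mu> A" using A \<mu> by (simp add: subprob_def)
  finally show "emeasure (transport \<epsilon> f 0 \<mu>) A = emeasure \<mu> A" .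
qed

section \<open>The scheme as a single flow with a field piecewise constant in time\<close>

definition frozen :: "real \<Rightarrow> nat \<Rightarrow> (nat \<Rightarrow> 'a \<Rightarrow> 'a) \<Rightarrow> real \<Rightarrow> 'a \<Rightarrow> 'a" where
  "frozen h n v t = v (min n (nat \<lfloor>t / h\<rfloor>))"

lemma frozen_eq: 
  assumes "0 < h" "j \<le> n" "real j * h \<le> t" "t < real j * h + h"
  shows "frozen h n v t = v j"
proof -
  have "\<lfloor>t / h\<rfloor> = int j"
    using assms by (intro floor_unique) (auto simp: field_simps)
  then show ?thesis using assms by (simp add: frozen_def)
qed

lemma floor_grid:
  fixes h t :: real
  assumes "0 < h" "0 \<le> t"
  shows "real (nat \<lfloor>t / h\<rfloor>) * h \<le> t" "t < real (nat \<lfloor>t / h\<rfloor>) * h + h"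
proof -
  have "real (nat \<lfloor>t / h\<rfloor>) \<le> t / h" "t / h < real (nat \<lfloor>t / h\<rfloor>) + 1"
    using assms floor_correct[of "t / h"] by auto
  then have "real (nat \<lfloor>t / h\<rfloor>) * h \<le> t" "t < (real (nat \<lfloor>t / h\<rfloor>) + 1) * h"
    using assms(1) by (simp_all only: pos_le_divide_eq pos_divide_less_eq)
  then show "real (nat \<lfloor>t / h\<rfloor>) * h \<le> t" "t < real (nat \<lfloor>t / h\<rfloor>) * h + h"
    by (simp_all only: distrib_right mult_1)
qed

text \<open>Clipping the index at \<open>n\<close>, together with \<open>nat\<close> sending
  negative floors to 0, leaves finitely many jump times on the whole line, as \<open>regular\<close>
  requires.\<close>

lemma regular_frozen:
  assumes h: "0 < h" and v: "\<And>j. regular C (\<lambda>_. v j)"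
  shows "regular C (frozen h n v)"
proof -
  define K where "K = (\<lambda>j. real j * h) ` {..n}"
  have "continuous_on (- K) (\<lambda>t. frozen h n v t x)" for x
  proof -
    have "isCont (\<lambda>t. frozen h n v t x) t" if t: "t \<notin> K" for t
    proof -
      define j where "j = nat \<lfloor>t / h\<rfloor>"
      have const: ?thesis if "open S" "t \<in> S" "\<And>r. r \<in> S \<Longrightarrow> frozen h n v r = v i" for S i
      proof -
        have "\<forall>\<^sub>F r in nhds t. frozen h n v r x = v i x"
          using eventually_nhds_in_open[OF that(1,2)] by eventually_elim (simp add: that(3))
        then show ?thesis using isCont_cong[of "\<lambda>t. frozen h n v t x" "\<lambda>_. v i x" t] by simp
      qed
      consider "t < 0" | "real n * h < t" | "0 \<le> t" "t \<le> real n * h" by linarith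
      then show ?thesis
      proof cases
        case 1
        have "frozen h n v r = v 0" if "r \<in> {..<0}" for r
        proof -
          have "r / h \<le> 0" using that h by (simp add: field_simps)
          then have "\<lfloor>r / h\<rfloor> \<le> 0" by (simp add: floor_le_iff)
          then show ?thesis by (simp add: frozen_def)
        qed
        then show ?thesis using 1 by (intro const[of "{..<0}"]) auto
      next
        case 2
        have "frozen h n v r = v n" if "r \<in> {real n * h<..}" for r
        proof -
          have "real n \<le> r / h" using that h by (simp add: field_simps)
          then have "int n \<le> \<lfloor>r / h\<rfloor>" by (simp add: le_floor_iff)
          then have "n \<le> nat \<lfloor>r / h\<rfloor>" by simp
          then show ?thesis by (simp add: frozen_def min_def)
        qed
        then show ?thesis using 2 by (intro const[of "{real n * h<..}"]) auto
      next
        case 3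
        note le = floor_grid[OF h 3(1), folded j_def]
        have "real j * h \<le> real n * h" using le 3 by linarith
        then have jn: "j \<le> n" using h by simp
        have "real j * h \<noteq> t" using t jn unfolding K_def by auto
        then show ?thesis using le jn
          by (intro const[of "{real j * h <..< real j * h + h}" j]) (auto intro!: frozen_eq h)
      qed
    qed
    then show ?thesis by (simp add: continuous_at_imp_continuous_on)
  qed
  moreover have "finite K" by (simp add: K_def)
  moreover have "frozen h n v t = v (min n (nat \<lfloor>t / h\<rfloor>))" for t by (simp add: frozen_def)
  ultimately show ?thesis using v unfolding regular_def by metis
qed

lemma subprob_grid_measure:
  assumes reg: "\<And>\<mu>. subprob \<mu> \<Longrightarrow> regular C (\<lambda>_. ham_field W \<Phi> \<mu>)"
    and \<epsilon>: "0 \<le> \<epsilon>" and h: "0 < h" and \<mu>0: "subprob \<mu>0"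
  shows "subprob (grid_measure W \<Phi> \<epsilon> h \<mu>0 j)"
proof (induction j)
  case (Suc j)
  have h': "0 \<le> h" using h by simp
  show ?case
    using step_eq_transport[OF reg[OF Suc] h' Suc \<epsilon>] subprob_transport[OF reg[OF Suc] h' Suc \<epsilon>] by simp
qed (simp add: \<mu>0)

lemma discr_measure_transport:
  fixes W \<Phi> :: "'a::euclidean_space \<Rightarrow> real"
    and \<mu>0 :: "('a \<times> 'a) measure"
  defines "F \<equiv> \<lambda>h n \<epsilon> \<mu>0. frozen h n (\<lambda>j. ham_field W \<Phi> (grid_measure W \<Phi> \<epsilon> h \<mu>0 j))"
  assumes reg: "\<And>\<mu>. subprob \<mu> \<Longrightarrow> regular C (\<lambda>_. ham_field W \<Phi> \<mu>)"
    and \<epsilon>: "0 \<le> \<epsilon>" and T: "0 < T" and n: "1 \<le> n" and \<mu>0: "subprob \<mu>0" 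
  shows "regular C (F (T / real n) n \<epsilon> \<mu>0)"
    and "j \<le> n \<Longrightarrow> grid_measure W \<Phi> \<epsilon> (T / real n) \<mu>0 j = transport \<epsilon> (F (T / real n) n \<epsilon> \<mu>0) (real j * (T / real n)) \<mu>0"
    and "t \<in> {0..T} \<Longrightarrow> discr_measure W \<Phi> T \<mu>0 \<epsilon> n t = transport \<epsilon> (F (T / real n) n \<epsilon> \<mu>0) t \<mu>0"
proof -
  define h where "h = T / real n"
  have h: "0 < h" using T n by (simp add: h_def)
  let ?m = "grid_measure W \<Phi> \<epsilon> h \<mu>0"
  have sp: "subprob (?m j)" for j by (rule subprob_grid_measure[OF reg \<epsilon> h \<mu>0])
  let ?F = "F h n \<epsilon> \<mu>0"
  have F: "regular C ?F" unfolding F_def by (rule regular_frozen[OF h reg[OF sp]])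
  have adv: "step \<epsilon> (ham_field W \<Phi> (?m j)) s (?m j) = transport \<epsilon> ?F (real j * h + s) \<mu>0"
    if s: "0 \<le> s" "s \<le> h" and j: "j \<le> n" and m: "?m j = transport \<epsilon> ?F (real j * h) \<mu>0" for j s
  proof -
    have jh: "0 \<le> real j * h" using h by simp
    have "step \<epsilon> (ham_field W \<Phi> (?m j)) s (?m j) = transport \<epsilon> (\<lambda>_. ham_field W \<Phi> (?m j)) s (?m j)"
      by (rule step_eq_transport[OF reg[OF sp] s(1) sp \<epsilon>])
    also have "\<dots> = transport \<epsilon> (\<lambda>r. ?F (real j * h + r)) s (?m j)"
      unfolding F_def
      by (rule transport_cong) (use s h j in \<open>simp add: frozen_eq[of h j]\<close>)
    also have "\<dots> = transport \<epsilon> (\<lambda>r. ?F (real j * h + r)) s (transport \<epsilon> ?F (real j * h) \<mu>0)"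
      by (simp add: m)
    also have "\<dots> = transport \<epsilon> ?F (real j * h + s) \<mu>0"
      by (rule transport_shift[OF F jh s(1) \<mu>0 \<epsilon>])
    finally show ?thesis .
  qed
  have m: "?m j = transport \<epsilon> ?F (real j * h) \<mu>0" if "j \<le> n" for j
    using that
  proof (induction j)
    case 0 then show ?case by (simp add: transport_0[OF F \<mu>0])
  next
    case (Suc j)
    then have "?m (Suc j) = transport \<epsilon> ?F (real j * h + h) \<mu>0"
      using adv[of h j] h by simp
    then show ?case by (simp add: algebra_simps)
  qed
  then show "j \<le> n \<Longrightarrow> grid_measure W \<Phi> \<epsilon> (T / real n) \<mu>0 j = transport \<epsilon> (F (T / real n) n \<epsilon> \<mu>0) (real j * (T / real n)) \<mu>0"
    by (simp add: h_def)
  show "regular C (F (T / real n) n \<epsilon> \<mu>0)" using F by (simp add: h_def)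
  assume t: "t \<in> {0..T}"
  \<comment> \<open>At \<open>t = T\<close> this index is \<open>n\<close> with remaining time 0,
    which is why the steps above are treated for \<open>j \<le> n\<close> and not only
    \<open>j < n\<close>.\<close>
  define k where "k = nat \<lfloor>t / h\<rfloor>"
  have le: "real k * h \<le> t" "t < real k * h + h"
    unfolding k_def by (rule floor_grid[OF h]; use t in simp)+
  have "real k * h \<le> real n * h" using le t n by (simp add: h_def)
  then have kn: "k \<le> n" using h by simp
  have "discr_measure W \<Phi> T \<mu>0 \<epsilon> n t = step \<epsilon> (ham_field W \<Phi> (?m k)) (t - real k * h) (?m k)"
    by (simp add: discr_measure_def Let_def k_def h_def)
  also have "\<dots> = transport \<epsilon> ?F (real k * h + (t - real k * h)) \<mu>0"
    by (rule adv) (use le kn m in auto)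
  finally show "discr_measure W \<Phi> T \<mu>0 \<epsilon> n t = transport \<epsilon> (F (T / real n) n \<epsilon> \<mu>0) t \<mu>0"
    by (simp add: h_def)
qed

section \<open>The Hamiltonian field\<close>

lemma GDERIV_unique:
  assumes "GDERIV f x :> D" "GDERIV f x :> D'" shows "D = D'"
proof -
  have "(\<lambda>h. inner h D) = (\<lambda>h. inner h D')"
    using assms has_derivative_unique unfolding gderiv_def by blast
  then show ?thesis by (metis vector_eq_ldot)
qed

lemma grad_eqI: "GDERIV f x :> D \<Longrightarrow> grad f x = D"
  unfolding grad_def using GDERIV_unique by blast

lemma GDERIV_grad:
  fixes f :: "'a::euclidean_space \<Rightarrow> real"
  assumes "f differentiable (at x)" shows "GDERIV f x :> grad f x"
proof -
  define f' where "f' = frechet_derivative f (at x)"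
  have f': "(f has_derivative f') (at x)" using assms frechet_derivative_works f'_def by blast
  then have lin: "linear f'" by (rule has_derivative_linear)
  have "f' h = inner h (\<Sum>b\<in>Basis. f' b *\<^sub>R b)" for h
  proof -
    have "f' h = f' (\<Sum>b\<in>Basis. inner h b *\<^sub>R b)" by (simp add: euclidean_representation)
    also have "\<dots> = (\<Sum>b\<in>Basis. inner h b * f' b)" by (simp add: linear_sum[OF lin] linear_scale[OF lin])
    finally show ?thesis by (simp add: inner_sum_right mult.commute)
  qed
  then have "GDERIV f x :> (\<Sum>b\<in>Basis. f' b *\<^sub>R b)"
    using f' unfolding gderiv_def by (metis (no_types, lifting) ext)
  then show ?thesis using grad_eqI by metis
qed

lemma frechet_derivative_grad:
  fixes f :: "'a::euclidean_space \<Rightarrow> real"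
  assumes "f differentiable (at x)" shows "frechet_derivative f (at x) v = inner v (grad f x)"
  using GDERIV_grad[OF assms] frechet_derivative_at unfolding gderiv_def by metis

lemma has_derivative_zero_outside:
  assumes "closed A" "\<And>x. x \<notin> A \<Longrightarrow> f x = 0" "x \<notin> A"
  shows "(f has_derivative (\<lambda>_. 0)) (at x)"
  by (rule has_derivative_transform_within_open[of "\<lambda>_. 0" _ _ _ "- A"]) (use assms in auto)

lemma frechet_derivative_zero_outside:
  assumes "closed A" "\<And>x. x \<notin> A \<Longrightarrow> f x = 0" "x \<notin> A"
  shows "frechet_derivative f (at x) v = 0"
  by (simp add: frechet_derivative_at[OF has_derivative_zero_outside[OF assms], symmetric])

lemma zero_outside_supp: "x \<notin> supp f \<Longrightarrow> f x = 0"
  using closure_subset[of "{x. f x \<noteq> 0}"] by (auto simp: supp_def)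

lemma C1_lipschitz_on:
  fixes g :: "'a::euclidean_space \<Rightarrow> real"
  assumes g: "Ck (Suc 0) g" and S: "convex S"
    and M: "\<And>b x. b \<in> Basis \<Longrightarrow> x \<in> S \<Longrightarrow> \<bar>frechet_derivative g (at x) b\<bar> \<le> M b"
    and xy: "x \<in> S" "y \<in> S"
  shows "\<bar>g x - g y\<bar> \<le> (\<Sum>b\<in>Basis. M b) * norm (x - y)"
proof -
  have d: "g differentiable (at x)" for x using g by simp
  have "norm (g x - g y) \<le> (\<Sum>b\<in>Basis. M b) * norm (x - y)"
  proof (rule differentiable_bound[OF S _ _ xy])
    fix x assume x: "x \<in> S"
    show "(g has_derivative frechet_derivative g (at x)) (at x within S)"
      using d frechet_derivative_works has_derivative_at_withinI by blast
    show "onorm (frechet_derivative g (at x)) \<le> (\<Sum>b\<in>Basis. M b)"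
    proof (rule onorm_le)
      fix v
      have "frechet_derivative g (at x) v = (\<Sum>b\<in>Basis. inner v b * inner (grad g x) b)"
        unfolding frechet_derivative_grad[OF d] by (rule euclidean_inner)
      also have "norm \<dots> \<le> (\<Sum>b\<in>Basis. M b * norm v)"
      proof (rule sum_norm_le)
        fix b :: 'a assume b: "b \<in> Basis"
        have "\<bar>inner (grad g x) b\<bar> \<le> M b"
          using M[OF b x] by (simp add: frechet_derivative_grad[OF d] inner_commute)
        then show "norm (inner v b * inner (grad g x) b) \<le> M b * norm v"
          using mult_mono[of "\<bar>inner (grad g x) b\<bar>" "M b" "\<bar>inner v b\<bar>" "norm v"] Basis_le_norm[OF b, of v]
          by (simp add: abs_mult mult.commute)
      qed
      finally show "norm (frechet_derivative g (at x) v) \<le> (\<Sum>b\<in>Basis. M b) * norm v"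
        by (simp add: sum_distrib_right)
    qed
  qed
  then show ?thesis by simp
qed

lemma C2_differentiable: "Ck 2 f \<Longrightarrow> f differentiable (at x)"
  by (simp add: numeral_2_eq_2)

lemma C2_component: "Ck 2 f \<Longrightarrow> Ck (Suc 0) (\<lambda>x. frechet_derivative f (at x) v)"
  by (simp add: numeral_2_eq_2)

text \<open>The mean value inequality is applied to each partial derivative. A convex set with
  bounded second derivatives covers both uses: balls for \<open>\<Phi>\<close>, the whole space for
  \<open>W\<close>.\<close>

lemma grad_lipschitz_on:
  fixes f :: "'a::euclidean_space \<Rightarrow> real"
  assumes f: "Ck 2 f" and S: "convex S"
    and M: "\<And>b c. \<exists>M. \<forall>x\<in>S. \<bar>frechet_derivative (\<lambda>x. frechet_derivative f (at x) b) (at x) c\<bar> \<le> M"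
  obtains L where "0 \<le> L" "\<And>x y. x \<in> S \<Longrightarrow> y \<in> S \<Longrightarrow> norm (grad f x - grad f y) \<le> L * norm (x - y)"
proof -
  obtain M where M: "\<And>b c x. x \<in> S \<Longrightarrow> \<bar>frechet_derivative (\<lambda>x. frechet_derivative f (at x) b) (at x) c\<bar> \<le> M b c"
    using M by metis
  define L where "L = (\<Sum>b\<in>Basis. \<Sum>c\<in>Basis. \<bar>M b c\<bar>)"
  show ?thesis
  proof
    show "0 \<le> L" unfolding L_def by (intro sum_nonneg) auto
    fix x y assume xy: "x \<in> S" "y \<in> S"
    have "norm (grad f x - grad f y) \<le> (\<Sum>b\<in>Basis. \<bar>inner (grad f x - grad f y) b\<bar>)"
      by (rule norm_le_l1)
    also have "\<dots> \<le> (\<Sum>b\<in>Basis. (\<Sum>c\<in>Basis. \<bar>M b c\<bar>) * norm (x - y))"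
    proof (rule sum_mono)
      fix b :: 'a assume b: "b \<in> Basis"
      have "\<bar>frechet_derivative f (at x) b - frechet_derivative f (at y) b\<bar> \<le> (\<Sum>c\<in>Basis. \<bar>M b c\<bar>) * norm (x - y)"
        by (rule C1_lipschitz_on[OF C2_component[OF f] S _ xy]) (use M order_trans abs_ge_self in blast)
      then show "\<bar>inner (grad f x - grad f y) b\<bar> \<le> (\<Sum>c\<in>Basis. \<bar>M b c\<bar>) * norm (x - y)"
        by (simp add: frechet_derivative_grad[OF C2_differentiable[OF f]] inner_diff_right inner_commute[of _ b])
    qed
    finally show "norm (grad f x - grad f y) \<le> L * norm (x - y)"
      by (simp add: L_def sum_distrib_right)
  qed
qed

lemma C2_second_continuous:
  "Ck 2 f \<Longrightarrow> continuous_on S (\<lambda>x. frechet_derivative (\<lambda>x. frechet_derivative f (at x) b) (at x) c)"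
  by (simp add: numeral_2_eq_2) (meson continuous_on_subset subset_UNIV)

lemma grad_lipschitz_cball:
  fixes f :: "'a::euclidean_space \<Rightarrow> real"
  assumes f: "Ck 2 f"
  obtains L where "0 \<le> L" "\<And>x y. x \<in> cball 0 R \<Longrightarrow> y \<in> cball 0 R \<Longrightarrow> norm (grad f x - grad f y) \<le> L * norm (x - y)"
proof (rule grad_lipschitz_on[OF f, of "cball 0 R"])
  fix b c
  show "\<exists>M. \<forall>x\<in>cball 0 R. \<bar>frechet_derivative (\<lambda>x. frechet_derivative f (at x) b) (at x) c\<bar> \<le> M"
    using compact_image_norm_bound[OF C2_second_continuous[OF f] compact_cball] by (metis real_norm_def)
qed (use that in auto)

lemma grad_lipschitz_compact_supp:
  fixes f :: "'a::euclidean_space \<Rightarrow> real"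
  assumes f: "Ck 2 f" and supp: "compact (supp f)"
  obtains L where "0 \<le> L" "\<And>x y. norm (grad f x - grad f y) \<le> L * norm (x - y)"
proof (rule grad_lipschitz_on[OF f, of UNIV])
  fix b c
  let ?k = "\<lambda>x. frechet_derivative (\<lambda>x. frechet_derivative f (at x) b) (at x) c"
  have cl: "closed (supp f)" using supp by (rule compact_imp_closed)
  \<comment> \<open>Vanishing outside the closed support passes to the first derivative and, by the
    same lemma, to the second.\<close>
  have z: "?k x = 0" if "x \<notin> supp f" for x
    by (rule frechet_derivative_zero_outside[OF cl _ that], rule frechet_derivative_zero_outside[OF cl zero_outside_supp])
  obtain M where "\<forall>x\<in>supp f. \<bar>?k x\<bar> \<le> M"
    using compact_image_norm_bound[OF C2_second_continuous[OF f] supp] by (metis real_norm_def)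
  then have "\<bar>?k x\<bar> \<le> max M 0" for x using z[of x] by (cases "x \<in> supp f") auto
  then show "\<exists>M. \<forall>x\<in>UNIV. \<bar>?k x\<bar> \<le> M" by blast
qed (use that in auto)

lemma grad_continuous:
  fixes f :: "'a::euclidean_space \<Rightarrow> real"
  assumes f: "Ck 2 f" shows "continuous_on S (grad f)"
proof -
  have "continuous_on UNIV (grad f)"
  proof (rule continuous_on_componentwise[THEN iffD2], rule ballI)
    fix b :: 'a
    have "continuous_on UNIV (\<lambda>x. frechet_derivative f (at x) b)"
    proof -
      have "(\<lambda>x. frechet_derivative f (at x) b) differentiable (at x)" for x
        using C2_component[OF f, of b] by simp
      then show ?thesis
        by (intro differentiable_imp_continuous_on) (simp add: differentiable_on_def)
    qed
    then show "continuous_on UNIV (\<lambda>x. inner (grad f x) b)"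
      by (simp add: frechet_derivative_grad[OF C2_differentiable[OF f]] inner_commute)
  qed
  then show ?thesis by (rule continuous_on_subset) auto
qed

lemma grad_zero_outside_supp:
  fixes f :: "'a::euclidean_space \<Rightarrow> real"
  assumes "x \<notin> supp f" shows "grad f x = 0"
proof -
  have "closed (supp f)" by (simp add: supp_def)
  from has_derivative_zero_outside[OF this zero_outside_supp assms]
  have "GDERIV f x :> 0" by (simp add: gderiv_def)
  then show ?thesis by (rule grad_eqI)
qed

text \<open>A maximum attained on the compact support turns the pointwise strict inequality into a
  uniform gap. Applied to \<open>W\<close>, the gap \<open>B - b\<close> becomes the margin \<delta>
  of the barriers.\<close>

lemma grad_strict_bound:
  fixes f :: "'a::euclidean_space \<Rightarrow> real"
  assumes f: "Ck 2 f" and supp: "compact (supp f)" and B: "\<And>x. norm (grad f x) < B"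
  obtains b where "0 \<le> b" "b < B" "\<And>x. norm (grad f x) \<le> b"
proof (cases "supp f = {}")
  case True
  then have "norm (grad f x) \<le> 0" for x using grad_zero_outside_supp[of x f] by simp
  then show ?thesis using that[of 0] B[of undefined] norm_ge_zero order_le_less_trans by blast
next
  case False
  then obtain x where x: "\<And>y. y \<in> supp f \<Longrightarrow> norm (grad f y) \<le> norm (grad f x)"
    using continuous_attains_sup[OF supp False, of "\<lambda>x. norm (grad f x)"]
    by (metis continuous_on_norm grad_continuous[OF f])
  have "norm (grad f y) \<le> norm (grad f x)" for y
    using x[of y] grad_zero_outside_supp[of y f] by (cases "y \<in> supp f") auto
  then show ?thesis using that[of "norm (grad f x)"] B by auto
qed

text \<open>The remainder is uniform in the base point \<open>a\<close>, which permits
  differentiation under the integral; the constant \<open>L\<close> instead of \<open>L / 2\<close>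
  is enough for that.\<close>

lemma C2_taylor:
  fixes f :: "'a::euclidean_space \<Rightarrow> real"
  assumes f: "Ck 2 f" and L: "0 \<le> L" "\<And>x y. norm (grad f x - grad f y) \<le> L * norm (x - y)"
  shows "\<bar>f (a + h) - f a - inner h (grad f a)\<bar> \<le> L * norm h * norm h"
proof -
  have "norm (f (a + h) - f a - inner (a + h - a) (grad f a)) \<le> norm (a + h - a) * (L * norm h)"
  proof (rule differentiable_bound_linearization[where S="cball a (norm h)" and f'="\<lambda>x h. inner h (grad f x)"])
    show "a + t *\<^sub>R (a + h - a) \<in> cball a (norm h)" if "t \<in> {0..1}" for t
      using that by (auto simp: dist_norm mult_left_le_one_le)
    show "(f has_derivative (\<lambda>h. inner h (grad f x))) (at x within cball a (norm h))" for x
      using GDERIV_grad[OF C2_differentiable[OF f]] has_derivative_at_withinI unfolding gderiv_def by blast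
    show "onorm ((\<lambda>i. inner i (grad f x)) - (\<lambda>i. inner i (grad f a))) \<le> L * norm h" if "x \<in> cball a (norm h)" for x
      unfolding fun_diff_def
    proof (rule onorm_le)
      fix i
      have "norm (inner i (grad f x - grad f a)) \<le> norm i * norm (grad f x - grad f a)"
        using Cauchy_Schwarz_ineq2 by auto
      also have "\<dots> \<le> norm i * (L * norm h)"
        using that order_trans[OF L(2)[of x a] mult_left_mono[OF _ L(1)]]
        by (intro mult_left_mono) (auto simp: dist_norm norm_minus_commute)
      finally show "norm (inner i (grad f x) - inner i (grad f a)) \<le> L * norm h * norm i"
        by (simp add: inner_diff_right mult.commute)
    qed
  qed auto
  then show ?thesis by (simp add: mult.assoc mult.left_commute)
qed

section \<open>The mean-field force\<close>

definition grad_conv :: "('a::euclidean_space \<Rightarrow> real) \<Rightarrow> ('a \<times> 'a) measure \<Rightarrow> 'a \<Rightarrow> 'a" where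
  "grad_conv W \<mu> q = (\<integral>x. grad W (q - snd x) \<partial>\<mu>)"

lemma subprob_integral_bound:
  fixes \<psi> :: "'a::euclidean_space \<Rightarrow> 'b::euclidean_space"
  assumes \<mu>: "subprob \<mu>" and \<psi>: "\<psi> \<in> borel_measurable borel" and b: "0 \<le> b" "\<And>x. norm (\<psi> x) \<le> b"
  shows "integrable \<mu> \<psi>" "norm (\<integral>x. \<psi> x \<partial>\<mu>) \<le> b"
proof -
  interpret finite_measure \<mu> by (rule subprob_finite[OF \<mu>])
  show i: "integrable \<mu> \<psi>"
    by (rule integrable_const_bound[of _ b]) (use b \<psi> in \<open>auto simp: subprob_measurable[OF \<mu>]\<close>)
  have sp: "space \<mu> = UNIV" using \<mu> sets_eq_imp_space_eq[of \<mu> borel] by (simp add: subprob_def)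
  have "measure \<mu> UNIV \<le> 1" using \<mu> by (simp add: subprob_def emeasure_eq_measure)
  have "norm (\<integral>x. \<psi> x \<partial>\<mu>) \<le> (\<integral>x. norm (\<psi> x) \<partial>\<mu>)" by (rule integral_norm_bound)
  also have "\<dots> \<le> (\<integral>x. b \<partial>\<mu>)" by (rule integral_mono) (use i b in auto)
  also have "\<dots> = b * measure \<mu> UNIV" by (simp add: sp)
  also have "\<dots> \<le> b * 1" using \<open>measure \<mu> UNIV \<le> 1\<close> b(1) by (rule mult_left_mono)
  finally show "norm (\<integral>x. \<psi> x \<partial>\<mu>) \<le> b" by simp
qed

lemma grad_W_shift_measurable:
  fixes W :: "'a::euclidean_space \<Rightarrow> real"
  assumes W: "Ck 2 W"
  shows "(\<lambda>x. grad W (q - snd x)) \<in> borel_measurable borel"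
proof (rule borel_measurable_continuous_onI)
  show "continuous_on UNIV (\<lambda>x. grad W (q - snd x))"
    by (rule continuous_on_compose2[OF grad_continuous[OF W, of UNIV]]) (auto intro!: continuous_intros)
qed

lemma grad_conv_bound:
  fixes W :: "'a::euclidean_space \<Rightarrow> real"
  assumes W: "Ck 2 W" and b: "0 \<le> b" "\<And>x. norm (grad W x) \<le> b" and \<mu>: "subprob \<mu>"
  shows "norm (grad_conv W \<mu> q) \<le> b"
  unfolding grad_conv_def
  by (rule subprob_integral_bound(2)[OF \<mu> grad_W_shift_measurable[OF W] b(1)]) (rule b(2))

lemma grad_conv_lipschitz:
  fixes W :: "'a::euclidean_space \<Rightarrow> real"
  assumes W: "Ck 2 W" and b: "0 \<le> b" "\<And>x. norm (grad W x) \<le> b" 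
    and L: "0 \<le> L" "\<And>x y. norm (grad W x - grad W y) \<le> L * norm (x - y)" and \<mu>: "subprob \<mu>"
  shows "norm (grad_conv W \<mu> q - grad_conv W \<mu> q') \<le> L * norm (q - q')"
proof -
  have i: "integrable \<mu> (\<lambda>x. grad W (q - snd x))" for q
    by (rule subprob_integral_bound(1)[OF \<mu> grad_W_shift_measurable[OF W] b(1)]) (rule b(2))
  have "grad_conv W \<mu> q - grad_conv W \<mu> q' = (\<integral>x. grad W (q - snd x) - grad W (q' - snd x) \<partial>\<mu>)"
    unfolding grad_conv_def by (rule Bochner_Integration.integral_diff[symmetric, OF i i])
  also have "norm \<dots> \<le> L * norm (q - q')"
  proof (rule subprob_integral_bound[OF \<mu> borel_measurable_diff[OF grad_W_shift_measurable[OF W] grad_W_shift_measurable[OF W]]])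
    show "norm (grad W (q - snd x) - grad W (q' - snd x)) \<le> L * norm (q - q')" for x :: "'a \<times> 'a"
      using L(2)[of "q - snd x" "q' - snd x"] by simp
  qed (use L(1) in simp)
  finally show ?thesis .
qed

text \<open>The uniform Taylor remainder, integrated against a mass of at most one, is still at most
  \<open>L * norm h * norm h\<close>.\<close>

lemma GDERIV_conv:
  fixes W :: "'a::euclidean_space \<Rightarrow> real"
  assumes W: "Ck 2 W" and b: "0 \<le> b" "\<And>x. norm (grad W x) \<le> b" "\<And>x. \<bar>W x\<bar> \<le> b"
    and L: "0 \<le> L" "\<And>x y. norm (grad W x - grad W y) \<le> L * norm (x - y)" and \<mu>: "subprob \<mu>"
  shows "GDERIV (conv W \<mu>) q :> grad_conv W \<mu> q"
  unfolding gderiv_def has_derivative_at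
proof
  show "bounded_linear (\<lambda>h. inner h (grad_conv W \<mu> q))" by (rule bounded_linear_inner_left)
  have "W differentiable_on UNIV" using C2_differentiable[OF W] by (simp add: differentiable_on_def)
  then have Wc: "continuous_on UNIV W" by (rule differentiable_imp_continuous_on)
  have Wm: "(\<lambda>x. W (q - snd x)) \<in> borel_measurable borel" for q
    by (rule borel_measurable_continuous_onI, rule continuous_on_compose2[OF Wc]) (auto intro!: continuous_intros)
  have Wi: "integrable \<mu> (\<lambda>x. W (q - snd x))" for q
    by (rule subprob_integral_bound(1)[OF \<mu> Wm b(1)]) (use b in auto)
  have gi: "integrable \<mu> (\<lambda>x. grad W (q - snd x))" for q
    by (rule subprob_integral_bound(1)[OF \<mu> grad_W_shift_measurable[OF W] b(1)]) (rule b(2))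
  have est: "norm (conv W \<mu> (q + h) - conv W \<mu> q - inner h (grad_conv W \<mu> q)) / norm h \<le> L * norm h" for h
  proof -
    have "conv W \<mu> (q + h) - conv W \<mu> q - inner h (grad_conv W \<mu> q)
        = (\<integral>x. W ((q - snd x) + h) - W (q - snd x) - inner h (grad W (q - snd x)) \<partial>\<mu>)"
    proof -
      have 1: "integrable \<mu> (\<lambda>x. W (q - snd x + h))" using Wi[of "q + h"] by (simp add: algebra_simps)
      have "inner h (grad_conv W \<mu> q) = (\<integral>x. inner h (grad W (q - snd x)) \<partial>\<mu>)"
        unfolding grad_conv_def by (rule integral_inner_right[symmetric]) (rule gi)
      moreover have "conv W \<mu> (q + h) = (\<integral>x. W (q - snd x + h) \<partial>\<mu>)"
        unfolding conv_def by (simp add: add_diff_eq diff_add_eq)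
      moreover have "integrable \<mu> (\<lambda>x. inner h (grad W (q - snd x)))"
        by (rule integrable_inner_right) (rule gi)
      ultimately show ?thesis
        using 1 Wi[of q] by (simp add: conv_def Bochner_Integration.integral_diff)
    qed
    also have "norm \<dots> \<le> L * norm h * norm h"
    proof (rule subprob_integral_bound[OF \<mu>])
      show "(\<lambda>x. W ((q - snd x) + h) - W (q - snd x) - inner h (grad W (q - snd x))) \<in> borel_measurable borel"
      proof -
        have [measurable]: "(\<lambda>x. W (q - snd x + h)) \<in> borel_measurable borel" using Wm[of "q + h"] by (simp add: algebra_simps)
        note [measurable] = Wm[of q] grad_W_shift_measurable[OF W, of q]
        show ?thesis by measurable
      qed
      show "norm (W (q - snd x + h) - W (q - snd x) - inner h (grad W (q - snd x))) \<le> L * norm h * norm h" for x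
        using C2_taylor[OF W L] by simp
    qed (use L in simp)
    finally show ?thesis by (cases "h = 0") (auto simp: divide_le_eq L)
  qed
  show "(\<lambda>h. norm (conv W \<mu> (q + h) - conv W \<mu> q - inner h (grad_conv W \<mu> q)) / norm h) \<midarrow>0\<rightarrow> 0"
  proof (rule Lim_null_comparison)
    show "\<forall>\<^sub>F h in at 0. norm (norm (conv W \<mu> (q + h) - conv W \<mu> q - inner h (grad_conv W \<mu> q)) / norm h) \<le> L * norm h"
      using est by simp
    show "(\<lambda>h. L * norm h) \<midarrow>0\<rightarrow> 0" by (intro tendsto_eq_intros) auto
  qed
qed

text \<open>The Hamiltonian field with the mean-field gradient replaced by a prescribed force
  \<open>G\<close>. The separation matters because the limit force is found before any limit
  measure.\<close>

definition kick :: "('a::euclidean_space \<Rightarrow> real) \<Rightarrow> (real \<Rightarrow> 'a \<Rightarrow> 'a) \<Rightarrow> real \<Rightarrow> 'a \<times> 'a \<Rightarrow> 'a \<times> 'a" where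
  "kick \<Phi> G t = (\<lambda>(p, q). (- (G t q + grad \<Phi> q), p))"

lemma ham_field_kick:
  fixes W \<Phi> :: "'a::euclidean_space \<Rightarrow> real"
  assumes W: "Ck 2 W" and b: "0 \<le> b" "\<And>x. norm (grad W x) \<le> b" "\<And>x. \<bar>W x\<bar> \<le> b"
    and L: "0 \<le> L" "\<And>x y. norm (grad W x - grad W y) \<le> L * norm (x - y)"
    and \<Phi>: "Ck 2 \<Phi>" and \<mu>: "subprob \<mu>"
  shows "ham_field W \<Phi> \<mu> = kick \<Phi> (\<lambda>_. grad_conv W \<mu>) t"
proof -
  have "grad (\<lambda>q'. conv W \<mu> q' + \<Phi> q') q = grad_conv W \<mu> q + grad \<Phi> q" for q
    by (intro grad_eqI GDERIV_add GDERIV_conv[OF W b L \<mu>] GDERIV_grad C2_differentiable[OF \<Phi>])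
  then show ?thesis by (auto simp: ham_field_def grad_H_def J_def kick_def fun_eq_iff)
qed

lemma norm_fst_snd_le: "norm (fst x) \<le> norm x" "norm (snd x) \<le> norm x"
  using norm_fst_le[of "fst x" "snd x"] norm_snd_le[of "snd x" "fst x"] by auto

text \<open>The point is the order of quantifiers: \<open>C\<close> depends on
  \<open>\<Phi>\<close>, \<open>b\<close> and \<open>L\<close> but not on the force, so the scheme
  at all resolutions and its limit share it.\<close>

lemma regular_kick:
  fixes \<Phi> :: "'a::euclidean_space \<Rightarrow> real"
  assumes \<Phi>: "Ck 2 \<Phi>" and L: "0 \<le> L" and b: "0 \<le> b"
  obtains C where "\<And>G. (\<And>t q. norm (G t q) \<le> b) \<Longrightarrow> (\<And>t q q'. norm (G t q - G t q') \<le> L * norm (q - q')) \<Longrightarrow>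
      (\<exists>K. finite K \<and> (\<forall>q. continuous_on (- K) (\<lambda>t. G t q))) \<Longrightarrow> regular C (kick \<Phi> G)"
proof -
  have "\<exists>L'\<ge>0. \<forall>x\<in>cball 0 R. \<forall>y\<in>cball 0 R. norm (grad \<Phi> x - grad \<Phi> y) \<le> L' * norm (x - y)" for R
    using grad_lipschitz_cball[OF \<Phi>, of R] by metis
  then obtain L' where L': "\<And>R. 0 \<le> L' R" "\<And>R x y. norm x \<le> R \<Longrightarrow> norm y \<le> R \<Longrightarrow> norm (grad \<Phi> x - grad \<Phi> y) \<le> L' R * norm (x - y)"
    by (metis mem_cball_0)
  have "\<exists>M. \<forall>x\<in>cball 0 R. norm (grad \<Phi> x) \<le> M" for R
    using compact_image_norm_bound[OF grad_continuous[OF \<Phi>] compact_cball] by metis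
  then obtain M where M: "\<And>R x. norm x \<le> R \<Longrightarrow> norm (grad \<Phi> x) \<le> M R" by (metis mem_cball_0)
  define C where "C R = \<bar>R\<bar> + b + \<bar>M R\<bar> + L + L' R + 1" for R
  show ?thesis
  proof (rule that)
    fix G :: "real \<Rightarrow> 'a \<Rightarrow> 'a"
    assume Gb: "\<And>t q. norm (G t q) \<le> b" and GL: "\<And>t q q'. norm (G t q - G t q') \<le> L * norm (q - q')"
      and "\<exists>K. finite K \<and> (\<forall>q. continuous_on (- K) (\<lambda>t. G t q))"
    then obtain K where K: "finite K" "\<And>q. continuous_on (- K) (\<lambda>t. G t q)" by blast
    have "continuous_on (- K) (\<lambda>t. kick \<Phi> G t x)" for x
      unfolding kick_def by (cases x) (auto intro!: continuous_intros K)
    moreover have "norm (kick \<Phi> G t x) \<le> C R" if x: "norm x \<le> R" for t R x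
    proof -
      obtain p q where [simp]: "x = (p, q)" by fastforce
      have pq: "norm p \<le> R" "norm q \<le> R" using norm_fst_snd_le[of x] x by auto
      have "norm (kick \<Phi> G t x) \<le> norm (G t q + grad \<Phi> q) + norm p"
        using norm_Pair_le[of "- (G t q + grad \<Phi> q)" p] unfolding norm_minus_cancel by (simp add: kick_def)
      also have "\<dots> \<le> b + M R + R" using norm_triangle_ineq[of "G t q" "grad \<Phi> q"] Gb[of t q] M[OF pq(2)] pq by linarith
      also have "\<dots> \<le> C R" unfolding C_def using L L'(1)[of R] by linarith
      finally show ?thesis .
    qed
    moreover have "norm (kick \<Phi> G t x - kick \<Phi> G t y) \<le> C R * norm (x - y)" if x: "norm x \<le> R" and y: "norm y \<le> R" for t R x y
    proof -
      obtain p q p' q' where [simp]: "x = (p, q)" "y = (p', q')" by fastforce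
      have q: "norm q \<le> R" "norm q' \<le> R" using norm_fst_snd_le[of x] norm_fst_snd_le[of y] x y by auto
      have d: "norm (p - p') \<le> norm (x - y)" "norm (q - q') \<le> norm (x - y)" using norm_fst_snd_le[of "x - y"] by auto
      have "kick \<Phi> G t x - kick \<Phi> G t y = (- ((G t q - G t q') + (grad \<Phi> q - grad \<Phi> q')), p - p')"
        by (simp add: kick_def)
      also have "norm \<dots> \<le> norm ((G t q - G t q') + (grad \<Phi> q - grad \<Phi> q')) + norm (p - p')"
        using norm_Pair_le[of "- ((G t q - G t q') + (grad \<Phi> q - grad \<Phi> q'))" "p - p'"] unfolding norm_minus_cancel .
      also have "\<dots> \<le> L * norm (q - q') + L' R * norm (q - q') + norm (p - p')"
        using norm_triangle_ineq[of "G t q - G t q'" "grad \<Phi> q - grad \<Phi> q'"] GL[of t q q'] L'(2)[OF q] by linarith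
      also have "\<dots> \<le> L * norm (x - y) + L' R * norm (x - y) + 1 * norm (x - y)"
        using d L L'(1) by (intro add_mono mult_left_mono) auto
      also have "\<dots> = (L + L' R + 1) * norm (x - y)" by (simp add: algebra_simps)
      also have "\<dots> \<le> C R * norm (x - y)"
        unfolding C_def using b by (intro mult_right_mono) auto
      finally show ?thesis .
    qed
    ultimately show "regular C (kick \<Phi> G)" using K(1) unfolding regular_def by auto
  qed
qed

section \<open>Particles that leave do not return\<close>

text \<open>A mean value inequality that tolerates finitely many times without a derivative, namely
  the jump times of the field.\<close>

lemma increment_ge:
  fixes g :: "real \<Rightarrow> real"
  assumes ab: "a \<le> b" and K: "finite K" and g: "continuous_on {a..b} g"
    and d: "\<And>s. s \<in> {a<..<b} - K \<Longrightarrow> \<exists>D. (g has_real_derivative D) (at s) \<and> c \<le> D"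
  shows "c * (b - a) \<le> g b - g a"
proof -
  obtain g' where g': "\<And>s. s \<in> {a<..<b} - K \<Longrightarrow> (g has_real_derivative g' s) (at s) \<and> c \<le> g' s"
    using d by metis
  define g'' where "g'' s = (if s \<in> {a<..<b} - K then g' s else c)" for s
  have "(g'' has_integral (g b - g a)) {a..b}"
    by (rule fundamental_theorem_of_calculus_interior_strong[OF K ab _ g])
      (use g' in \<open>auto simp: g''_def simp flip: has_real_derivative_iff_has_vector_derivative\<close>)
  moreover have "((\<lambda>_. c) has_integral (c * (b - a))) {a..b}"
    using has_integral_const_real[of c a b] ab by (simp add: mult.commute)
  ultimately show ?thesis
    by (intro has_integral_le[of "\<lambda>_. c" "c * (b - a)" "{a..b}" g'']) (use g' in \<open>auto simp: g''_def\<close>)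
qed

lemma last_below:
  fixes r :: "real \<Rightarrow> real"
  assumes r: "continuous_on {a..b} r" and le: "a \<le> b" "r a \<le> R" "R < r b"
  obtains c where "a \<le> c" "c < b" "r c = R" "\<And>s. s \<in> {c<..b} \<Longrightarrow> R < r s"
proof -
  define Z where "Z = {s \<in> {a..b}. r s = R}"
  have iv: "\<exists>z\<in>Z. s \<le> z" if s: "s \<in> {a..b}" "r s \<le> R" for s
  proof -
    have "continuous_on {s..b} r" by (rule continuous_on_subset[OF r]) (use s in auto)
    then obtain z where "s \<le> z" "z \<le> b" "r z = R"
      using IVT'[of r s R b] s le by auto
    then have "z \<in> Z" using s by (simp add: Z_def)
    then show ?thesis using \<open>s \<le> z\<close> by blast
  qed
  have "closed Z" unfolding Z_def by (rule continuous_closed_preimage_constant[OF r]) auto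
  then have "compact Z" unfolding compact_eq_bounded_closed
    by (auto simp: Z_def intro: bounded_subset[of "{a..b}"])
  moreover have "Z \<noteq> {}" using iv[of a] le by auto
  ultimately obtain c where c: "c \<in> Z" "\<And>z. z \<in> Z \<Longrightarrow> z \<le> c"
    using compact_attains_sup[of Z] by auto
  show ?thesis
  proof (rule that)
    show "a \<le> c" "r c = R" using c(1) by (auto simp: Z_def)
    show "c < b" using c(1) le by (cases "c = b") (auto simp: Z_def)
    fix s assume s: "s \<in> {c<..b}"
    show "R < r s"
    proof (rule ccontr)
      assume "\<not> R < r s"
      then obtain z where "z \<in> Z" "s \<le> z" using iv[of s] s \<open>a \<le> c\<close> by auto
      then show False using c(2) s by fastforce
    qed
  qed
qed

lemma first_below:
  fixes r :: "real \<Rightarrow> real"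
  assumes r: "continuous_on {a..b} r" and le: "a \<le> b" "R < r a" "r b \<le> R"
  obtains c where "a < c" "c \<le> b" "r c = R" "\<And>s. s \<in> {a..<c} \<Longrightarrow> R < r s"
proof -
  have "continuous_on {-b..-a} (\<lambda>s. r (- s))"
    by (rule continuous_on_compose2[OF r]) (auto intro!: continuous_intros)
  from last_below[OF this, of R] le obtain c where c: "- b \<le> c" "c < - a" "r (- c) = R"
    "\<And>s. s \<in> {c<..-a} \<Longrightarrow> R < r (- s)" by auto
  show ?thesis
    by (rule that[of "- c"]) (use c(1-3) c(4)[of "- _"] in \<open>auto simp: minus_less_iff\<close>)
qed

text \<open>The radius \<open>\<rho> = norm q\<close> satisfies \<open>\<rho>'' \<ge> - u' \<rho> + \<delta>\<close>, so \<open>\<rho>'\<^sup>2 / 2 + u \<rho>\<close> increases while the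
  particle moves outwards; beyond a strict peak of \<open>u\<close> it therefore never stops moving outwards.\<close>

lemma no_return:
  fixes p q F :: "real \<Rightarrow> 'a::real_inner"
  assumes K: "finite K" and pc: "continuous_on {0..t} p" and qc: "continuous_on {0..t} q"
    and dq: "\<And>s. s \<in> {0<..<t} - K \<Longrightarrow> (q has_vector_derivative p s) (at s)"
    and dp: "\<And>s. s \<in> {0<..<t} - K \<Longrightarrow> (p has_vector_derivative - F s) (at s)"
    and u: "\<And>r. 0 < r \<Longrightarrow> (u has_real_derivative u' r) (at r)" "continuous_on {0<..} u'"
    and \<delta>: "0 < \<delta>"
    and force: "\<And>s. s \<in> {0..t} \<Longrightarrow> q s \<noteq> 0 \<Longrightarrow> inner (F s) (q s) \<le> (u' (norm (q s)) - \<delta>) * norm (q s)"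
    and R: "0 < R" "\<And>r. R < r \<Longrightarrow> u r < u R"
    and q0: "norm (q 0) \<le> R" and \<tau>: "\<tau> \<in> {0..t}" "R < norm (q \<tau>)"
  shows "R < norm (q t)"
proof (rule ccontr)
  assume "\<not> R < norm (q t)"
  then have qt: "norm (q t) \<le> R" by simp
  define r where "r s = norm (q s)" for s
  define v where "v s = inner (p s) (q s) / norm (q s)" for s
  have rc: "continuous_on {0..t} r" unfolding r_def by (intro continuous_intros qc)
  \<comment> \<open>The excursion around \<open>\<tau>\<close>: between \<open>a\<close> and
    \<open>b\<close> the particle is strictly outside, and its radius is \<open>R\<close> at both
    ends.\<close>
  obtain a where a: "0 \<le> a" "a < \<tau>" "r a = R" "\<And>s. s \<in> {a<..\<tau>} \<Longrightarrow> R < r s"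
  proof (rule last_below[of 0 \<tau> r R])
    show "continuous_on {0..\<tau>} r" by (rule continuous_on_subset[OF rc]) (use \<tau> in auto)
  qed (use q0 \<tau> in \<open>auto simp: r_def\<close>)
  obtain b where b: "\<tau> < b" "b \<le> t" "r b = R" "\<And>s. s \<in> {\<tau>..<b} \<Longrightarrow> R < r s"
  proof (rule first_below[of \<tau> t r R])
    show "continuous_on {\<tau>..t} r" by (rule continuous_on_subset[OF rc]) (use \<tau> in auto)
  qed (use qt \<tau> in \<open>auto simp: r_def\<close>)
  have out: "R < r s" if "s \<in> {a<..<b}" for s
    using a(4)[of s] b(4)[of s] that by (cases "s \<le> \<tau>") auto
  have ge: "R \<le> r s" if "s \<in> {a..b}" for s
    using out[of s] a(3) b(3) that by (cases "s = a \<or> s = b") auto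
  have nz: "q s \<noteq> 0" if "s \<in> {a..b}" for s using ge[OF that] R(1) by (auto simp: r_def)
  have ab: "{a..b} \<subseteq> {0..t}" "a < b" using a b by auto
  have rc': "continuous_on {a..b} r" by (rule continuous_on_subset[OF rc ab(1)])
  have vc: "continuous_on {a..b} v" unfolding v_def
    by (intro continuous_intros continuous_on_subset[OF pc ab(1)] continuous_on_subset[OF qc ab(1)]) (use nz in auto)
  have dr: "(r has_real_derivative v s) (at s)" if s: "s \<in> {a<..<b} - K" for s
  proof -
    have "(q has_derivative (\<lambda>h. h *\<^sub>R p s)) (at s)"
      using dq[of s] s ab by (auto simp: has_vector_derivative_def)
    from has_derivative_compose[OF this has_derivative_norm[OF nz]] s
    have "(r has_derivative (\<lambda>h. inner (h *\<^sub>R p s) (sgn (q s)))) (at s)" by (simp add: r_def[abs_def])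
    then show ?thesis
      by (rule has_derivative_imp_has_field_derivative) (simp add: v_def sgn_div_norm divide_inverse mult.commute)
  qed
  \<comment> \<open>The second derivative of the radius is the radial component of
    \<open>- F\<close> plus the centrifugal term, \<open>inner p p - v * v\<close> divided by the
    radius, which is nonnegative by Cauchy-Schwarz.\<close>
  have dv: "\<exists>D. (v has_real_derivative D) (at s) \<and> \<delta> - u' (r s) \<le> D" if s: "s \<in> {a<..<b} - K" for s
  proof -
    have s': "s \<in> {0<..<t} - K" "s \<in> {0..t}" using s ab by auto
    have rs: "0 < r s" using ge[of s] R(1) s by auto
    have 1: "((\<lambda>s. inner (p s) (q s)) has_real_derivative (inner (p s) (p s) + inner (- F s) (q s))) (at s)"
      unfolding has_field_derivative_def
      using has_derivative_inner[OF dp[OF s'(1), unfolded has_vector_derivative_def] dq[OF s'(1), unfolded has_vector_derivative_def]]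
      by (rule has_derivative_eq_rhs) (auto simp: algebra_simps)
    have "(v has_real_derivative ((inner (p s) (p s) + inner (- F s) (q s)) * r s - inner (p s) (q s) * v s) / (r s * r s)) (at s)"
      using DERIV_divide[OF 1 dr[OF s]] rs unfolding v_def[abs_def] r_def by simp
    moreover have "\<delta> - u' (r s) \<le> ((inner (p s) (p s) + inner (- F s) (q s)) * r s - inner (p s) (q s) * v s) / (r s * r s)"
    proof -
      have pq: "inner (p s) (q s) = v s * r s" using rs by (simp add: v_def r_def)
      have "(v s * r s)\<^sup>2 \<le> inner (p s) (p s) * (r s)\<^sup>2"
        using Cauchy_Schwarz_ineq[of "p s" "q s"] pq by (simp add: r_def power2_norm_eq_inner)
      then have "(v s)\<^sup>2 \<le> inner (p s) (p s)" using rs by (simp add: power_mult_distrib)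
      then have "v s * v s \<le> inner (p s) (p s)" by (simp add: power2_eq_square)
      moreover have "inner (F s) (q s) \<le> (u' (r s) - \<delta>) * r s"
        using force[OF s'(2)] nz[of s] s by (simp add: r_def)
      ultimately have "(\<delta> - u' (r s)) * r s \<le> inner (p s) (p s) - inner (F s) (q s) - v s * v s"
        by (simp add: algebra_simps)
      then have "(\<delta> - u' (r s)) * r s * r s \<le> (inner (p s) (p s) - inner (F s) (q s) - v s * v s) * r s"
        using rs by (intro mult_right_mono) auto
      then show ?thesis using rs unfolding pq by (simp add: le_divide_eq algebra_simps)
    qed
    ultimately show ?thesis by blast
  qed
  \<comment> \<open>\<open>u\<close> is smaller to the right of \<open>R\<close>, so its slope there
    cannot be positive. This makes the lower bound \<open>\<delta> - u'\<close> of the radial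
    acceleration positive near \<open>R\<close>.\<close>
  have u'R: "u' R \<le> 0"
  proof (rule ccontr)
    assume "\<not> u' R \<le> 0"
    then obtain d where "0 < d" "\<And>h. 0 < h \<Longrightarrow> h < d \<Longrightarrow> u R < u (R + h)"
      using DERIV_pos_inc_right[OF u(1)[OF R(1)]] by auto
    then have "u R < u (R + d / 2)" by simp
    then show False using R(2)[of "R + d / 2"] \<open>0 < d\<close> by simp
  qed
  \<comment> \<open>With negative radial velocity at \<open>a\<close> the radius could not rise
    above \<open>R\<close> right afterwards.\<close>
  have va: "0 \<le> v a"
  proof (rule ccontr)
    assume neg: "\<not> 0 \<le> v a"
    obtain e where e: "0 < e" "\<And>s. s \<in> {a..b} \<Longrightarrow> dist s a < e \<Longrightarrow> dist (v s) (v a) < - v a"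
      using vc[unfolded continuous_on_iff, rule_format, of a "- v a"] neg ab(2) by auto
    define s where "s = min (a + e / 2) ((a + b) / 2)"
    have s: "a < s" "s < b" "s - a < e" using e(1) ab(2) by (auto simp: s_def min_def field_simps)
    have "0 * (s - a) \<le> (\<lambda>s. - r s) s - (\<lambda>s. - r s) a"
    proof (rule increment_ge[OF _ K])
      show "continuous_on {a..s} (\<lambda>s. - r s)"
        by (intro continuous_intros continuous_on_subset[OF rc']) (use s in auto)
      fix z assume z: "z \<in> {a<..<s} - K"
      have "dist (v z) (v a) < - v a" using e(2)[of z] z s by (auto simp: dist_real_def)
      then have "v z \<le> 0" by (simp add: dist_real_def)
      moreover have "((\<lambda>s. - r s) has_real_derivative - v z) (at z)"
        using dr[of z] z s by (intro derivative_intros) auto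
      ultimately show "\<exists>D. ((\<lambda>s. - r s) has_real_derivative D) (at z) \<and> 0 \<le> D" by force
    qed (use s in auto)
    then show False using out[of s] s a(3) by simp
  qed
  \<comment> \<open>The radial velocity at \<open>a\<close> may be zero, which is where the margin
    is needed: continuity of \<open>u'\<close> keeps the acceleration at least
    \<open>\<delta> / 2\<close> for a short time, and the velocity becomes strictly
    positive.\<close>
  obtain c where c: "a < c" "c < b" "\<And>s. s \<in> {a..c} \<Longrightarrow> u' (r s) \<le> \<delta> / 2"
  proof -
    have "continuous_on {a..b} (\<lambda>s. u' (r s))"
      by (rule continuous_on_compose2[OF u(2) rc']) (use ge R(1) in force)
    then obtain e where e: "0 < e" "\<And>s. s \<in> {a..b} \<Longrightarrow> dist s a < e \<Longrightarrow> dist (u' (r s)) (u' (r a)) < \<delta> / 2"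
      unfolding continuous_on_iff using ab(2) half_gt_zero[OF \<delta>]
      by (metis atLeastAtMost_iff less_imp_le order_refl)
    define c where "c = min (a + e / 2) ((a + b) / 2)"
    have c: "a < c" "c < b" "c - a < e" using e(1) ab(2) by (auto simp: c_def min_def field_simps)
    show ?thesis
    proof (rule that[OF c(1,2)])
      fix s assume s: "s \<in> {a..c}"
      have "dist (u' (r s)) (u' (r a)) < \<delta> / 2" using e(2)[of s] s c by (auto simp: dist_real_def)
      then have "\<bar>u' (r s) - u' R\<bar> < \<delta> / 2" by (simp add: dist_real_def a(3))
      then show "u' (r s) \<le> \<delta> / 2" using u'R by linarith
    qed
  qed
  have vc_pos: "0 < v s" if s: "s \<in> {a<..c}" for s
  proof -
    have "\<delta> / 2 * (s - a) \<le> v s - v a"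
    proof (rule increment_ge[OF _ K])
      show "continuous_on {a..s} v" by (rule continuous_on_subset[OF vc]) (use s c in auto)
      fix z assume z: "z \<in> {a<..<s} - K"
      then obtain D where "(v has_real_derivative D) (at z)" "\<delta> - u' (r z) \<le> D"
        using dv[of z] s c by auto
      moreover have "u' (r z) \<le> \<delta> / 2" using c(3)[of z] z s by auto
      ultimately show "\<exists>D. (v has_real_derivative D) (at z) \<and> \<delta> / 2 \<le> D" by force
    qed (use s in auto)
    moreover have "0 < \<delta> / 2 * (s - a)" using \<delta> s by simp
    ultimately show ?thesis using va by linarith
  qed
  have r_up: "r c \<le> r e" if e: "e \<in> {c..b}" and pos: "\<And>s. s \<in> {c<..<e} \<Longrightarrow> 0 \<le> v s" for e
  proof -
    have "0 * (e - c) \<le> r e - r c"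
    proof (rule increment_ge[OF _ K])
      show "continuous_on {c..e} r" by (rule continuous_on_subset[OF rc']) (use e c in auto)
      fix z assume z: "z \<in> {c<..<e} - K"
      have "(r has_real_derivative v z) (at z)" using dr[of z] z e c by auto
      moreover have "0 \<le> v z" using pos z by auto
      ultimately show "\<exists>D. (r has_real_derivative D) (at z) \<and> 0 \<le> D" by blast
    qed (use e in auto)
    then show ?thesis by simp
  qed
  have rcR: "R < r c" using out[of c] c by auto
  have "\<exists>s\<in>{c..b}. v s \<le> 0"
  proof (rule ccontr)
    assume *: "\<not> (\<exists>s\<in>{c..b}. v s \<le> 0)"
    have "r c \<le> r b"
    proof (rule r_up)
      show "0 \<le> v s" if "s \<in> {c<..<b}" for s
        using * that by (meson atLeastAtMost_iff greaterThanLessThan_iff less_imp_le linear)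
    qed (use c in auto)
    then show False using rcR b(3) by simp
  qed
  then obtain w where w: "w \<in> {c..b}" "v w \<le> 0" by blast
  have "continuous_on {c..w} v" by (rule continuous_on_subset[OF vc]) (use w c in auto)
  \<comment> \<open>The first turning point. There the energy below is purely potential and at least
    its value at \<open>a\<close>, although the radius lies beyond the peak.\<close>
  then obtain e where e: "c < e" "e \<le> w" "v e = 0" "\<And>s. s \<in> {c..<e} \<Longrightarrow> 0 < v s"
  proof (rule first_below[of c w v 0])
    show "0 < v c" by (rule vc_pos) (use c in auto)
  qed (use w in auto)
  have e': "a < e" "e \<le> b" using e w c by auto
  have v_pos: "0 < v s" if "s \<in> {a<..<e}" for s
    using vc_pos[of s] e(4)[of s] that by (cases "s \<le> c") auto
  define E where "E s = (v s)\<^sup>2 / 2 + u (r s)" for s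
  have uc: "continuous_on {0<..} u"
    using u(1) by (auto intro!: continuous_at_imp_continuous_on DERIV_isCont)
  have "0 * (e - a) \<le> E e - E a"
  proof (rule increment_ge[OF _ K])
    have "continuous_on {a..e} (\<lambda>s. u (r s))"
      by (rule continuous_on_compose2[OF uc continuous_on_subset[OF rc']]) (use ge R(1) e' in force)+
    then show "continuous_on {a..e} E" unfolding E_def
      by (intro continuous_intros continuous_on_subset[OF vc]) (use e' in auto)
    fix z assume z: "z \<in> {a<..<e} - K"
    obtain D where D: "(v has_real_derivative D) (at z)" "\<delta> - u' (r z) \<le> D"
      using dv[of z] z e' by auto
    have "0 < r z" using ge[of z] z e' R(1) by auto
    from DERIV_chain2[OF u(1)[OF this] dr[of z]] z e'
    have "((\<lambda>s. u (r s)) has_real_derivative u' (r z) * v z) (at z)" by auto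
    then have "(E has_real_derivative v z * (D + u' (r z))) (at z)"
      unfolding E_def[abs_def] using D(1) by (auto intro!: derivative_eq_intros simp: algebra_simps)
    moreover have "0 \<le> v z * (D + u' (r z))"
      using v_pos[of z] z D(2) \<delta> by (intro mult_nonneg_nonneg) auto
    ultimately show "\<exists>D. (E has_real_derivative D) (at z) \<and> 0 \<le> D" by blast
  qed (use e' in auto)
  then have "(v a)\<^sup>2 / 2 + u R \<le> u (r e)" using e(3) a(3) unfolding E_def by simp
  then have "u R \<le> u (r e)" using zero_le_power2[of "v a"] by linarith
  moreover have "R < r e" using rcR r_up[of e] e e(4) w by (force simp: less_eq_real_def)
  ultimately show False using R(2) by force
qed

section \<open>Barriers at the peaks of the comparison potential\<close>

definition barrier :: "('a::euclidean_space \<Rightarrow> real) \<Rightarrow> real \<Rightarrow> real \<Rightarrow> bool" where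
  "barrier \<Phi> b R \<longleftrightarrow> 0 < R \<and> (\<exists>u u' \<delta>. 0 < \<delta> \<and> (\<forall>r>0. (u has_real_derivative u' r) (at r)) \<and>
     continuous_on {0<..} u' \<and> (\<forall>q. q \<noteq> 0 \<longrightarrow> b + \<delta> + inner (grad \<Phi> q) (q /\<^sub>R norm q) \<le> u' (norm q)) \<and>
     (\<forall>r>R. u r < u R))"

text \<open>A far peak \<open>norm (qL L)\<close> of \<open>u\<close> serves as \<open>R\<close>,
  and the gap \<open>B - b\<close> between the allowed and the actual force bound as \<delta>. Peaks
  occur at arbitrarily large radii, so every bounded region can be enclosed.\<close>

lemma barrier_exists:
  fixes \<Phi> :: "'a::euclidean_space \<Rightarrow> real"
  assumes dyn: "dynamical_hypothesis \<Phi> B" and \<Phi>: "Ck 2 \<Phi>" and b: "b < B"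
  obtains R where "R0 \<le> R" "barrier \<Phi> b R"
proof -
  obtain u :: "real \<Rightarrow> real" and qL :: "nat \<Rightarrow> 'a" where u: "Ck 2 u" and u': "\<And>r. 0 < r \<Longrightarrow> B + radial_max \<Phi> r \<le> deriv u r"
    and qL: "filterlim (\<lambda>L. norm (qL L)) at_top sequentially"
    and peak: "\<And>L q::'a. 1 \<le> L \<Longrightarrow> norm (qL L) < norm q \<Longrightarrow> u (norm q) < u (norm (qL L))"
    using dyn unfolding dynamical_hypothesis_def by blast
  have "\<forall>\<^sub>F L in sequentially. max R0 1 \<le> norm (qL L)"
    using qL unfolding filterlim_at_top by blast
  then have "\<forall>\<^sub>F L in sequentially. max R0 1 \<le> norm (qL L) \<and> 1 \<le> L"
    using eventually_ge_at_top[of 1] by eventually_elim simp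
  then obtain L where L: "max R0 1 \<le> norm (qL L)" "1 \<le> L"
    by (auto dest: eventually_happens)
  have du: "(u has_real_derivative deriv u r) (at r)" for r
    using C2_differentiable[OF u] DERIV_deriv_iff_real_differentiable by blast
  have grad_u: "grad u = deriv u"
    using du by (auto intro!: grad_eqI simp: fun_eq_iff)
  have "barrier \<Phi> b (norm (qL L))"
    unfolding barrier_def
  proof (rule conjI, use L in force, rule exI[of _ u], rule exI[of _ "deriv u"], rule exI[of _ "B - b"], intro conjI allI impI)
    show "continuous_on {0<..} (deriv u)" using grad_continuous[OF u] grad_u by metis
    fix q :: 'a assume q: "q \<noteq> 0"
    \<comment> \<open>\<open>radial_max\<close> is a real supremum and dominates its values only if
      they are bounded above; the sphere is compact and misses the origin.\<close>
    have "bdd_above ((\<lambda>q. inner (grad \<Phi> q) (q /\<^sub>R norm q)) ` sphere 0 (norm q))"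
    proof (intro bounded_imp_bdd_above compact_imp_bounded compact_continuous_image)
      show "continuous_on (sphere 0 (norm q)) (\<lambda>q. inner (grad \<Phi> q) (q /\<^sub>R norm q))"
        by (intro continuous_intros grad_continuous[OF \<Phi>]) (use q in auto)
    qed auto
    then have "inner (grad \<Phi> q) (q /\<^sub>R norm q) \<le> radial_max \<Phi> (norm q)"
      unfolding radial_max_def by (rule cSUP_upper2[of _ _ q]) auto
    then show "b + (B - b) + inner (grad \<Phi> q) (q /\<^sub>R norm q) \<le> deriv u (norm q)"
      using u'[of "norm q"] q by simp
  next
    fix r assume r: "norm (qL L) < r"
    have "0 \<le> r" using r norm_ge_zero[of "qL L"] by linarith
    \<comment> \<open>The peak condition speaks about vectors; every nonnegative radius is the norm
      of one.\<close>
    then obtain q :: 'a where "norm q = r" by (rule vector_choose_size)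
    then show "u r < u (norm (qL L))" using peak[OF L(2)] r by blast
  qed (use b du in auto)
  then show ?thesis using that[of "norm (qL L)"] L by simp
qed

lemma kick_no_return:
  fixes \<Phi> :: "'a::euclidean_space \<Rightarrow> real"
  assumes bar: "barrier \<Phi> b R" and f: "regular C (kick \<Phi> G)" and G: "\<And>t q. norm (G t q) \<le> b"
    and a: "alive (kick \<Phi> G) x t" and \<tau>: "0 \<le> \<tau>" "\<tau> \<le> t"
    and x: "norm (snd x) \<le> R" and out: "R < norm (snd (flow (kick \<Phi> G) x \<tau>))"
  shows "R < norm (snd (flow (kick \<Phi> G) x t))"
proof -
  obtain u u' \<delta> where \<delta>: "0 < \<delta>" and u: "\<And>r. 0 < r \<Longrightarrow> (u has_real_derivative u' r) (at r)" "continuous_on {0<..} u'"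
    and force: "\<And>q. q \<noteq> 0 \<Longrightarrow> b + \<delta> + inner (grad \<Phi> q) (q /\<^sub>R norm q) \<le> u' (norm q)"
    and R: "0 < R" "\<And>r. R < r \<Longrightarrow> u r < u R"
    using bar unfolding barrier_def by blast
  obtain K where K: "finite K" "\<And>x. continuous_on (- K) (\<lambda>t. kick \<Phi> G t x)"
    using f by (auto simp: regular_def)
  let ?X = "flow (kick \<Phi> G) x"
  have c: "continuous_on {0..t} ?X" by (rule flow_continuous[OF f a])
  have d: "(?X has_vector_derivative kick \<Phi> G s (?X s)) (at s)" if "s \<in> {0<..<t} - K" for s
    by (rule sol_has_vector_derivative[OF f K sol_flow[OF f a] that])
  show ?thesis
  proof (rule no_return[OF K(1), where p="\<lambda>s. fst (?X s)" and q="\<lambda>s. snd (?X s)" and F="\<lambda>s. G s (snd (?X s)) + grad \<Phi> (snd (?X s))"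
        and u=u and u'=u' and \<delta>=\<delta> and \<tau>=\<tau>])
    show "((\<lambda>s. snd (?X s)) has_vector_derivative fst (?X s)) (at s)" if "s \<in> {0<..<t} - K" for s
      using bounded_linear.has_vector_derivative[OF bounded_linear_snd d[OF that]] by (simp add: kick_def split_beta)
    show "((\<lambda>s. fst (?X s)) has_vector_derivative - (G s (snd (?X s)) + grad \<Phi> (snd (?X s)))) (at s)" if "s \<in> {0<..<t} - K" for s
      using bounded_linear.has_vector_derivative[OF bounded_linear_fst d[OF that]] by (simp add: kick_def split_beta)
    fix s assume "snd (?X s) \<noteq> 0"
    define q where "q = snd (?X s)"
    have q: "0 < norm q" using \<open>snd (?X s) \<noteq> 0\<close> by (simp add: q_def)
    have "inner (G s q) q \<le> norm (G s q) * norm q" by (rule norm_cauchy_schwarz)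
    also have "\<dots> \<le> b * norm q" using G by (intro mult_right_mono) auto
    finally have 1: "inner (G s q) q \<le> b * norm q" .
    have "(b + \<delta> + inner (grad \<Phi> q) (q /\<^sub>R norm q)) * norm q \<le> u' (norm q) * norm q"
      using force[of q] q by (intro mult_right_mono) auto
    moreover have "inner (grad \<Phi> q) (q /\<^sub>R norm q) * norm q = inner (grad \<Phi> q) q"
      using q by simp
    ultimately have "b * norm q + \<delta> * norm q + inner (grad \<Phi> q) q \<le> u' (norm q) * norm q"
      by (simp only: distrib_right)
    with 1 have "inner (G s q + grad \<Phi> q) q \<le> (u' (norm q) - \<delta>) * norm q"
      by (simp add: algebra_simps)
    then show "inner (G s (snd (?X s)) + grad \<Phi> (snd (?X s))) (snd (?X s)) \<le> (u' (norm (snd (?X s))) - \<delta>) * norm (snd (?X s))"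
      by (simp add: q_def)
  next
    show "norm (snd (?X 0)) \<le> R" using x by (simp add: flow_0[OF f])
  qed (use \<delta> u R \<tau> out in \<open>auto intro!: continuous_intros c\<close>)
qed

text \<open>A predicate, so that \<open>P\<close> can be fixed before the force, the function
  \<open>C\<close> and the starting point are chosen.\<close>

definition momentum_bound :: "('a::euclidean_space \<Rightarrow> real) \<Rightarrow> real \<Rightarrow> real \<Rightarrow> real \<Rightarrow> real \<Rightarrow> real \<Rightarrow> bool" where
  "momentum_bound \<Phi> b T M R P \<longleftrightarrow> (\<forall>C G x t s. regular C (kick \<Phi> G) \<longrightarrow> (\<forall>t q. norm (G t q) \<le> b) \<longrightarrow>
     alive (kick \<Phi> G) x t \<longrightarrow> t \<le> T \<longrightarrow> norm x \<le> M \<longrightarrow> (\<forall>s\<in>{0..t}. norm (snd (flow (kick \<Phi> G) x s)) \<le> R) \<longrightarrow>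
     s \<in> {0..t} \<longrightarrow> norm (flow (kick \<Phi> G) x s) \<le> P)"

lemma momentum_boundD:
  assumes "momentum_bound \<Phi> b T M R P" "regular C (kick \<Phi> G)" "\<And>t q. norm (G t q) \<le> b" "alive (kick \<Phi> G) x t"
    "t \<le> T" "norm x \<le> M" "\<And>s. s \<in> {0..t} \<Longrightarrow> norm (snd (flow (kick \<Phi> G) x s)) \<le> R" "s \<in> {0..t}"
  shows "norm (flow (kick \<Phi> G) x s) \<le> P"
  using assms unfolding momentum_bound_def by blast

lemma momentum_bound_exists:
  fixes \<Phi> :: "'a::euclidean_space \<Rightarrow> real"
  assumes \<Phi>: "Ck 2 \<Phi>"
  obtains P where "momentum_bound \<Phi> b T M R P"
proof -
  obtain m where m: "\<And>q. norm q \<le> R \<Longrightarrow> norm (grad \<Phi> q) \<le> m"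
    using compact_image_norm_bound[OF grad_continuous[OF \<Phi>] compact_cball[of 0 R]] by (metis mem_cball_0)
  show ?thesis
  \<comment> \<open>Initial momentum, plus force bound times duration, plus the bound on the
    position.\<close>
  proof (rule that[of "M + \<bar>b + m\<bar> * T + R"], unfold momentum_bound_def, intro allI impI)
    fix C G x t s
    assume f: "regular C (kick \<Phi> G)" and G: "\<forall>t q. norm (G t q) \<le> b" and a: "alive (kick \<Phi> G) x t" and t: "t \<le> T"
      and x: "norm x \<le> M" and q: "\<forall>s\<in>{0..t}. norm (snd (flow (kick \<Phi> G) x s)) \<le> R" and s: "s \<in> {0..t}"
    let ?X = "flow (kick \<Phi> G) x"
    have "((\<lambda>r. kick \<Phi> G r (?X r)) has_integral (?X s - x)) {0..s}"
      using sol_flow[OF f a] s by (auto simp: sol_def)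
    from has_integral_linear[OF this bounded_linear_fst]
    have hi: "((\<lambda>r. - (G r (snd (?X r)) + grad \<Phi> (snd (?X r)))) has_integral (fst (?X s) - fst x)) {0..s}"
      by (simp add: o_def kick_def split_beta)
    have "norm (fst (?X s) - fst x) \<le> \<bar>b + m\<bar> * Henstock_Kurzweil_Integration.content {0..s}"
    proof (rule has_integral_bound_real[OF _ _ hi])
      fix r assume "r \<in> {0..s} - {}"
      then have r: "r \<in> {0..s}" by simp
      have "norm (G r (snd (?X r)) + grad \<Phi> (snd (?X r))) \<le> b + m"
        using G[rule_format, of r "snd (?X r)"] m[OF q[rule_format, of r]] r s
          norm_triangle_ineq[of "G r (snd (?X r))" "grad \<Phi> (snd (?X r))"] by force
      then show "norm (- (G r (snd (?X r)) + grad \<Phi> (snd (?X r)))) \<le> \<bar>b + m\<bar>"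
        unfolding norm_minus_cancel by simp
    qed simp_all
    also have "\<dots> \<le> \<bar>b + m\<bar> * T" using s t by (intro mult_left_mono) auto
    finally have "norm (fst (?X s)) \<le> norm (fst x) + \<bar>b + m\<bar> * T"
      using norm_triangle_ineq2[of "fst (?X s)" "fst x"] by linarith
    then have "norm (fst (?X s)) \<le> M + \<bar>b + m\<bar> * T" using norm_fst_snd_le(1)[of x] x by linarith
    moreover have "norm (?X s) \<le> norm (fst (?X s)) + norm (snd (?X s))"
      using norm_Pair_le[of "fst (?X s)" "snd (?X s)"] by simp
    ultimately show "norm (?X s) \<le> M + \<bar>b + m\<bar> * T + R" using q[rule_format, OF s] by linarith
  qed
qed

text \<open>An explosion has to show in the position: while positions stay in the ball of radius
  \<open>R\<close>, force and momentum are bounded up to time \<open>t\<close>, and a bounded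
  trajectory can be continued.\<close>

lemma kick_escape:
  fixes \<Phi> :: "'a::euclidean_space \<Rightarrow> real"
  assumes \<Phi>: "Ck 2 \<Phi>" and f: "regular C (kick \<Phi> G)" and G: "\<And>t q. norm (G t q) \<le> b"
    and dead: "\<not> alive (kick \<Phi> G) x t" and t: "0 \<le> t"
  obtains \<tau> where "0 \<le> \<tau>" "\<tau> < t" "alive (kick \<Phi> G) x \<tau>" "R < norm (snd (flow (kick \<Phi> G) x \<tau>))"
proof -
  obtain P where P: "momentum_bound \<Phi> b t (norm x) R P" by (rule momentum_bound_exists[OF \<Phi>])
  \<comment> \<open>Beyond \<open>P\<close>, so that reaching this radius contradicts the momentum
    bound, and beyond \<open>norm x\<close>, so that the trajectory starts inside.\<close>
  define R' where "R' = max (P + 1) (norm x + 1)"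
  obtain \<tau> where \<tau>: "0 \<le> \<tau>" "\<tau> \<le> t" "alive (kick \<Phi> G) x \<tau>" "\<tau> = t \<or> norm (flow (kick \<Phi> G) x \<tau>) = R'"
  proof -
    have nx: "norm x < R'" by (simp add: R'_def)
    show ?thesis
    proof (rule exit_or_alive[OF f t nx])
    qed (rule that)
  qed
  then have "P < norm (flow (kick \<Phi> G) x \<tau>)" using dead by (auto simp: R'_def)
  then obtain s where s: "s \<in> {0..\<tau>}" "R < norm (snd (flow (kick \<Phi> G) x s))"
    using momentum_boundD[OF P f G \<tau>(3,2) order_refl, of \<tau>] \<tau>(1) by force
  have "alive (kick \<Phi> G) x s" by (rule alive_mono[OF \<tau>(3)]) (use s in auto)
  then show ?thesis using that[of s] s \<tau>(2) dead by (cases "s = t") auto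
qed

section \<open>Convergence and equicontinuity of transported measures\<close>

text \<open>The integrands converge for every single starting point, and the constant
  \<open>c\<close> dominates them. Only positions are cut off in \<open>\<psi>\<close>, because the
  force kernel does not depend on momentum.\<close>

lemma transport_converge:
  fixes \<Phi> :: "'a::euclidean_space \<Rightarrow> real" and \<psi> :: "'a \<times> 'a \<Rightarrow> 'b::euclidean_space"
  assumes \<Phi>: "Ck 2 \<Phi>" and bar: "\<And>\<rho>. \<exists>R\<ge>\<rho>. barrier \<Phi> b R"
    and fk: "\<And>k::nat. regular C (kick \<Phi> (Gk k))" and f: "regular C (kick \<Phi> G)"
    and Gk: "\<And>k t q. norm (Gk k t q) \<le> b" and G: "\<And>t q. norm (G t q) \<le> b"
    and conv: "\<And>t q. (\<lambda>k. Gk k t q) \<longlonglongrightarrow> G t q"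
    and \<mu>: "subprob \<mu>" and t: "tk \<longlonglongrightarrow> t" "\<And>k. 0 \<le> tk k"
    and \<epsilon>: "\<epsilon> \<longlonglongrightarrow> 0" "\<And>k. 0 \<le> \<epsilon> k"
    and \<psi>: "continuous_on UNIV \<psi>" "\<And>x. norm (\<psi> x) \<le> c" "\<And>x. \<rho> < norm (snd x) \<Longrightarrow> \<psi> x = 0"
  shows "(\<lambda>k. \<integral>x. \<psi> x \<partial>transport (\<epsilon> k) (kick \<Phi> (Gk k)) (tk k) \<mu>) \<longlonglongrightarrow> (\<integral>x. \<psi> x \<partial>transport 0 (kick \<Phi> G) t \<mu>)"
proof -
  let ?f = "kick \<Phi> G" and ?fk = "\<lambda>k. kick \<Phi> (Gk k)"
  have t0: "0 \<le> t" by (rule LIMSEQ_le_const[OF t(1)]) (use t(2) in auto)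
  have \<psi>m: "\<psi> \<in> borel_measurable borel" by (rule borel_measurable_continuous_onI[OF \<psi>(1)])
  have fconv: "(\<lambda>k. ?fk k r z) \<longlonglongrightarrow> ?f r z" for r z
    unfolding kick_def split_beta by (intro tendsto_intros conv)
  have meas: "(\<lambda>x. weight e g s x *\<^sub>R \<psi> (endpoint g s x)) \<in> borel_measurable \<mu>" if "regular C g" "0 \<le> s" for e g s
  proof -
    note [measurable] = weight_measurable[OF that] endpoint_measurable[OF that] \<psi>m
    show ?thesis unfolding subprob_measurable[OF \<mu>] by measurable
  qed
  have "(\<lambda>k. \<integral>x. weight (\<epsilon> k) (?fk k) (tk k) x *\<^sub>R \<psi> (endpoint (?fk k) (tk k) x) \<partial>\<mu>)
      \<longlonglongrightarrow> (\<integral>x. weight 0 ?f t x *\<^sub>R \<psi> (endpoint ?f t x) \<partial>\<mu>)"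
  proof (rule integral_dominated_convergence[where w="\<lambda>_. c"])
    show "(\<lambda>x. weight 0 ?f t x *\<^sub>R \<psi> (endpoint ?f t x)) \<in> borel_measurable \<mu>" by (rule meas[OF f t0])
    show "(\<lambda>x. weight (\<epsilon> k) (?fk k) (tk k) x *\<^sub>R \<psi> (endpoint (?fk k) (tk k) x)) \<in> borel_measurable \<mu>" for k
      by (rule meas[OF fk t(2)])
    interpret finite_measure \<mu> by (rule subprob_finite[OF \<mu>])
    show "integrable \<mu> (\<lambda>_. c)" by simp
    have "norm (weight (\<epsilon> k) (?fk k) (tk k) x *\<^sub>R \<psi> (endpoint (?fk k) (tk k) x)) \<le> c" for k x
    proof -
      have "weight (\<epsilon> k) (?fk k) (tk k) x * norm (\<psi> (endpoint (?fk k) (tk k) x)) \<le> 1 * c"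
        by (rule mult_mono) (use weight_le_1[OF fk \<epsilon>(2)] \<psi>(2) in auto)
      then show ?thesis by (simp add: weight_nonneg)
    qed
    then show "AE x in \<mu>. norm (weight (\<epsilon> k) (?fk k) (tk k) x *\<^sub>R \<psi> (endpoint (?fk k) (tk k) x)) \<le> c" for k
      by (intro always_eventually allI)
    have "(\<lambda>k. weight (\<epsilon> k) (?fk k) (tk k) x *\<^sub>R \<psi> (endpoint (?fk k) (tk k) x)) \<longlonglongrightarrow> weight 0 ?f t x *\<^sub>R \<psi> (endpoint ?f t x)" for x
    proof (cases "alive ?f x t")
      case True
      note fc = flow_converge[OF fk f fconv tendsto_const t True]
      \<comment> \<open>On survivors the lengths stay bounded, so their product with
        \<open>\<epsilon> k\<close> vanishes and the damping disappears in the limit.\<close>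
      obtain l where l: "\<forall>\<^sub>F k in sequentially. len (?fk k) x (tk k) \<le> l" using fc(3) by blast
      have "(\<lambda>k. exp (- \<epsilon> k * len (?fk k) x (tk k))) \<longlonglongrightarrow> exp (- 0)"
      proof (intro tendsto_exp)
        have "(\<lambda>k. \<epsilon> k * len (?fk k) x (tk k)) \<longlonglongrightarrow> 0"
        proof (rule tendsto_sandwich[of "\<lambda>_. 0" _ _ "\<lambda>k. \<epsilon> k * l"])
          show "\<forall>\<^sub>F k in sequentially. 0 \<le> \<epsilon> k * len (?fk k) x (tk k)"
            using fc(1) by eventually_elim (intro mult_nonneg_nonneg \<epsilon> len_nonneg[OF fk])
          show "\<forall>\<^sub>F k in sequentially. \<epsilon> k * len (?fk k) x (tk k) \<le> \<epsilon> k * l"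
            using l by eventually_elim (intro mult_left_mono \<epsilon>)
          show "(\<lambda>k. \<epsilon> k * l) \<longlonglongrightarrow> 0" by (rule tendsto_mult_left_zero[OF \<epsilon>(1)])
        qed simp
        then show "(\<lambda>k. - \<epsilon> k * len (?fk k) x (tk k)) \<longlonglongrightarrow> - 0" by (auto dest: tendsto_minus)
      qed
      moreover have "(\<lambda>k. \<psi> (flow (?fk k) x (tk k))) \<longlonglongrightarrow> \<psi> (flow ?f x t)"
        by (rule continuous_on_tendsto_compose[OF \<psi>(1) fc(2)]) auto
      ultimately have "(\<lambda>k. exp (- \<epsilon> k * len (?fk k) x (tk k)) *\<^sub>R \<psi> (flow (?fk k) x (tk k))) \<longlonglongrightarrow> exp (- 0) *\<^sub>R \<psi> (flow ?f x t)"
        by (rule tendsto_scaleR)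
      moreover have "\<forall>\<^sub>F k in sequentially. exp (- \<epsilon> k * len (?fk k) x (tk k)) *\<^sub>R \<psi> (flow (?fk k) x (tk k))
          = weight (\<epsilon> k) (?fk k) (tk k) x *\<^sub>R \<psi> (endpoint (?fk k) (tk k) x)"
        using fc(1) by eventually_elim (simp add: weight_def endpoint_def)
      ultimately show ?thesis
        using True by (simp add: weight_def endpoint_def tendsto_cong)
    next
      case False
      \<comment> \<open>\<open>R\<close> encloses both the starting point and the positions seen by
        \<open>\<psi>\<close>. The limit particle is beyond it at some \<open>\<tau>\<close> before
        \<open>t\<close>, hence eventually so are the approximating ones; by time
        \<open>tk k\<close> each of them is dead or still outside, invisible in either case.\<close>
      obtain R where R: "max \<rho> (norm x) \<le> R" "barrier \<Phi> b R" using bar by blast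
      have xR: "norm (snd x) \<le> R" using norm_fst_snd_le(2)[of x] R by auto
      obtain \<tau> where \<tau>: "0 \<le> \<tau>" "\<tau> < t" "alive ?f x \<tau>" "R < norm (snd (flow ?f x \<tau>))"
        by (rule kick_escape[OF \<Phi> f G False t0])
      note fc = flow_converge[OF fk f fconv tendsto_const tendsto_const \<tau>(1,3)]
      have "(\<lambda>k. norm (snd (flow (?fk k) x \<tau>))) \<longlonglongrightarrow> norm (snd (flow ?f x \<tau>))"
        by (intro tendsto_intros fc(2))
      then have "\<forall>\<^sub>F k in sequentially. R < norm (snd (flow (?fk k) x \<tau>))" using \<tau>(4) by (rule order_tendstoD)
      moreover have "\<forall>\<^sub>F k in sequentially. \<tau> < tk k" using t(1) \<tau>(2) by (rule order_tendstoD)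
      ultimately have "\<forall>\<^sub>F k in sequentially. weight (\<epsilon> k) (?fk k) (tk k) x *\<^sub>R \<psi> (endpoint (?fk k) (tk k) x) = 0"
      proof eventually_elim
        case (elim k)
        show ?case
        proof (cases "alive (?fk k) x (tk k)")
          case True
          have "R < norm (snd (flow (?fk k) x (tk k)))"
            by (rule kick_no_return[OF R(2) fk Gk True \<tau>(1) _ xR]) (use elim in auto)
          then show ?thesis using \<psi>(3) R True by (simp add: endpoint_def)
        qed (simp add: weight_def)
      qed
      then show ?thesis using False by (simp add: weight_def tendsto_eventually)
    qed
    then show "AE x in \<mu>. (\<lambda>k. weight (\<epsilon> k) (?fk k) (tk k) x *\<^sub>R \<psi> (endpoint (?fk k) (tk k) x)) \<longlonglongrightarrow> weight 0 ?f t x *\<^sub>R \<psi> (endpoint ?f t x)"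
      by (intro always_eventually allI)
  qed
  then show ?thesis
    by (simp add: integral_transport[OF f t0 \<mu> \<psi>m] integral_transport[OF fk t(2) \<mu> \<psi>m])
qed

section \<open>Equicontinuity in time\<close>

lemma exp_minus_diff_le:
  fixes a b :: real
  assumes "0 \<le> a" "a \<le> b"
  shows "\<bar>exp (- b) - exp (- a)\<bar> \<le> b - a"
proof -
  have "1 - (b - a) \<le> exp (- (b - a))" using exp_ge_add_one_self[of "- (b - a)"] by linarith
  then have "exp (- a) * (1 - exp (- (b - a))) \<le> 1 * (b - a)"
    using assms by (intro mult_mono) auto
  moreover have "exp (- a) * exp (- (b - a)) = exp (- b)" by (simp flip: exp_add)
  ultimately show ?thesis using assms by (simp add: algebra_simps)
qed

text \<open>Modelled on the kernel \<open>grad W (q - snd x)\<close>, with explicit constants so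
  that estimates are uniform over the class.\<close>

definition observable :: "real \<Rightarrow> real \<Rightarrow> real \<Rightarrow> ('a::euclidean_space \<times> 'a \<Rightarrow> 'b::euclidean_space) \<Rightarrow> bool" where
  "observable c L \<rho> \<psi> \<longleftrightarrow> (\<forall>x y. norm (\<psi> x - \<psi> y) \<le> L * norm (x - y)) \<and> (\<forall>x. norm (\<psi> x) \<le> c) \<and>
     (\<forall>x. \<rho> < norm (snd x) \<longrightarrow> \<psi> x = 0)"

text \<open>A particle seen inside \<open>cball 0 \<rho>\<close> has never left \<open>cball 0 R\<close> before, so its momentum is
  controlled, and it takes a definite time to disappear from view.\<close>

lemma observable_lipschitz:
  fixes \<Phi> :: "'a::euclidean_space \<Rightarrow> real"
  assumes \<Phi>: "Ck 2 \<Phi>" and bar: "\<And>\<rho>. \<exists>R\<ge>\<rho>. barrier \<Phi> b R" and c: "0 \<le> c" and L: "0 \<le> L" and T: "0 \<le> T"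
  shows "\<exists>K d. 0 \<le> K \<and> 0 < d \<and> (\<forall>G \<epsilon> x s t (\<psi> :: 'a \<times> 'a \<Rightarrow> 'b::euclidean_space).
       regular C (kick \<Phi> G) \<longrightarrow> (\<forall>t q. norm (G t q) \<le> b) \<longrightarrow> 0 \<le> \<epsilon> \<longrightarrow> \<epsilon> \<le> 1 \<longrightarrow> norm x \<le> M \<longrightarrow>
       0 \<le> s \<longrightarrow> s \<le> t \<longrightarrow> t \<le> T \<longrightarrow> t - s < d \<longrightarrow> observable c L \<rho> \<psi> \<longrightarrow>
       norm (weight \<epsilon> (kick \<Phi> G) t x *\<^sub>R \<psi> (endpoint (kick \<Phi> G) t x) - weight \<epsilon> (kick \<Phi> G) s x *\<^sub>R \<psi> (endpoint (kick \<Phi> G) s x)) \<le> K * (t - s))"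
proof -
  \<comment> \<open>The extra 1 leaves a shell of unit width between the visible region and the
    barrier; \<open>M\<close> is included so that all starting points lie inside.\<close>
  obtain R where R: "max (\<rho> + 1) M \<le> R" "barrier \<Phi> b R" using bar by blast
  obtain P where P: "momentum_bound \<Phi> b T M R P" by (rule momentum_bound_exists[OF \<Phi>])
  define V where "V = \<bar>C P\<bar>"
  have V: "0 \<le> V" by (simp add: V_def)
  show ?thesis
  \<comment> \<open>\<open>L * V\<close> accounts for motion at speed at most \<open>V\<close>, and
    \<open>c * V\<close> for the change of the weight. Within time \<open>1 / (V + 1)\<close> no
    particle crosses the unit shell; the added 1 covers \<open>V = 0\<close>.\<close>
  proof (rule exI[of _ "L * V + c * V"], rule exI[of _ "1 / (V + 1)"], intro conjI allI impI)
    show "0 \<le> L * V + c * V" using c L V by simp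
    show "0 < 1 / (V + 1)" using V by simp
    fix G and \<epsilon> s t :: real and x :: "'a \<times> 'a" and \<psi> :: "'a \<times> 'a \<Rightarrow> 'b"
    assume f: "regular C (kick \<Phi> G)" and G': "\<forall>t q. norm (G t q) \<le> b" and \<epsilon>: "0 \<le> \<epsilon>" "\<epsilon> \<le> 1" and x: "norm x \<le> M"
      and st: "0 \<le> s" "s \<le> t" "t \<le> T" "t - s < 1 / (V + 1)" and obs: "observable c L \<rho> \<psi>"
    have G: "norm (G t q) \<le> b" for t q using G' by blast
    have \<psi>: "norm (\<psi> x - \<psi> y) \<le> L * norm (x - y)" "norm (\<psi> x) \<le> c" "\<rho> < norm (snd x) \<Longrightarrow> \<psi> x = 0" for x y
      using obs unfolding observable_def by blast+
    let ?f = "kick \<Phi> G"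
    let ?X = "flow ?f x"
    let ?a = "\<lambda>t. weight \<epsilon> ?f t x *\<^sub>R \<psi> (endpoint ?f t x)"
    have xR: "norm (snd x) \<le> R" using norm_fst_snd_le(2)[of x] x R by auto
    have inside: "norm (snd (?X r)) \<le> R" if "alive ?f x w" "norm (snd (?X w)) \<le> R" "r \<in> {0..w}" for r w
      using kick_no_return[OF R(2) f G that(1), of r] xR that by force
    have speed: "norm (?X w - ?X r) \<le> V * (w - r)" "len ?f x r \<le> len ?f x w" "len ?f x w - len ?f x r \<le> V * (w - r)"
      if a: "alive ?f x w" and in_R: "\<And>r. r \<in> {0..w} \<Longrightarrow> norm (snd (?X r)) \<le> R" and rw: "0 \<le> r" "r \<le> w" "w \<le> T" for r w
    proof -
      have XP: "norm (?X z) \<le> P" if "z \<in> {r..w}" for z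
        by (rule momentum_boundD[OF P f G a rw(3) x in_R]) (use that rw in auto)
      have CV: "C P * (w - r) \<le> V * (w - r)" unfolding V_def using rw by (intro mult_right_mono) auto
      show "norm (?X w - ?X r) \<le> V * (w - r)"
        using flow_diff_le[OF f a rw(1,2) XP] CV by linarith
      show "len ?f x r \<le> len ?f x w" by (rule len_diff_le(1)[OF f a rw(1,2) XP])
      show "len ?f x w - len ?f x r \<le> V * (w - r)"
        using len_diff_le(2)[OF f a rw(1,2) XP] CV by linarith
    qed
    show "norm (?a t - ?a s) \<le> (L * V + c * V) * (t - s)"
    proof (cases "alive ?f x t \<and> norm (snd (?X t)) \<le> R")
      case True
      then have at: "alive ?f x t" and as: "alive ?f x s" and in_t: "norm (snd (?X t)) \<le> R"
        using alive_mono[of ?f x t s] st by auto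
      note sp = speed[OF at inside[OF at in_t] st(1,2,3)]
      have ws: "weight \<epsilon> ?f t x = exp (- (\<epsilon> * len ?f x t))" "weight \<epsilon> ?f s x = exp (- (\<epsilon> * len ?f x s))"
        using at as by (auto simp: weight_def)
      have w: "\<bar>weight \<epsilon> ?f t x - weight \<epsilon> ?f s x\<bar> \<le> V * (t - s)"
      proof -
        have "\<bar>weight \<epsilon> ?f t x - weight \<epsilon> ?f s x\<bar> \<le> \<epsilon> * len ?f x t - \<epsilon> * len ?f x s"
          unfolding ws by (rule exp_minus_diff_le) (use \<epsilon> sp(2) len_nonneg[OF f as] in \<open>auto intro: mult_left_mono\<close>)
        also have "\<dots> = \<epsilon> * (len ?f x t - len ?f x s)" by (simp add: algebra_simps)
        also have "\<dots> \<le> 1 * (len ?f x t - len ?f x s)" using \<epsilon> sp(2) by (intro mult_right_mono) auto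
        finally show ?thesis using sp(3) by simp
      qed
      define A B where "A = weight \<epsilon> ?f t x *\<^sub>R (\<psi> (?X t) - \<psi> (?X s))"
        and "B = (weight \<epsilon> ?f t x - weight \<epsilon> ?f s x) *\<^sub>R \<psi> (?X s)"
      have "?a t - ?a s = A + B"
        using at as by (simp add: A_def B_def endpoint_def algebra_simps)
      then have "norm (?a t - ?a s) \<le> norm A + norm B" by (simp add: norm_triangle_ineq)
      also have "\<dots> = weight \<epsilon> ?f t x * norm (\<psi> (?X t) - \<psi> (?X s)) + \<bar>weight \<epsilon> ?f t x - weight \<epsilon> ?f s x\<bar> * norm (\<psi> (?X s))"
        by (simp add: A_def B_def weight_nonneg)
      also have "\<dots> \<le> 1 * (L * (V * (t - s))) + (V * (t - s)) * c"
      proof (rule add_mono)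
        have "norm (\<psi> (?X t) - \<psi> (?X s)) \<le> L * norm (?X t - ?X s)" by (rule \<psi>(1))
        also have "\<dots> \<le> L * (V * (t - s))" by (rule mult_left_mono[OF sp(1) L])
        finally have "norm (\<psi> (?X t) - \<psi> (?X s)) \<le> L * (V * (t - s))" .
        then show "weight \<epsilon> ?f t x * norm (\<psi> (?X t) - \<psi> (?X s)) \<le> 1 * (L * (V * (t - s)))"
          by (rule mult_mono[OF weight_le_1[OF f \<epsilon>(1)]]) simp_all
        show "\<bar>weight \<epsilon> ?f t x - weight \<epsilon> ?f s x\<bar> * norm (\<psi> (?X s)) \<le> (V * (t - s)) * c"
          by (rule mult_mono[OF w \<psi>(2)]) (use V st in simp_all)
      qed
      finally show ?thesis by (simp add: algebra_simps)
    next
      case False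
      have "?a t = 0"
        using False \<psi>(3)[of "?X t"] R by (auto simp: weight_def endpoint_def)
      \<comment> \<open>Being visible at \<open>s\<close> but outside or dead at \<open>t\<close>
        would require crossing the shell within \<open>t - s\<close>.\<close>
      moreover have "?a s = 0"
      proof (rule ccontr)
        assume ne: "?a s \<noteq> 0"
        then have as: "alive ?f x s" by (auto simp: weight_def split: if_splits)
        have "norm (snd (?X s)) \<le> \<rho>" using ne \<psi>(3)[of "?X s"] as by (force simp: endpoint_def)
        then have sR: "norm (snd (?X s)) < R" "norm (snd (?X s)) + 1 \<le> R" using R by auto
        have "\<exists>\<tau>. \<tau> \<le> t \<and> 0 \<le> \<tau> \<and> alive ?f x \<tau> \<and> R < norm (snd (?X \<tau>))"
        proof (cases "alive ?f x t")
          case True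
          then show ?thesis using False st by (intro exI[of _ t]) auto
        next
          case False
          then obtain \<tau> where "0 \<le> \<tau>" "\<tau> < t" "alive ?f x \<tau>" "R < norm (snd (?X \<tau>))"
            using kick_escape[OF \<Phi> f G, of x t R] st by (metis order_trans)
          then show ?thesis by (intro exI[of _ \<tau>]) auto
        qed
        then obtain \<tau> where \<tau>: "\<tau> \<le> t" "0 \<le> \<tau>" "alive ?f x \<tau>" "R < norm (snd (?X \<tau>))" by blast
        have s\<tau>: "s < \<tau>"
        proof (rule ccontr)
          assume "\<not> s < \<tau>"
          then show False using inside[OF as, of \<tau>] sR \<tau> by auto
        qed
        \<comment> \<open>On the sphere itself the no-return argument still confines the earlier
          path, so the speed bound applies up to \<open>w\<close>; at \<open>\<tau>\<close> the
          particle is already outside.\<close>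
        obtain w where w: "s < w" "w \<le> \<tau>" "norm (snd (?X w)) = R"
        proof (rule first_below[of s \<tau> "\<lambda>r. - norm (snd (?X r))" "- R"])
          show "continuous_on {s..\<tau>} (\<lambda>r. - norm (snd (?X r)))"
            by (intro continuous_intros continuous_on_subset[OF flow_continuous[OF f \<tau>(3)]]) (use st in auto)
        qed (use sR \<tau> s\<tau> in auto)
        have aw: "alive ?f x w" by (rule alive_mono[OF \<tau>(3)]) (use w st in auto)
        have "norm (snd (?X w)) \<le> R" using w by simp
        then have "norm (?X w - ?X s) \<le> V * (w - s)"
          by (intro speed(1)[OF aw inside[OF aw]]) (use w st \<tau> in auto)
        also have "\<dots> \<le> V * (t - s)" using V w \<tau> by (intro mult_left_mono) auto
        also have "\<dots> < 1"
        proof -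
          have "(t - s) * (V + 1) < 1" using st(4) V by (simp add: pos_less_divide_eq)
          then show ?thesis using st(2) by (simp add: algebra_simps)
        qed
        finally have "norm (snd (?X w - ?X s)) < 1" using norm_fst_snd_le(2)[of "?X w - ?X s"] by linarith
        moreover have "norm (snd (?X w)) \<le> norm (snd (?X s)) + norm (snd (?X w - ?X s))"
          using norm_triangle_ineq[of "snd (?X s)" "snd (?X w - ?X s)"] by simp
        ultimately show False using w sR by linarith
      qed
      ultimately have "norm (?a t - ?a s) = 0" by (simp only: diff_zero norm_zero)
      then show ?thesis using c L V st by simp
    qed
  qed
qed

lemma subprob_tail:
  fixes \<mu> :: "'a::euclidean_space measure"
  assumes \<mu>: "subprob \<mu>" and e: "0 < e"
  obtains M where "measure \<mu> {x. M < norm x} < e"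
proof -
  interpret finite_measure \<mu> by (rule subprob_finite[OF \<mu>])
  have "(\<lambda>n. measure \<mu> {x. real n < norm x}) \<longlonglongrightarrow> measure \<mu> (\<Inter>n. {x. real n < norm x})"
  proof (rule finite_Lim_measure_decseq)
    have "{x. real n < norm x} \<in> sets borel" for n by (intro borel_open open_Collect_less continuous_intros)
    then show "range (\<lambda>n. {x. real n < norm x}) \<subseteq> sets \<mu>" using \<mu> unfolding subprob_def by blast
    show "decseq (\<lambda>n. {x. real n < norm x})"
      unfolding decseq_def by (intro allI impI subsetI) (simp add: order_le_less_trans)
  qed
  moreover have "(\<Inter>n. {x. real n < norm x}) = ({} :: 'a set)"
  proof (intro equals0I)
    fix x assume x: "x \<in> (\<Inter>n. {x. real n < norm x})"
    obtain n :: nat where "norm x < real n" using reals_Archimedean2 by blast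
    moreover have "real n < norm x" using x by blast
    ultimately show False by simp
  qed
  ultimately have "(\<lambda>n. measure \<mu> {x. real n < norm x}) \<longlonglongrightarrow> 0" by simp
  then have "\<forall>\<^sub>F n in sequentially. measure \<mu> {x. real n < norm x} < e" using e by (rule order_tendstoD)
  then show ?thesis using that by (auto dest: eventually_happens)
qed

text \<open>Starting points of norm above \<open>M\<close> carry little mass, and all others share
  one Lipschitz constant in time.\<close>

lemma transport_equicontinuous:
  fixes \<Phi> :: "'a::euclidean_space \<Rightarrow> real"
  assumes \<Phi>: "Ck 2 \<Phi>" and bar: "\<And>\<rho>. \<exists>R\<ge>\<rho>. barrier \<Phi> b R" and c: "0 \<le> c" and L: "0 \<le> L" and T: "0 \<le> T"
    and \<mu>: "subprob \<mu>" and e: "0 < e"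
  shows "\<exists>d>0. \<forall>G \<epsilon> s t (\<psi> :: 'a \<times> 'a \<Rightarrow> 'b::euclidean_space).
       regular C (kick \<Phi> G) \<longrightarrow> (\<forall>t q. norm (G t q) \<le> b) \<longrightarrow> 0 \<le> \<epsilon> \<longrightarrow> \<epsilon> \<le> 1 \<longrightarrow>
       s \<in> {0..T} \<longrightarrow> t \<in> {0..T} \<longrightarrow> \<bar>t - s\<bar> < d \<longrightarrow> observable c L \<rho> \<psi> \<longrightarrow>
       norm ((\<integral>x. \<psi> x \<partial>transport \<epsilon> (kick \<Phi> G) t \<mu>) - (\<integral>x. \<psi> x \<partial>transport \<epsilon> (kick \<Phi> G) s \<mu>)) \<le> e"
proof -
  interpret finite_measure \<mu> by (rule subprob_finite[OF \<mu>])
  have sp: "space \<mu> = UNIV" "sets \<mu> = sets borel" using \<mu> sets_eq_imp_space_eq[of \<mu> borel] by (auto simp: subprob_def)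
  have m1: "measure \<mu> UNIV \<le> 1" using \<mu> by (simp add: subprob_def emeasure_eq_measure)
  \<comment> \<open>The tail contributes at most \<open>2 * c\<close> times its mass, hence at most
    \<open>e / 2\<close>; \<open>c + 1\<close> guards against \<open>c = 0\<close>.\<close>
  obtain M where M: "measure \<mu> {x. M < norm x} < e / (4 * (c + 1))"
    using subprob_tail[OF \<mu>, of "e / (4 * (c + 1))"] e c by auto
  obtain K d where K: "0 \<le> K" and d: "0 < d" and est:
    "\<forall>G \<epsilon> x s t (\<psi> :: 'a \<times> 'a \<Rightarrow> 'b).
       regular C (kick \<Phi> G) \<longrightarrow> (\<forall>t q. norm (G t q) \<le> b) \<longrightarrow> 0 \<le> \<epsilon> \<longrightarrow> \<epsilon> \<le> 1 \<longrightarrow> norm x \<le> M \<longrightarrow>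
       0 \<le> s \<longrightarrow> s \<le> t \<longrightarrow> t \<le> T \<longrightarrow> t - s < d \<longrightarrow> observable c L \<rho> \<psi> \<longrightarrow>
       norm (weight \<epsilon> (kick \<Phi> G) t x *\<^sub>R \<psi> (endpoint (kick \<Phi> G) t x) - weight \<epsilon> (kick \<Phi> G) s x *\<^sub>R \<psi> (endpoint (kick \<Phi> G) s x)) \<le> K * (t - s)"
    using observable_lipschitz[OF \<Phi> bar c L T, of C M \<rho>] by blast
  define d' where "d' = min d (e / (2 * (K + 1)))"
  have d': "0 < d'" using d e K by (simp add: d'_def)
  show ?thesis
  proof (rule exI[of _ d'], intro conjI allI impI d')
    fix G and \<epsilon> s t :: real and \<psi> :: "'a \<times> 'a \<Rightarrow> 'b"
    assume f: "regular C (kick \<Phi> G)" and G: "\<forall>t q. norm (G t q) \<le> b" and \<epsilon>: "0 \<le> \<epsilon>" "\<epsilon> \<le> 1"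
      and st: "s \<in> {0..T}" "t \<in> {0..T}" "\<bar>t - s\<bar> < d'" and obs: "observable c L \<rho> \<psi>"
    have \<psi>: "norm (\<psi> x - \<psi> y) \<le> L * norm (x - y)" "norm (\<psi> x) \<le> c" for x y
      using obs unfolding observable_def by blast+
    let ?f = "kick \<Phi> G"
    define a where "a t x = weight \<epsilon> ?f t x *\<^sub>R \<psi> (endpoint ?f t x)" for t x
    have "continuous_on UNIV \<psi>"
      by (rule lipschitz_on_continuous_on[of L]) (use \<psi>(1) L in \<open>auto simp: lipschitz_on_def dist_norm\<close>)
    then have \<psi>m: "\<psi> \<in> borel_measurable borel" by (rule borel_measurable_continuous_onI)
    have am: "a t \<in> borel_measurable \<mu>" if "0 \<le> t" for t
    proof -
      note [measurable] = weight_measurable[OF f that] endpoint_measurable[OF f that] \<psi>m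
      show ?thesis unfolding subprob_measurable[OF \<mu>] a_def[abs_def] by measurable
    qed
    have ac: "norm (a t x) \<le> c" for t x
    proof -
      have "weight \<epsilon> ?f t x * norm (\<psi> (endpoint ?f t x)) \<le> 1 * c"
        by (rule mult_mono) (use weight_le_1[OF f \<epsilon>(1)] \<psi>(2) in auto)
      then show ?thesis by (simp add: a_def weight_nonneg)
    qed
    have ai: "integrable \<mu> (a t)" if "0 \<le> t" for t
      by (rule integrable_const_bound[of _ c]) (use ac am[OF that] in auto)
    have diff: "norm (a t x - a s x) \<le> K * \<bar>t - s\<bar> + 2 * c * indicator {x. M < norm x} x" for x
    proof (cases "norm x \<le> M")
      case True
      have "norm (a t x - a s x) \<le> K * \<bar>t - s\<bar>"
      proof (cases "s \<le> t")
        case True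
        then show ?thesis
          using est[rule_format, OF f G[rule_format] \<epsilon> \<open>norm x \<le> M\<close>, of s t \<psi>] st obs by (auto simp: a_def d'_def)
      next
        case False
        then show ?thesis
          using est[rule_format, OF f G[rule_format] \<epsilon> \<open>norm x \<le> M\<close>, of t s \<psi>] st obs by (auto simp: a_def d'_def norm_minus_commute)
      qed
      then show ?thesis using c by (auto simp: indicator_def)
    next
      case False
      have "norm (a t x - a s x) \<le> c + c" using ac[of t x] ac[of s x] norm_triangle_ineq4[of "a t x" "a s x"] by linarith
      moreover have "0 \<le> K * \<bar>t - s\<bar>" using K by simp
      ultimately show ?thesis using False by (simp add: indicator_def)
    qed
    have "(\<integral>x. \<psi> x \<partial>transport \<epsilon> ?f t \<mu>) - (\<integral>x. \<psi> x \<partial>transport \<epsilon> ?f s \<mu>) = (\<integral>x. a t x - a s x \<partial>\<mu>)"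
      using st ai by (simp add: integral_transport[OF f _ \<mu> \<psi>m] a_def[symmetric])
    also have "norm \<dots> \<le> (\<integral>x. norm (a t x - a s x) \<partial>\<mu>)" by (rule integral_norm_bound)
    also have "\<dots> \<le> (\<integral>x. K * \<bar>t - s\<bar> + 2 * c * indicator {x. M < norm x} x \<partial>\<mu>)"
    proof (rule integral_mono)
      show "integrable \<mu> (\<lambda>x. norm (a t x - a s x))" using ai st by auto
      have "{x. M < norm x} \<in> sets \<mu>" unfolding sp by (intro borel_open open_Collect_less continuous_intros)
      then show "integrable \<mu> (\<lambda>x. K * \<bar>t - s\<bar> + 2 * c * indicator {x. M < norm x} x)" by (auto simp: integrable_real_indicator less_top[symmetric])
    qed (use diff in auto)
    also have "\<dots> = K * \<bar>t - s\<bar> * measure \<mu> UNIV + 2 * c * measure \<mu> {x. M < norm x}"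
    proof -
      have "{x. M < norm x} \<in> sets \<mu>" unfolding sp by (intro borel_open open_Collect_less continuous_intros)
      then show ?thesis by (subst Bochner_Integration.integral_add) (auto simp: integrable_real_indicator less_top[symmetric] sp)
    qed
    also have "\<dots> \<le> e / 2 + e / 2"
    proof (rule add_mono)
      have "K * \<bar>t - s\<bar> * measure \<mu> UNIV \<le> K * \<bar>t - s\<bar> * 1" using K m1 by (intro mult_left_mono) auto
      also have "\<dots> \<le> (K + 1) * (e / (2 * (K + 1)))" using st(3) K by (simp only: mult_1_right, intro mult_mono) (auto simp: d'_def)
      also have "\<dots> = e / 2" using K by (simp add: field_simps)
      finally show "K * \<bar>t - s\<bar> * measure \<mu> UNIV \<le> e / 2" .
      have "2 * c * measure \<mu> {x. M < norm x} \<le> (2 * (c + 1)) * (e / (4 * (c + 1)))"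
        using M c by (intro mult_mono) auto
      also have "\<dots> = e / 2" using c by (simp add: field_simps)
      finally show "2 * c * measure \<mu> {x. M < norm x} \<le> e / 2" .
    qed
    finally show "norm ((\<integral>x. \<psi> x \<partial>transport \<epsilon> ?f t \<mu>) - (\<integral>x. \<psi> x \<partial>transport \<epsilon> ?f s \<mu>)) \<le> e" by simp
  qed
qed

text \<open>Arzela-Ascoli in pointwise form: a diagonal subsequence converges on a countable dense
  subset, and equicontinuity passes the Cauchy property on to every point. \<open>S\<close> may be
  unbounded, since only pointwise limits are wanted.\<close>

lemma equicontinuous_convergent_subsequence:
  fixes F :: "nat \<Rightarrow> 'a::euclidean_space \<Rightarrow> 'b::euclidean_space"
  assumes bd: "\<And>k z. z \<in> S \<Longrightarrow> norm (F k z) \<le> M"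
    and eq: "\<And>z e. z \<in> S \<Longrightarrow> 0 < e \<Longrightarrow> \<exists>d>0. \<forall>k. \<forall>w\<in>S. dist w z < d \<longrightarrow> dist (F k w) (F k z) < e"
  obtains \<phi> :: "nat \<Rightarrow> nat" where "strict_mono \<phi>" "\<And>z. z \<in> S \<Longrightarrow> convergent (\<lambda>k. F (\<phi> k) z)"
proof -
  obtain D where D: "countable D" "D \<subseteq> S" "S \<subseteq> closure D" using separable by metis
  obtain \<phi> :: "nat \<Rightarrow> nat" where \<phi>: "strict_mono \<phi>" and conv: "\<And>z. z \<in> D \<Longrightarrow> \<exists>l. (\<lambda>k. F (\<phi> k) z) \<longlonglongrightarrow> l"
    using function_convergent_subsequence[of D F M] D bd by (metis subsetD)
  show ?thesis
  proof (rule that[OF \<phi>])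
    fix z assume z: "z \<in> S"
    have "Cauchy (\<lambda>k. F (\<phi> k) z)"
    proof (rule metric_CauchyI)
      fix e :: real assume e: "0 < e"
      then obtain d where d: "0 < d" "\<And>k w. w \<in> S \<Longrightarrow> dist w z < d \<Longrightarrow> dist (F k w) (F k z) < e / 3"
        using eq[OF z, of "e / 3"] by auto
      obtain w where w: "w \<in> D" "dist w z < d" using D(3) z d(1) by (force simp: closure_approachable)
      have "Cauchy (\<lambda>k. F (\<phi> k) w)" using conv[OF w(1)] LIMSEQ_imp_Cauchy by blast
      then obtain N where N: "\<And>m n. N \<le> m \<Longrightarrow> N \<le> n \<Longrightarrow> dist (F (\<phi> m) w) (F (\<phi> n) w) < e / 3"
        using metric_CauchyD[of _ "e / 3"] e by (metis divide_pos_pos zero_less_numeral)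
      have "dist (F (\<phi> m) z) (F (\<phi> n) z) < e" if "N \<le> m" "N \<le> n" for m n
      proof -
        have "dist (F (\<phi> m) z) (F (\<phi> n) z) \<le> dist (F (\<phi> m) w) (F (\<phi> m) z) + dist (F (\<phi> m) w) (F (\<phi> n) w) + dist (F (\<phi> n) w) (F (\<phi> n) z)"
          using dist_triangle[of "F (\<phi> m) z" "F (\<phi> n) z" "F (\<phi> m) w"] dist_triangle[of "F (\<phi> m) w" "F (\<phi> n) z" "F (\<phi> n) w"]
          by (simp add: dist_commute[of "F (\<phi> m) z"])
        moreover have "w \<in> S" using w D by auto
        ultimately show ?thesis using N[OF that] d(2)[of w "\<phi> m"] d(2)[of w "\<phi> n"] w(2) by linarith
      qed
      then show "\<exists>N. \<forall>m\<ge>N. \<forall>n\<ge>N. dist (F (\<phi> m) z) (F (\<phi> n) z) < e" by blast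
    qed
    then show "convergent (\<lambda>k. F (\<phi> k) z)" by (simp add: Cauchy_convergent)
  qed
qed

section \<open>The weak formulation\<close>

lemma test_function_differentiable: "test_function \<phi> \<Longrightarrow> \<phi> differentiable (at x)"
  unfolding test_function_def by (metis Ck.simps(2))

lemma test_function_frechet_continuous:
  "test_function \<phi> \<Longrightarrow> continuous_on UNIV (\<lambda>x. frechet_derivative \<phi> (at x) v)"
  unfolding test_function_def by (metis Ck.simps)

lemma test_function_continuous: "test_function \<phi> \<Longrightarrow> continuous_on UNIV \<phi>"
  unfolding test_function_def by (metis Ck.simps(1))

lemma compact_supp_bounded:
  fixes \<psi> :: "'a::euclidean_space \<Rightarrow> real"
  assumes c: "continuous_on UNIV \<psi>" and z: "\<And>x. x \<notin> S \<Longrightarrow> \<psi> x = 0" and S: "compact S"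
  obtains b where "0 \<le> b" "\<And>x. \<bar>\<psi> x\<bar> \<le> b"
proof -
  have "continuous_on S \<psi>" using c by (rule continuous_on_subset) simp
  then obtain b where b: "\<forall>x\<in>S. \<bar>\<psi> x\<bar> \<le> b"
    using compact_image_norm_bound[OF _ S] by (metis real_norm_def)
  have "\<bar>\<psi> x\<bar> \<le> max b 0" for x using b z[of x] by (cases "x \<in> S") auto
  then show ?thesis using that[of "max b 0"] by auto
qed

lemma compact_radius:
  fixes S :: "'a::real_normed_vector set"
  assumes "compact S"
  obtains r where "\<And>x. x \<in> S \<Longrightarrow> norm x \<le> r"
  using compact_imp_bounded[OF assms] by (auto simp: bounded_iff)

lemma test_function_bounds:
  assumes "test_function \<phi>"
  obtains b r where "0 \<le> b" "\<And>x. \<bar>\<phi> x\<bar> \<le> b" "\<And>x. r < norm x \<Longrightarrow> \<phi> x = 0"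
proof -
  have S: "compact (supp \<phi>)" using assms by (simp add: test_function_def)
  obtain b where b: "0 \<le> b" "\<And>x. \<bar>\<phi> x\<bar> \<le> b"
    using compact_supp_bounded[OF test_function_continuous[OF assms] zero_outside_supp[of _ \<phi>] S] by metis
  obtain r where "\<And>x. x \<in> supp \<phi> \<Longrightarrow> norm x \<le> r" using compact_radius[OF S] by metis
  then have "\<phi> x = 0" if "r < norm x" for x using zero_outside_supp[of x \<phi>] that by force
  then show ?thesis using that b by blast
qed

lemma regular_jointly_continuous:
  assumes f: "regular C f" "\<And>x. continuous_on UNIV (\<lambda>t. f t x)"
  shows "continuous_on UNIV (\<lambda>z. f (fst z) (snd z))"
  unfolding continuous_on_def
proof
  fix z :: "real \<times> 'a"
  show "((\<lambda>z. f (fst z) (snd z)) \<longlongrightarrow> f (fst z) (snd z)) (at z within UNIV)"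
    by (rule regular_tendsto[OF f(1), of "{}"]) (auto intro!: f(2) tendsto_eq_intros)
qed

text \<open>After Fubini the time integral is taken first, along each trajectory, where the
  integrand is the derivative of \<phi> and both boundary values vanish. The nonlinearity enters
  only through \<open>ham\<close>: the force is the one generated by the measures.\<close>

lemma kick_weak_solution:
  fixes W \<Phi> :: "'a::euclidean_space \<Rightarrow> real"
  assumes \<Phi>: "Ck 2 \<Phi>" and bar: "\<And>\<rho>. \<exists>R\<ge>\<rho>. barrier \<Phi> b R"
    and f: "regular C (kick \<Phi> G)" and Gc: "\<And>q. continuous_on UNIV (\<lambda>t. G t q)" and G: "\<And>t q. norm (G t q) \<le> b"
    and \<mu>: "subprob \<mu>" and T: "0 < T"
    and ham: "\<And>t. t \<in> {0<..<T} \<Longrightarrow> ham_field W \<Phi> (transport 0 (kick \<Phi> G) t \<mu>) = kick \<Phi> G t"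
  shows "hamiltonian_ODE W \<Phi> T (\<lambda>t. transport 0 (kick \<Phi> G) t \<mu>)"
  unfolding hamiltonian_ODE_def Let_def
proof (intro allI impI, elim conjE)
  let ?f = "kick \<Phi> G"
  fix \<phi> :: "real \<times> ('a \<times> 'a) \<Rightarrow> real"
  assume \<phi>: "test_function \<phi>" and supp: "supp \<phi> \<subseteq> {0<..<T} \<times> UNIV"
  have fc: "continuous_on UNIV (\<lambda>t. ?f t x)" for x
    unfolding kick_def split_beta by (intro continuous_intros Gc)
  define D where "D z = frechet_derivative \<phi> (at z)" for z
  have D: "(\<phi> has_derivative D z) (at z)" for z
    unfolding D_def using test_function_differentiable[OF \<phi>] frechet_derivative_works by blast
  have lin: "linear (D z)" for z using D by (rule has_derivative_linear)
  define \<gamma> where "\<gamma> z = D z (1, ?f (fst z) (snd z))" for z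
  have dt: "deriv (\<lambda>s. \<phi> (s, x)) t = D (t, x) (1, 0)" for t x
  proof (rule DERIV_imp_deriv)
    have "((\<lambda>s. (s, x)) has_derivative (\<lambda>h. (h, 0))) (at t)" by (auto intro!: derivative_eq_intros)
    from has_derivative_compose[OF this D]
    show "((\<lambda>s. \<phi> (s, x)) has_real_derivative D (t, x) (1, 0)) (at t)"
    proof (rule has_derivative_imp_has_field_derivative)
      fix h :: real
      have "D (t, x) (h *\<^sub>R (1, 0)) = h *\<^sub>R D (t, x) (1, 0)" by (rule linear_scale[OF lin])
      then show "h * D (t, x) (1, 0) = D (t, x) (h, 0)" by simp
    qed
  qed
  have dx: "inner (grad (\<lambda>y. \<phi> (t, y)) x) w = D (t, x) (0, w)" for t x w
  proof -
    have "((\<lambda>y. (t, y)) has_derivative (\<lambda>h. (0, h))) (at x)" by (auto intro!: derivative_eq_intros)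
    from has_derivative_compose[OF this D] have d: "((\<lambda>y. \<phi> (t, y)) has_derivative (\<lambda>h. D (t, x) (0, h))) (at x)" by simp
    then have "GDERIV (\<lambda>y. \<phi> (t, y)) x :> grad (\<lambda>y. \<phi> (t, y)) x"
      by (intro GDERIV_grad) (auto simp: differentiable_def)
    from has_derivative_unique[OF d this[unfolded gderiv_def]] show ?thesis by (metis inner_commute)
  qed
  have g: "deriv (\<lambda>s. \<phi> (s, x)) t + inner (grad (\<lambda>y. \<phi> (t, y)) x) (?f t x) = \<gamma> (t, x)" for t x
    using linear_add[OF lin, of "(t, x)" "(1, 0)" "(0, ?f t x)"] by (simp add: dt dx \<gamma>_def)
  have \<gamma>c: "continuous_on UNIV \<gamma>"
  proof -
    \<comment> \<open>\<open>D z\<close> is applied to a vector that varies with \<open>z\<close>,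
      while continuity is known for fixed directions; the basis expansion reduces one to the
      other.\<close>
    have "\<gamma> z = (\<Sum>v\<in>Basis. inner (1, ?f (fst z) (snd z)) v * D z v)" for z
    proof -
      have "D z w = (\<Sum>v\<in>Basis. inner w v * D z v)" for w
      proof -
        have "D z w = D z (\<Sum>v\<in>Basis. inner w v *\<^sub>R v)" by (simp only: euclidean_representation)
        also have "\<dots> = (\<Sum>v\<in>Basis. inner w v * D z v)" by (simp only: linear_sum[OF lin] linear_scale[OF lin] real_scaleR_def)
        finally show ?thesis .
      qed
      then show ?thesis unfolding \<gamma>_def .
    qed
    then have eq: "\<gamma> = (\<lambda>z. \<Sum>v\<in>Basis. inner (1, ?f (fst z) (snd z)) v * D z v)" by (rule ext)
    show ?thesis
      unfolding eq D_def
      by (intro continuous_on_sum continuous_on_mult continuous_on_inner continuous_on_Pair continuous_on_const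
          regular_jointly_continuous[OF f fc] test_function_frechet_continuous[OF \<phi>])
  qed
  have clS: "closed (supp \<phi>)" by (simp add: supp_def)
  have S: "compact (supp \<phi>)" using \<phi> by (simp add: test_function_def)
  have \<gamma>0: "\<gamma> z = 0" if "z \<notin> supp \<phi>" for z
    unfolding \<gamma>_def D_def by (rule frechet_derivative_zero_outside[OF clS zero_outside_supp that])
  have \<phi>0: "\<phi> z = 0" if "z \<notin> supp \<phi>" for z by (rule zero_outside_supp[OF that])
  obtain c where c: "0 \<le> c" "\<And>z. \<bar>\<gamma> z\<bar> \<le> c" using compact_supp_bounded[OF \<gamma>c \<gamma>0 S] by metis
  obtain \<rho> where \<rho>: "\<And>z. z \<in> supp \<phi> \<Longrightarrow> norm z \<le> \<rho>" using compact_radius[OF S] by metis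
  have \<gamma>m: "(\<lambda>x. \<gamma> (t, x)) \<in> borel_measurable borel" for t
    by (rule borel_measurable_continuous_onI) (rule continuous_on_compose2[OF \<gamma>c], auto intro!: continuous_intros)
  let ?\<mu> = "\<lambda>t. transport 0 ?f t \<mu>"
  let ?g = "\<lambda>t x. deriv (\<lambda>s. \<phi> (s, x)) t + inner (grad (\<lambda>y. \<phi> (t, y)) x) (ham_field W \<Phi> (?\<mu> t) x)"
  have integrand: "?g t = (\<lambda>x. \<gamma> (t, x))" if "t \<in> {0<..<T}" for t
    unfolding ham[OF that] g ..
  \<comment> \<open>The integrand pulled back to the starting points: undamped since the limit has
    damping 0, and zero after death.\<close>
  define H where "H z = indicator ({0<..<T} \<times> UNIV) z * (if 0 \<le> fst z \<and> alive ?f (snd z) (fst z) then \<gamma> (fst z, flow ?f (snd z) (fst z)) else 0)" for z :: "real \<times> 'a \<times> 'a"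
  have Hint: "(\<integral>x. \<gamma> (t, x) \<partial>?\<mu> t) = (\<integral>x. H (t, x) \<partial>\<mu>)" if t: "t \<in> {0<..<T}" for t
  proof -
    have "(\<integral>x. \<gamma> (t, x) \<partial>?\<mu> t) = (\<integral>x. weight 0 ?f t x *\<^sub>R \<gamma> (t, endpoint ?f t x) \<partial>\<mu>)"
      by (rule integral_transport[OF f _ \<mu> \<gamma>m]) (use t in auto)
    also have "\<dots> = (\<integral>x. H (t, x) \<partial>\<mu>)"
      by (rule Bochner_Integration.integral_cong[OF refl]) (use t in \<open>auto simp: H_def weight_def endpoint_def\<close>)
    finally show ?thesis .
  qed
  interpret mu: finite_measure \<mu> by (rule subprob_finite[OF \<mu>])
  interpret pair_sigma_finite lborel \<mu> by standard
  have sp: "space \<mu> = UNIV" "sets \<mu> = sets borel" using \<mu> sets_eq_imp_space_eq[of \<mu> borel] by (auto simp: subprob_def)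
  have setsp: "sets (lborel \<Otimes>\<^sub>M \<mu>) = sets (borel :: (real \<times> 'a \<times> 'a) measure)"
  proof -
    have "sets (lborel \<Otimes>\<^sub>M \<mu>) = sets (borel \<Otimes>\<^sub>M (borel :: ('a \<times> 'a) measure))"
      by (rule sets_pair_measure_cong) (simp_all add: sp)
    then show ?thesis by (simp only: borel_prod)
  qed
  have IS: "{0<..<T} \<times> UNIV \<in> sets (borel :: (real \<times> 'a \<times> 'a) measure)"
    by (intro borel_open open_Times) auto
  have Hm: "H \<in> borel_measurable (lborel \<Otimes>\<^sub>M \<mu>)"
  proof -
    have "(\<lambda>z. if z \<in> {z. 0 \<le> fst z \<and> alive ?f (snd z) (fst z)} then \<gamma> (fst z, flow ?f (snd z) (fst z)) else 0) \<in> borel_measurable borel"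
    proof (rule borel_measurable_continuous_on_if[OF alive_joint(1)[OF f]])
      show "continuous_on {z. 0 \<le> fst z \<and> alive ?f (snd z) (fst z)} (\<lambda>z. \<gamma> (fst z, flow ?f (snd z) (fst z)))"
        by (rule continuous_on_compose2[OF \<gamma>c]) (auto intro!: continuous_intros alive_joint(2)[OF f])
    qed simp
    then have "H \<in> borel_measurable borel"
      unfolding H_def[abs_def] using IS by simp
    then show ?thesis by (simp add: measurable_cong_sets[OF setsp refl])
  qed
  have Hi: "integrable (lborel \<Otimes>\<^sub>M \<mu>) H"
  proof (rule integrableI_bounded_set[where A="{0<..<T} \<times> UNIV" and B=c])
    show "{0<..<T} \<times> UNIV \<in> sets (lborel \<Otimes>\<^sub>M \<mu>)" unfolding setsp by (rule IS)
    have "emeasure (lborel \<Otimes>\<^sub>M \<mu>) ({0<..<T} \<times> UNIV) = emeasure lborel {0<..<T} * emeasure \<mu> UNIV"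
      by (rule mu.emeasure_pair_measure_Times) (auto simp: sp)
    also have "\<dots> < \<infinity>"
      using T by (simp add: ennreal_mult_less_top mu.emeasure_eq_measure)
    finally show "emeasure (lborel \<Otimes>\<^sub>M \<mu>) ({0<..<T} \<times> UNIV) < \<infinity>" .
  qed (use Hm c in \<open>auto simp: H_def\<close>)
  have zero: "(\<integral>t. H (t, x) \<partial>lborel) = 0" for x
  proof -
    \<comment> \<open>\<open>\<tau>\<close> is \<open>T\<close> for a survivor and otherwise an
      escape time past a barrier that encloses the support, after which the particle is dead or out
      of the support. Thus the fundamental theorem is only applied while the particle is alive, and
      \<phi> vanishes at the upper end.\<close>
    have "\<exists>\<tau>\<in>{0..T}. alive ?f x \<tau> \<and> (\<tau>, flow ?f x \<tau>) \<notin> supp \<phi> \<and> (\<forall>t>\<tau>. t < T \<longrightarrow> alive ?f x t \<longrightarrow> (t, flow ?f x t) \<notin> supp \<phi>)"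
    proof (cases "alive ?f x T")
      case True
      then show ?thesis using supp T by (intro bexI[of _ T]) auto
    next
      case False
      obtain R where R: "max \<rho> (norm x) \<le> R" "barrier \<Phi> b R" using bar by blast
      have xR: "norm (snd x) \<le> R" using norm_fst_snd_le(2)[of x] R by auto
      obtain \<tau> where \<tau>: "0 \<le> \<tau>" "\<tau> < T" "alive ?f x \<tau>" "R < norm (snd (flow ?f x \<tau>))"
        by (rule kick_escape[OF \<Phi> f G False]) (use T in auto)
      have out: "(t, flow ?f x t) \<notin> supp \<phi>" if "\<tau> \<le> t" "alive ?f x t" for t
      proof
        assume "(t, flow ?f x t) \<in> supp \<phi>"
        then have "norm (t, flow ?f x t) \<le> \<rho>" by (rule \<rho>)
        then have "norm (snd (flow ?f x t)) \<le> \<rho>"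
          using norm_snd_le[of "flow ?f x t" t] norm_fst_snd_le(2)[of "flow ?f x t"] by linarith
        moreover have "R < norm (snd (flow ?f x t))"
          by (rule kick_no_return[OF R(2) f G that(2) \<tau>(1) that(1) xR \<tau>(4)])
        ultimately show False using R by simp
      qed
      then show ?thesis using \<tau> by (intro bexI[of _ \<tau>]) auto
    qed
    then obtain \<tau> where \<tau>: "0 \<le> \<tau>" "\<tau> \<le> T" "alive ?f x \<tau>" "(\<tau>, flow ?f x \<tau>) \<notin> supp \<phi>"
      and after: "\<And>t. \<tau> < t \<Longrightarrow> t < T \<Longrightarrow> alive ?f x t \<Longrightarrow> (t, flow ?f x t) \<notin> supp \<phi>" by auto
    have "H (t, x) = indicator {0..\<tau>} t *\<^sub>R \<gamma> (t, flow ?f x t)" for t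
    proof (cases "t \<in> {0<..<T}")
      case True
      show ?thesis
      proof (cases "t \<le> \<tau>")
        case le: True
        then have "alive ?f x t" using alive_mono[OF \<tau>(3), of t] True by simp
        then show ?thesis using True le by (simp add: H_def)
      next
        case False
        then show ?thesis using True after[of t] \<gamma>0 by (auto simp: H_def)
      qed
    next
      case False
      \<comment> \<open>Whatever value \<open>flow\<close> takes here, such times lie outside the
        support of \<phi>.\<close>
      then have "\<gamma> (t, flow ?f x t) = 0" using supp by (intro \<gamma>0) auto
      then show ?thesis using False by (simp add: H_def)
    qed
    then have "(\<integral>t. H (t, x) \<partial>lborel) = (\<integral>t. indicator {0..\<tau>} t *\<^sub>R \<gamma> (t, flow ?f x t) \<partial>lborel)" by simp
    also have "\<dots> = \<phi> (\<tau>, flow ?f x \<tau>) - \<phi> (0, flow ?f x 0)"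
    proof (rule integral_FTC_atLeastAtMost[OF \<tau>(1)])
      show "continuous_on {0..\<tau>} (\<lambda>t. \<gamma> (t, flow ?f x t))"
        by (rule continuous_on_compose2[OF \<gamma>c]) (auto intro!: continuous_intros flow_continuous[OF f \<tau>(3)])
      fix t assume t: "0 \<le> t" "t \<le> \<tau>"
      have "((\<lambda>t. (t, flow ?f x t)) has_vector_derivative (1, ?f t (flow ?f x t))) (at t within {0..\<tau>})"
        by (intro has_vector_derivative_Pair has_vector_derivative_id
            sol_has_vector_derivative_within[OF f fc sol_flow[OF f \<tau>(3)]]) (use t in auto)
      from vector_derivative_diff_chain_within[OF this has_derivative_at_withinI[OF D]]
      show "((\<lambda>t. \<phi> (t, flow ?f x t)) has_vector_derivative \<gamma> (t, flow ?f x t)) (at t within {0..\<tau>})"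
        by (simp add: o_def \<gamma>_def)
    qed
    also have "\<dots> = 0"
    proof -
      have "(0, flow ?f x 0) \<notin> supp \<phi>" using supp by auto
      then show ?thesis using \<phi>0 \<tau>(4) by simp
    qed
    finally show ?thesis .
  qed
  have ind: "indicator {0<..<T} t *\<^sub>R (\<integral>x. ?g t x \<partial>?\<mu> t) = (\<integral>x. H (t, x) \<partial>\<mu>)" for t
  proof (cases "t \<in> {0<..<T}")
    case True
    then show ?thesis unfolding integrand[OF True] Hint[OF True] by simp
  qed (simp add: H_def)
  show "(\<forall>t\<in>{0<..<T}. integrable (?\<mu> t) (?g t)) \<and>
    (set_integrable lborel {0<..<T} (\<lambda>t. \<integral>x. ?g t x \<partial>?\<mu> t)) \<and>
    (LINT t:{0<..<T}|lborel. (\<integral>x. ?g t x \<partial>?\<mu> t)) = 0"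
  proof (intro conjI ballI)
    fix t assume t: "t \<in> {0<..<T}"
    have "subprob (?\<mu> t)" by (rule subprob_transport[OF f _ \<mu>]) (use t in auto)
    from subprob_integral_bound(1)[OF this \<gamma>m c(1)] c(2)
    show "integrable (?\<mu> t) (?g t)"
      unfolding integrand[OF t] by simp
  next
    show "set_integrable lborel {0<..<T} (\<lambda>t. \<integral>x. ?g t x \<partial>?\<mu> t)"
      unfolding set_integrable_def ind by (rule integrable_fst'[OF Hi])
  next
    have "(LINT t:{0<..<T}|lborel. (\<integral>x. ?g t x \<partial>?\<mu> t)) = (\<integral>t. (\<integral>x. H (t, x) \<partial>\<mu>) \<partial>lborel)"
      unfolding set_lebesgue_integral_def ind ..
    also have "\<dots> = (\<integral>x. (\<integral>t. H (t, x) \<partial>lborel) \<partial>\<mu>)"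
      by (rule Fubini_integral[symmetric]) (use Hi in simp)
    finally show "(LINT t:{0<..<T}|lborel. (\<integral>x. ?g t x \<partial>?\<mu> t)) = 0"
      by (simp add: zero)
  qed
qed

text \<open>The case of \<open>transport_converge\<close> with a constant sequence of fields and
  zero damping, where only the times move.\<close>

lemma transport_distr_continuous:
  fixes \<Phi> :: "'a::euclidean_space \<Rightarrow> real"
  assumes \<Phi>: "Ck 2 \<Phi>" and bar: "\<And>\<rho>. \<exists>R\<ge>\<rho>. barrier \<Phi> b R"
    and f: "regular C (kick \<Phi> G)" and G: "\<And>t q. norm (G t q) \<le> b" and \<mu>: "subprob \<mu>"
  shows "distr_continuous_on {0..T} (\<lambda>t. transport 0 (kick \<Phi> G) t \<mu>)"
  unfolding distr_continuous_on_def continuous_on_sequentially o_def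
proof (intro allI impI ballI, elim conjE)
  fix \<phi> :: "'a \<times> 'a \<Rightarrow> real" and tk t
  assume \<phi>: "test_function \<phi>" and t: "t \<in> {0..T}" "\<forall>n. tk n \<in> {0..T}" "tk \<longlonglongrightarrow> t"
  obtain c r where c: "\<And>x. \<bar>\<phi> x\<bar> \<le> c" and r: "\<And>x. r < norm x \<Longrightarrow> \<phi> x = 0"
    using test_function_bounds[OF \<phi>] by metis
  show "(\<lambda>n. \<integral>x. \<phi> x \<partial>transport 0 (kick \<Phi> G) (tk n) \<mu>) \<longlonglongrightarrow> (\<integral>x. \<phi> x \<partial>transport 0 (kick \<Phi> G) t \<mu>)"
  proof (rule transport_converge[OF \<Phi> bar f f G G tendsto_const \<mu> t(3), where \<rho>=r and c=c])
    show "\<phi> x = 0" if "r < norm (snd x)" for x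
      using norm_fst_snd_le(2)[of x] that by (intro r) linarith
  qed (use t c in \<open>auto intro: test_function_continuous[OF \<phi>]\<close>)
qed

section \<open>The limit of the discretization\<close>

text \<open>All real \<open>t\<close> are covered, with clamping to \<open>{0..T}\<close>, because
  convergence of the fields is later required at every real time.\<close>

lemma grid_time_dist:
  fixes n :: nat
  assumes T: "0 < T" and n: "1 \<le> n"
  defines "j \<equiv> \<lambda>t. min n (nat \<lfloor>t / (T / n)\<rfloor>)"
  shows "real (j t) * (T / n) \<in> {0..T}" "\<bar>real (j t) * (T / n) - max 0 (min T t)\<bar> \<le> T / n"
proof -
  define h where "h = T / n"
  have h: "0 < h" "real n * h = T" using T n by (auto simp: h_def)
  have "real (j t) * h \<le> real n * h" using h(1) by (intro mult_right_mono) (auto simp: j_def)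
  then show "real (j t) * (T / n) \<in> {0..T}" using h by (simp add: h_def[symmetric])
  consider "t < 0" | "0 \<le> t" "t < T" | "T \<le> t" by linarith
  then have "\<bar>real (j t) * h - max 0 (min T t)\<bar> \<le> h"
  proof cases
    case 1
    have "t / h \<le> 0" using 1 h by (simp add: field_simps)
    then have "\<lfloor>t / h\<rfloor> \<le> 0" by (simp add: floor_le_iff)
    then have "j t = 0" by (simp add: j_def h_def)
    then show ?thesis using 1 T h by (simp add: min_def)
  next
    case 2
    define k where "k = nat \<lfloor>t / h\<rfloor>"
    note le = floor_grid[OF h(1) 2(1), folded k_def]
    have "real k * h < real n * h" using le 2 h by linarith
    then have "k < n" using h(1) by simp
    moreover have "j t = min n k" unfolding j_def k_def h_def ..
    ultimately have "j t = k" by simp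
    then show ?thesis using le 2 by simp
  next
    case 3
    have "real n \<le> t / h" using 3 h by (simp add: le_divide_eq)
    then have "int n \<le> \<lfloor>t / h\<rfloor>" by (simp add: le_floor_iff)
    then have "n \<le> nat \<lfloor>t / h\<rfloor>" by simp
    then have "j t = n" by (simp add: j_def h_def min_def)
    then show ?thesis using 3 T h by simp
  qed
  then show "\<bar>real (j t) * (T / n) - max 0 (min T t)\<bar> \<le> T / n" by (simp add: h_def)
qed

text \<open>Two families of forces are compared: \<open>Gk\<close>, from the last grid measure,
  drives the scheme, while \<open>A\<close>, from the measure at the current time, is
  equicontinuous. They differ by a time shift of at most one step and so share their limit
  \<open>G\<close>.\<close>

lemma discretization_limit:
  fixes W \<Phi> :: "'a::euclidean_space \<Rightarrow> real"
  assumes W: "Ck 2 W" "compact (supp W)" "\<And>q. \<bar>W q\<bar> \<le> B" "\<And>q. norm (grad W q) < B"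
    and \<Phi>: "Ck 2 \<Phi>" and dyn: "dynamical_hypothesis \<Phi> B" and T: "0 < T" and \<mu>0: "subprob \<mu>0"
  obtains \<epsilon> :: "nat \<Rightarrow> real" and n :: "nat \<Rightarrow> nat" and C G b where
    "\<And>k. 0 < \<epsilon> k" "\<And>k. 1 \<le> n k" "\<epsilon> \<longlonglongrightarrow> 0" "filterlim n at_top sequentially"
    "\<And>\<rho>. \<exists>R\<ge>\<rho>. barrier \<Phi> b R" "regular C (kick \<Phi> G)" "\<And>q. continuous_on UNIV (\<lambda>t. G t q)" "\<And>t q. norm (G t q) \<le> b"
    "\<And>t. t \<in> {0..T} \<Longrightarrow> ham_field W \<Phi> (transport 0 (kick \<Phi> G) t \<mu>0) = kick \<Phi> G t"
    "\<And>t. t \<in> {0..T} \<Longrightarrow> distr_tendsto (\<lambda>k. discr_measure W \<Phi> T \<mu>0 (\<epsilon> k) (n k) t) (transport 0 (kick \<Phi> G) t \<mu>0)"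
proof -
  note result = that
  obtain b where b: "0 \<le> b" "b < B" "\<And>q. norm (grad W q) \<le> b"
    using grad_strict_bound[OF W(1,2,4)] by metis
  obtain L where L: "0 \<le> L" "\<And>x y. norm (grad W x - grad W y) \<le> L * norm (x - y)"
    using grad_lipschitz_compact_supp[OF W(1,2)] by metis
  obtain RW where RW: "\<And>q. q \<in> supp W \<Longrightarrow> norm q \<le> RW" using compact_radius[OF W(2)] by metis
  have bar: "\<exists>R\<ge>\<rho>. barrier \<Phi> b R" for \<rho> using barrier_exists[OF dyn \<Phi> b(2)] by metis
  obtain C where C: "\<And>G. (\<And>t q. norm (G t q) \<le> b) \<Longrightarrow> (\<And>t q q'. norm (G t q - G t q') \<le> L * norm (q - q')) \<Longrightarrow>
      (\<exists>K. finite K \<and> (\<forall>q. continuous_on (- K) (\<lambda>t. G t q))) \<Longrightarrow> regular C (kick \<Phi> G)"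
    using regular_kick[OF \<Phi> L(1) b(1)] by metis
  have B: "0 \<le> B" "\<And>q. norm (grad W q) \<le> B" using b order_trans less_imp_le by blast+
  have ham: "ham_field W \<Phi> \<mu> = kick \<Phi> (\<lambda>_. grad_conv W \<mu>) t" if "subprob \<mu>" for \<mu> t
    by (rule ham_field_kick[OF W(1) B W(3) L \<Phi> that])
  have gb: "norm (grad_conv W \<mu> q) \<le> b" and gL: "norm (grad_conv W \<mu> q - grad_conv W \<mu> q') \<le> L * norm (q - q')"
    if "subprob \<mu>" for \<mu> q q'
    using grad_conv_bound[OF W(1) b(1,3) that] grad_conv_lipschitz[OF W(1) b(1,3) L that] by auto
  have reg: "regular C (\<lambda>_. ham_field W \<Phi> \<mu>)" if "subprob \<mu>" for \<mu>
  proof -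
    have "regular C (kick \<Phi> (\<lambda>_. grad_conv W \<mu>))"
      by (rule C) (use gb[OF that] gL[OF that] in auto)
    moreover have "kick \<Phi> (\<lambda>_. grad_conv W \<mu>) = (\<lambda>_. ham_field W \<Phi> \<mu>)"
      using ham[OF that] by (intro ext) simp
    ultimately show ?thesis by simp
  qed
  \<comment> \<open>Both parameters are tied to one index, with damping \<open>1 / (k + 1)\<close>
    and \<open>k + 1\<close> steps; a subsequence is selected only afterwards. The equicontinuity
    estimate asks for damping at most 1.\<close>
  define eps where "eps k = inverse (real (Suc k))" for k
  have eps: "0 < eps k" "eps k \<le> 1" for k by (auto simp: eps_def inverse_le_1_iff)
  have eps0: "eps \<longlonglongrightarrow> 0" unfolding eps_def[abs_def] by (rule LIMSEQ_inverse_real_of_nat)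
  define h where "h k = T / real (Suc k)" for k
  have h0: "h \<longlonglongrightarrow> 0"
    unfolding h_def[abs_def] divide_inverse
    by (rule tendsto_mult_right_zero) (rule LIMSEQ_inverse_real_of_nat)
  define m where "m k = grid_measure W \<Phi> (eps k) (h k) \<mu>0" for k
  define Gk where "Gk k t = grad_conv W (m k (min (Suc k) (nat \<lfloor>t / h k\<rfloor>)))" for k t
  have hpos: "0 < h k" for k using T by (simp add: h_def)
  have msub: "subprob (m k j)" for k j
    unfolding m_def by (rule subprob_grid_measure[OF reg less_imp_le[OF eps(1)] hpos \<mu>0])
  have kickGk: "frozen (T / real (Suc k)) (Suc k) (\<lambda>j. ham_field W \<Phi> (grid_measure W \<Phi> (eps k) (T / real (Suc k)) \<mu>0 j)) = kick \<Phi> (Gk k)" for k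
  proof
    fix t
    have "kick \<Phi> (\<lambda>_. Gk k t) t = kick \<Phi> (Gk k) t" by (simp add: kick_def)
    then show "frozen (T / real (Suc k)) (Suc k) (\<lambda>j. ham_field W \<Phi> (grid_measure W \<Phi> (eps k) (T / real (Suc k)) \<mu>0 j)) t = kick \<Phi> (Gk k) t"
      using ham[OF msub, of k "min (Suc k) (nat \<lfloor>t / h k\<rfloor>)" t]
      by (simp add: frozen_def m_def Gk_def[of k t, symmetric] h_def) (simp add: Gk_def m_def h_def)
  qed
  have Suc1: "1 \<le> Suc k" for k by simp
  have rGk: "regular C (kick \<Phi> (Gk k))" for k
    using discr_measure_transport(1)[OF reg less_imp_le[OF eps(1)[of k]] T Suc1[of k] \<mu>0]
    unfolding kickGk .
  have mk: "m k j = transport (eps k) (kick \<Phi> (Gk k)) (real j * h k) \<mu>0" if "j \<le> Suc k" for j k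
    using discr_measure_transport(2)[OF reg less_imp_le[OF eps(1)[of k]] T Suc1[of k] \<mu>0 that]
    unfolding kickGk by (simp only: m_def h_def)
  have dk: "discr_measure W \<Phi> T \<mu>0 (eps k) (Suc k) t = transport (eps k) (kick \<Phi> (Gk k)) t \<mu>0" if "t \<in> {0..T}" for k t
    using discr_measure_transport(3)[OF reg less_imp_le[OF eps(1)[of k]] T Suc1[of k] \<mu>0 that]
    unfolding kickGk .
  have Gkb: "norm (Gk k t q) \<le> b" for k t q unfolding Gk_def by (rule gb[OF msub])
  define A where "A k t = grad_conv W (transport (eps k) (kick \<Phi> (Gk k)) t \<mu>0)" for k t
  have tsub: "subprob (transport (eps k) (kick \<Phi> (Gk k)) t \<mu>0)" if "0 \<le> t" for k t
    by (rule subprob_transport[OF rGk that \<mu>0 less_imp_le[OF eps(1)]])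
  have Ab: "norm (A k t q) \<le> b" and AL: "norm (A k t q - A k t q') \<le> L * norm (q - q')" if "0 \<le> t" for k t q q'
    unfolding A_def using gb[OF tsub[OF that]] gL[OF tsub[OF that]] by auto
  \<comment> \<open>The kernel sees only positions within \<open>RW\<close> of \<open>q\<close>,
    hence this radius.\<close>
  have obs: "observable b L (norm q + RW) (\<lambda>y. grad W (q - snd y))" for q
    unfolding observable_def
  proof (intro conjI allI impI)
    fix x y :: "'a \<times> 'a"
    have "norm (grad W (q - snd x) - grad W (q - snd y)) \<le> L * norm ((q - snd x) - (q - snd y))" by (rule L)
    also have "norm ((q - snd x) - (q - snd y)) = norm (snd (x - y))"
      by (simp add: norm_minus_commute)
    also have "L * \<dots> \<le> L * norm (x - y)" by (rule mult_left_mono[OF norm_fst_snd_le(2) L(1)])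
    finally show "norm (grad W (q - snd x) - grad W (q - snd y)) \<le> L * norm (x - y)" .
    show "norm (grad W (q - snd x)) \<le> b" by (rule b)
    assume "norm q + RW < norm (snd x)"
    then have "RW < norm (q - snd x)" using norm_triangle_ineq2[of "snd x" q] by (simp add: norm_minus_commute)
    then show "grad W (q - snd x) = 0" using RW[of "q - snd x"] by (intro grad_zero_outside_supp) auto
  qed
  have At: "\<exists>d>0. \<forall>k. \<forall>s\<in>{0..T}. \<forall>t\<in>{0..T}. \<bar>t - s\<bar> < d \<longrightarrow> norm (A k t q - A k s q) \<le> e" if e: "0 < e" for q e
  proof -
    obtain d where d: "0 < d" "\<forall>G \<epsilon> s t (\<psi> :: 'a \<times> 'a \<Rightarrow> 'a).
       regular C (kick \<Phi> G) \<longrightarrow> (\<forall>t q. norm (G t q) \<le> b) \<longrightarrow> 0 \<le> \<epsilon> \<longrightarrow> \<epsilon> \<le> 1 \<longrightarrow>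
       s \<in> {0..T} \<longrightarrow> t \<in> {0..T} \<longrightarrow> \<bar>t - s\<bar> < d \<longrightarrow> observable b L (norm q + RW) \<psi> \<longrightarrow>
       norm ((\<integral>x. \<psi> x \<partial>transport \<epsilon> (kick \<Phi> G) t \<mu>0) - (\<integral>x. \<psi> x \<partial>transport \<epsilon> (kick \<Phi> G) s \<mu>0)) \<le> e"
      using transport_equicontinuous[OF \<Phi> bar b(1) L(1) less_imp_le[OF T] \<mu>0 e, of C "norm q + RW"] by blast
    have "norm (A k t q - A k s q) \<le> e" if "s \<in> {0..T}" "t \<in> {0..T}" "\<bar>t - s\<bar> < d" for k s t
      unfolding A_def grad_conv_def
      using d(2)[rule_format, OF rGk Gkb less_imp_le[OF eps(1)] eps(2) that obs] .
    then show ?thesis using d(1) by blast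
  qed
  obtain \<phi> :: "nat \<Rightarrow> nat" where \<phi>: "strict_mono \<phi>"
    and conv: "\<And>z. z \<in> {0..T} \<times> UNIV \<Longrightarrow> convergent (\<lambda>k. A (\<phi> k) (fst z) (snd z))"
  proof (rule equicontinuous_convergent_subsequence[of "{0..T} \<times> UNIV" "\<lambda>k z. A k (fst z) (snd z)" b])
    show "norm (A k (fst z) (snd z)) \<le> b" if "z \<in> {0..T} \<times> UNIV" for k z using that Ab by auto
    fix z :: "real \<times> 'a" and e :: real
    assume z: "z \<in> {0..T} \<times> UNIV" and e: "0 < e"
    obtain d where d: "0 < d" "\<forall>k. \<forall>s\<in>{0..T}. \<forall>t\<in>{0..T}. \<bar>t - s\<bar> < d \<longrightarrow> norm (A k t (snd z) - A k s (snd z)) \<le> e / 2"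
      using At[of "e / 2" "snd z"] e by auto
    define d' where "d' = min d (e / (2 * (L + 1)))"
    have "dist (A k (fst w) (snd w)) (A k (fst z) (snd z)) < e" if w: "w \<in> {0..T} \<times> UNIV" "dist w z < d'" for k w
    proof -
      have n: "\<bar>fst w - fst z\<bar> < d'" "norm (snd w - snd z) < d'"
        using norm_fst_snd_le[of "w - z"] w(2) by (auto simp: dist_norm)
      have "norm (A k (fst w) (snd w) - A k (fst w) (snd z)) \<le> L * norm (snd w - snd z)"
        using w by (intro AL) auto
      also have "\<dots> \<le> L * (e / (2 * (L + 1)))" using n L by (intro mult_left_mono) (auto simp: d'_def)
      also have "\<dots> < e / 2" using L e by (simp add: field_simps)
      finally have 1: "norm (A k (fst w) (snd w) - A k (fst w) (snd z)) < e / 2" .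
      have 2: "norm (A k (fst w) (snd z) - A k (fst z) (snd z)) \<le> e / 2"
        using d(2)[rule_format, of "fst z" "fst w" k] z w n by (auto simp: d'_def)
      show ?thesis
        using 1 2 norm_triangle_ineq[of "A k (fst w) (snd w) - A k (fst w) (snd z)" "A k (fst w) (snd z) - A k (fst z) (snd z)"]
        by (simp add: dist_norm)
    qed
    moreover have "0 < d'" using d L e by (simp add: d'_def)
    ultimately show "\<exists>d>0. \<forall>k. \<forall>w\<in>{0..T} \<times> UNIV. dist w z < d \<longrightarrow> dist (A k (fst w) (snd w)) (A k (fst z) (snd z)) < e"
      by blast
  qed (rule that)
  \<comment> \<open>Clamping extends the limit force to all times by its values at 0 and
    \<open>T\<close> and keeps it continuous.\<close>
  define cl where "cl t = max 0 (min T t)" for t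
  have cl: "cl t \<in> {0..T}" "\<bar>cl t - cl s\<bar> \<le> \<bar>t - s\<bar>" for t s using T by (auto simp: cl_def)
  have clid: "cl t = t" if "t \<in> {0..T}" for t using that by (simp add: cl_def)
  define G where "G t q = lim (\<lambda>k. A (\<phi> k) (cl t) q)" for t q
  have G: "(\<lambda>k. A (\<phi> k) (cl t) q) \<longlonglongrightarrow> G t q" for t q
    unfolding G_def using conv[of "(cl t, q)"] cl by (simp add: convergent_LIMSEQ_iff)
  have cl0: "0 \<le> cl t" for t using cl(1)[of t] by simp
  have Gb: "norm (G t q) \<le> b" for t q
    by (rule LIMSEQ_le_const2[OF tendsto_norm[OF G]]) (use Ab[OF cl0] in auto)
  have GL: "norm (G t q - G t q') \<le> L * norm (q - q')" for t q q'
    by (rule LIMSEQ_le_const2[OF tendsto_norm[OF tendsto_diff[OF G G]]]) (use AL[OF cl0] in auto)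
  have Gc: "continuous_on UNIV (\<lambda>t. G t q)" for q
    unfolding continuous_on_iff
  proof (intro ballI allI impI)
    fix s e :: real assume e: "0 < e"
    obtain d where d: "0 < d" "\<forall>k. \<forall>s\<in>{0..T}. \<forall>t\<in>{0..T}. \<bar>t - s\<bar> < d \<longrightarrow> norm (A k t q - A k s q) \<le> e / 2"
      using At[of "e / 2" q] e by auto
    have "dist (G t q) (G s q) < e" if "dist t s < d" for t
    proof -
      have "norm (G t q - G s q) \<le> e / 2"
      proof (rule LIMSEQ_le_const2[OF tendsto_norm[OF tendsto_diff[OF G G]]], intro exI allI impI)
        have "\<bar>cl t - cl s\<bar> < d" using cl(2)[of t s] that by (simp add: dist_real_def)
        then show "norm (A (\<phi> k) (cl t) q - A (\<phi> k) (cl s) q) \<le> e / 2" for k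
          using d(2) cl(1) by blast
      qed
      then show ?thesis using e by (simp add: dist_norm)
    qed
    then show "\<exists>d>0. \<forall>t\<in>UNIV. dist t s < d \<longrightarrow> dist (G t q) (G s q) < e" using d(1) by blast
  qed
  have regG: "regular C (kick \<Phi> G)"
    by (rule C[OF Gb GL]) (use Gc in \<open>auto intro!: exI[of _ "{}"]\<close>)
  have h\<phi>: "(\<lambda>k. h (\<phi> k)) \<longlonglongrightarrow> 0" using LIMSEQ_subseq_LIMSEQ[OF h0 \<phi>] by (simp add: o_def)
  have eps\<phi>: "(\<lambda>k. eps (\<phi> k)) \<longlonglongrightarrow> 0" using LIMSEQ_subseq_LIMSEQ[OF eps0 \<phi>] by (simp add: o_def)
  have Gconv: "(\<lambda>k. Gk (\<phi> k) t q) \<longlonglongrightarrow> G t q" for t q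
  proof -
    have "(\<lambda>k. Gk (\<phi> k) t q - A (\<phi> k) (cl t) q) \<longlonglongrightarrow> 0"
    proof (rule tendstoI)
      fix e :: real assume e: "0 < e"
      obtain d where d: "0 < d" "\<forall>k. \<forall>s\<in>{0..T}. \<forall>t\<in>{0..T}. \<bar>t - s\<bar> < d \<longrightarrow> norm (A k t q - A k s q) \<le> e / 2"
        using At[of "e / 2" q] e by auto
      have "\<forall>\<^sub>F k in sequentially. h (\<phi> k) < d" using h\<phi> d(1) by (rule order_tendstoD)
      then show "\<forall>\<^sub>F k in sequentially. dist (Gk (\<phi> k) t q - A (\<phi> k) (cl t) q) 0 < e"
      proof eventually_elim
        case (elim k)
        define j where "j = min (Suc (\<phi> k)) (nat \<lfloor>t / h (\<phi> k)\<rfloor>)"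
        have j: "j \<le> Suc (\<phi> k)" by (simp add: j_def)
        have gt: "real j * h (\<phi> k) \<in> {0..T}" "\<bar>real j * h (\<phi> k) - cl t\<bar> \<le> h (\<phi> k)"
          using grid_time_dist[OF T, of "Suc (\<phi> k)" t] by (simp_all add: j_def h_def cl_def)
        have "Gk (\<phi> k) t q = A (\<phi> k) (real j * h (\<phi> k)) q"
          unfolding Gk_def A_def j_def[symmetric] mk[OF j] ..
        moreover have "norm (A (\<phi> k) (real j * h (\<phi> k)) q - A (\<phi> k) (cl t) q) \<le> e / 2"
          using d(2) gt cl(1) elim by (meson order_le_less_trans)
        ultimately show ?case using e by simp
      qed
    qed
    from tendsto_add[OF this G[of t q]] show ?thesis by simp
  qed
  show ?thesis
  proof (rule result[of "\<lambda>k. eps (\<phi> k)" "\<lambda>k. Suc (\<phi> k)" b C G])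
    show "filterlim (\<lambda>k. Suc (\<phi> k)) at_top sequentially"
      by (rule filterlim_compose[OF filterlim_Suc filterlim_subseq[OF \<phi>]])
  next
    fix t assume t: "t \<in> {0..T}"
    have sub: "subprob (transport 0 (kick \<Phi> G) t \<mu>0)"
      by (rule subprob_transport[OF regG _ \<mu>0]) (use t in auto)
    \<comment> \<open>This closes the loop: \<open>A\<close> along the subsequence tends to
      \<open>G\<close> by construction and, by \<open>transport_converge\<close>, to the force of
      the transported measure.\<close>
    have "G t q = grad_conv W (transport 0 (kick \<Phi> G) t \<mu>0) q" for q
    proof (rule LIMSEQ_unique)
      show "(\<lambda>k. A (\<phi> k) t q) \<longlonglongrightarrow> G t q" using G[of t q] clid[OF t] by simp
      have "(\<lambda>k. \<integral>y. grad W (q - snd y) \<partial>transport (eps (\<phi> k)) (kick \<Phi> (Gk (\<phi> k))) t \<mu>0)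
          \<longlonglongrightarrow> (\<integral>y. grad W (q - snd y) \<partial>transport 0 (kick \<Phi> G) t \<mu>0)"
      proof (rule transport_converge[OF \<Phi> bar rGk regG Gkb Gb Gconv \<mu>0 tendsto_const _ eps\<phi>, where \<rho>="norm q + RW" and c=b])
        show "continuous_on UNIV (\<lambda>y. grad W (q - snd y))"
          by (rule continuous_on_compose2[OF grad_continuous[OF W(1), of UNIV]]) (auto intro!: continuous_intros)
      qed (use obs[of q] t b less_imp_le[OF eps(1)] in \<open>auto simp: observable_def\<close>)
      then show "(\<lambda>k. A (\<phi> k) t q) \<longlonglongrightarrow> grad_conv W (transport 0 (kick \<Phi> G) t \<mu>0) q"
        by (simp add: A_def grad_conv_def)
    qed
    then have "grad_conv W (transport 0 (kick \<Phi> G) t \<mu>0) = G t" by (auto simp: fun_eq_iff)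
    then show "ham_field W \<Phi> (transport 0 (kick \<Phi> G) t \<mu>0) = kick \<Phi> G t"
      using ham[OF sub, of t] by (simp add: kick_def)
    show "distr_tendsto (\<lambda>k. discr_measure W \<Phi> T \<mu>0 (eps (\<phi> k)) (Suc (\<phi> k)) t) (transport 0 (kick \<Phi> G) t \<mu>0)"
      unfolding distr_tendsto_def dk[OF t]
    proof (intro allI impI)
      fix \<psi> :: "'a \<times> 'a \<Rightarrow> real" assume \<psi>: "test_function \<psi>"
      obtain c r where c: "\<And>x. \<bar>\<psi> x\<bar> \<le> c" and r: "\<And>x. r < norm x \<Longrightarrow> \<psi> x = 0"
        using test_function_bounds[OF \<psi>] by metis
      show "(\<lambda>k. \<integral>x. \<psi> x \<partial>transport (eps (\<phi> k)) (kick \<Phi> (Gk (\<phi> k))) t \<mu>0) \<longlonglongrightarrow> (\<integral>x. \<psi> x \<partial>transport 0 (kick \<Phi> G) t \<mu>0)"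
      proof (rule transport_converge[OF \<Phi> bar rGk regG Gkb Gb Gconv \<mu>0 tendsto_const _ eps\<phi>, where \<rho>=r and c=c])
        show "\<psi> x = 0" if "r < norm (snd x)" for x
          using norm_fst_snd_le(2)[of x] that by (intro r) linarith
      qed (use t c less_imp_le[OF eps(1)] in \<open>auto intro: test_function_continuous[OF \<psi>]\<close>)
    qed
  qed (use eps eps\<phi> bar regG Gc Gb in auto)
qed

theorem theorem3p5:
  fixes W \<Phi> :: "real ^ 'd \<Rightarrow> real"
    and \<mu>0 :: "((real ^ 'd) \<times> (real ^ 'd)) measure"
    and T \<alpha>0 B B1 b2 :: real
  assumes W_C2: "Ck 2 W" and W_supp: "compact (supp W)" and W_even: "\<And>q. W (- q) = W q"
    and Phi_C2: "Ck 2 \<Phi>"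
    \<comment> \<open>the origin is excluded because \<open>0 powr b = 0\<close> for every \<open>b\<close>;
        where \<open>b2 \<ge> 0\<close> the bound at the origin follows by continuity\<close>
    and Phi_bound: "\<And>q. q \<noteq> 0 \<Longrightarrow> \<bar>\<Phi> q\<bar> \<le> B1 * norm q powr b2"
    and B_pos: "B > 0" and W_bound: "\<And>q. \<bar>W q\<bar> \<le> B" and grad_W_bound: "\<And>q. norm (grad W q) < B"
    and dyn: "dynamical_hypothesis \<Phi> B"
    and T_pos: "T > 0" and alpha_pos: "\<alpha>0 > 0"
    and mu0_borel: "sets \<mu>0 = sets borel" and mu0_mass: "emeasure \<mu>0 UNIV = 1"
    and mu0_exp: "integrable \<mu>0 (\<lambda>x. exp (\<alpha>0 * norm x))"
  shows "\<exists>(\<epsilon>::nat \<Rightarrow> real) (n::nat \<Rightarrow> nat) (\<mu>::real \<Rightarrow> ((real ^ 'd) \<times> (real ^ 'd)) measure).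
      (\<forall>k. \<epsilon> k > 0 \<and> n k \<ge> 1) \<and> \<epsilon> \<longlonglongrightarrow> 0 \<and> filterlim n at_top sequentially \<and>
      \<mu> 0 = \<mu>0 \<and>
      (\<forall>t\<in>{0..T}. distr_tendsto (\<lambda>k. discr_measure W \<Phi> T \<mu>0 (\<epsilon> k) (n k) t) (\<mu> t)) \<and>
      (\<forall>t\<in>{0..T}. sets (\<mu> t) = sets borel \<and> finite_measure (\<mu> t) \<and> emeasure (\<mu> t) UNIV \<le> 1) \<and>
      distr_continuous_on {0..T} \<mu> \<and>
      hamiltonian_ODE W \<Phi> T \<mu>"
proof -
  have \<mu>0: "subprob \<mu>0" using mu0_borel mu0_mass by (simp add: subprob_def)
  obtain \<epsilon> :: "nat \<Rightarrow> real" and n :: "nat \<Rightarrow> nat" and C G b where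
    seq: "\<And>k. 0 < \<epsilon> k" "\<And>k. 1 \<le> n k" "\<epsilon> \<longlonglongrightarrow> 0" "filterlim n at_top sequentially"
    and bar: "\<And>\<rho>. \<exists>R\<ge>\<rho>. barrier \<Phi> b R" and f: "regular C (kick \<Phi> G)"
    and G: "\<And>q. continuous_on UNIV (\<lambda>t. G t q)" "\<And>t q. norm (G t q) \<le> b"
    and ham: "\<And>t. t \<in> {0..T} \<Longrightarrow> ham_field W \<Phi> (transport 0 (kick \<Phi> G) t \<mu>0) = kick \<Phi> G t"
    and lim: "\<And>t. t \<in> {0..T} \<Longrightarrow> distr_tendsto (\<lambda>k. discr_measure W \<Phi> T \<mu>0 (\<epsilon> k) (n k) t) (transport 0 (kick \<Phi> G) t \<mu>0)"
  proof (rule discretization_limit[OF W_C2 W_supp W_bound grad_W_bound Phi_C2 dyn T_pos \<mu>0])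
  qed (rule that)
  let ?\<mu> = "\<lambda>t. transport 0 (kick \<Phi> G) t \<mu>0"
  have sub: "subprob (?\<mu> t)" if "t \<in> {0..T}" for t
    by (rule subprob_transport[OF f _ \<mu>0]) (use that in auto)
  have "hamiltonian_ODE W \<Phi> T ?\<mu>"
    by (rule kick_weak_solution[OF Phi_C2 bar f G \<mu>0 T_pos]) (use ham in auto)
  moreover have "distr_continuous_on {0..T} ?\<mu>"
    by (rule transport_distr_continuous[OF Phi_C2 bar f G(2) \<mu>0])
  moreover have "sets (?\<mu> t) = sets borel \<and> finite_measure (?\<mu> t) \<and> emeasure (?\<mu> t) UNIV \<le> 1" if "t \<in> {0..T}" for t
    using sub[OF that] subprob_finite[OF sub[OF that]] by (simp add: subprob_def)
  moreover have "?\<mu> 0 = \<mu>0" by (rule transport_0[OF f \<mu>0])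
  ultimately show ?thesis
    using seq lim by (intro exI[of _ \<epsilon>] exI[of _ n] exI[of _ ?\<mu>]) simp
qed

end
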